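(* Let $\mathbf X$ be a flag simplicial complex with connected $1$-skeleton $G(\mathbf X)$. Then the following conditions are equivalent: (a) $\mathbf X$ is weakly systolic; (b) $G(\mathbf X)$ is a weakly modular graph without induced $C_4$; (c) $G(\mathbf X)$ is a weakly modular graph with convex balls; (d) $G(\mathbf X)$ is a graph with convex balls in which any induced $5$-cycle $C_5$ is included in a $5$-wheel $W_5$ (i.e. there is a vertex adjacent to all vertices of the $5$-cycle); (e) $\mathbf X$ is simply connected, satisfies the $\widehat W_5$-condition, and does not contain an induced $C_4$.
   Context: All graphs are undirected, connected, without loops or multiple edges; $d$ is the shortest-path distance. For a graph, $B_r(x)$ (resp. $S_r(x)$) is the set of vertices at distance at most (resp. exactly) $r$ from $x$; $I(u,v)=\{x: d(u,x)+d(x,v)=d(u,v)\}$. A vertex set $A$ is convex if $I(u,v)\subseteq A$ for all $u,v\in A$. A graph has convex balls if every ball $B_r(x)$, $x$ a vertex, $r\ge 0$, is convex. A graph is weakly modular if it satisfies: the triangle condition (T): for any vertices $u,v,w$ with $1=d(v,w)<d(u,v)=d(u,w)$ there is a common neighbor $x$ of $v,w$ with $d(u,x)=d(u,v)-1$; and the quadrangle condition (Q): for any vertices $u,v,w,z$ with $d(v,z)=d(w,z)=1$ and $2=d(v,w)\le d(u,v)=d(u,w)=d(u,z)-1$ there is a common neighbor $x$ of $v,w$ with $d(u,x)=d(u,v)-1$. A simplicial complex $\mathbf X$ is flag if every set of vertices, each pair of which lies in a common simplex, is contained in a simplex. $G(\mathbf X)$ denotes its $1$-skeleton, and distances, balls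 and spheres in $\mathbf X$ are those of $G(\mathbf X)$. The link $\mathrm{lk}(\sigma,\mathbf X)$ consists of simplices $\sigma'$ with $\sigma\cap\sigma'=\emptyset$ and $\sigma\cup\sigma'\in\mathbf X$. For a vertex $v$ and an integer $n\ge 0$, a flag complex $\mathbf X$ satisfies $SD_n(v)$ if for each $0\le i\le n$ and each (nonempty) simplex $\sigma$ all of whose vertices lie in $S_{i+1}(v)$, the set $V(\mathrm{lk}(\sigma,\mathbf X))\cap B_i(v)$ spans a nonempty simplex of $\mathbf X$. A flag complex is weakly systolic if it satisfies $SD_n(v)$ for all vertices $v$ and all natural numbers $n$. $C_k$ is the $k$-cycle; the $k$-wheel $W_k$ is a $k$-cycle $x_1,\dots,x_k$ together with a central vertex $c$ adjacent to all the $x_i$. $\widehat W_5$ is $W_5$ together with a further vertex $a\neq c$ adjacent to two consecutive vertices $x_i,x_{i+1}$ of the $5$-cycle and to no other vertex of the wheel. The $\widehat W_5$-condition: for any induced $\widehat W_5$ in $G(\mathbf X)$ there is a vertex $v\notin\widehat W_5$ adjacent in $G(\mathbf X)$ to all vertices of that $\widehat W_5$. *)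

theory Defs
  imports "HOL-Analysis.Analysis"
begin

text \<open>An undirected graph without loops or multiple edges is given by its vertex set and the
  symmetric, irreflexive relation of adjacent pairs. Infinite graphs are allowed.\<close>

record 'a sgraph =
  verts :: "'a set"
  edges :: "('a \<times> 'a) set"

definition simple_graph :: "'a sgraph \<Rightarrow> bool" where
  "simple_graph G \<longleftrightarrow> edges G \<subseteq> verts G \<times> verts G \<and> sym (edges G) \<and> irrefl (edges G)"

definition connected_graph :: "'a sgraph \<Rightarrow> bool" where
  "connected_graph G \<longleftrightarrow> (\<forall>u\<in>verts G. \<forall>v\<in>verts G. (u, v) \<in> (edges G)\<^sup>*)"

text \<open>The least length of a walk; meaningful only for vertices of the same component.\<close>

definition gdist :: "'a sgraph \<Rightarrow> 'a \<Rightarrow> 'a \<Rightarrow> nat" where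
  "gdist G u v = (LEAST n. (u, v) \<in> edges G ^^ n)"

definition gball :: "'a sgraph \<Rightarrow> nat \<Rightarrow> 'a \<Rightarrow> 'a set" where
  "gball G r x = {y \<in> verts G. gdist G x y \<le> r}"

definition gsphere :: "'a sgraph \<Rightarrow> nat \<Rightarrow> 'a \<Rightarrow> 'a set" where
  "gsphere G r x = {y \<in> verts G. gdist G x y = r}"

definition ginterval :: "'a sgraph \<Rightarrow> 'a \<Rightarrow> 'a \<Rightarrow> 'a set" where
  "ginterval G u v = {x \<in> verts G. gdist G u x + gdist G x v = gdist G u v}"

definition gconvex :: "'a sgraph \<Rightarrow> 'a set \<Rightarrow> bool" where
  "gconvex G A \<longleftrightarrow> (\<forall>u\<in>A. \<forall>v\<in>A. ginterval G u v \<subseteq> A)"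

definition has_convex_balls :: "'a sgraph \<Rightarrow> bool" where
  "has_convex_balls G \<longleftrightarrow> (\<forall>x\<in>verts G. \<forall>r. gconvex G (gball G r x))"

definition triangle_condition :: "'a sgraph \<Rightarrow> bool" where
  "triangle_condition G \<longleftrightarrow>
    (\<forall>u\<in>verts G. \<forall>v\<in>verts G. \<forall>w\<in>verts G.
      1 = gdist G v w \<and> gdist G v w < gdist G u v \<and> gdist G u v = gdist G u w \<longrightarrow>
      (\<exists>x\<in>verts G. (v, x) \<in> edges G \<and> (w, x) \<in> edges G \<and> gdist G u x = gdist G u v - 1))"

definition quadrangle_condition :: "'a sgraph \<Rightarrow> bool" where
  "quadrangle_condition G \<longleftrightarrow>
    (\<forall>u\<in>verts G. \<forall>v\<in>verts G. \<forall>w\<in>verts G. \<forall>z\<in>verts G.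
      gdist G v z = 1 \<and> gdist G w z = 1 \<and> 2 = gdist G v w \<and> gdist G v w \<le> gdist G u v \<and>
      gdist G u v = gdist G u w \<and> gdist G u w = gdist G u z - 1 \<longrightarrow>
      (\<exists>x\<in>verts G. (v, x) \<in> edges G \<and> (w, x) \<in> edges G \<and> gdist G u x = gdist G u v - 1))"

definition weakly_modular :: "'a sgraph \<Rightarrow> bool" where
  "weakly_modular G \<longleftrightarrow> triangle_condition G \<and> quadrangle_condition G"

definition induced_copy :: "'b sgraph \<Rightarrow> 'a sgraph \<Rightarrow> ('b \<Rightarrow> 'a) \<Rightarrow> bool" where
  "induced_copy H G f \<longleftrightarrow>
    inj_on f (verts H) \<and> f ` verts H \<subseteq> verts G \<and>
    (\<forall>i\<in>verts H. \<forall>j\<in>verts H. (f i, f j) \<in> edges G \<longleftrightarrow> (i, j) \<in> edges H)"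

text \<open>The \<open>k\<close>-cycle on \<open>0, \<dots>, k - 1\<close> (for \<open>k \<ge> 3\<close>); the wheel adds the centre \<open>k\<close>.\<close>

definition cycle_graph :: "nat \<Rightarrow> nat sgraph" where
  "cycle_graph k =
    \<lparr>verts = {..<k}, edges = {(i, j). i < k \<and> j < k \<and> (j = Suc i mod k \<or> i = Suc j mod k)}\<rparr>"

definition wheel_graph :: "nat \<Rightarrow> nat sgraph" where
  "wheel_graph k =
    \<lparr>verts = insert k {..<k}, edges = edges (cycle_graph k) \<union> {k} \<times> {..<k} \<union> {..<k} \<times> {k}\<rparr>"

text \<open>The 5-wheel with one more vertex \<open>6\<close>, adjacent exactly to the consecutive rim vertices
  \<open>0\<close> and \<open>1\<close>; by rotational symmetry this choice is no restriction.\<close>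

definition W5hat_graph :: "nat sgraph" where
  "W5hat_graph =
    \<lparr>verts = insert 6 (verts (wheel_graph 5)),
     edges = edges (wheel_graph 5) \<union> {6} \<times> {0, 1} \<union> {0, 1} \<times> {6}\<rparr>"

definition no_induced_C4 :: "'a sgraph \<Rightarrow> bool" where
  "no_induced_C4 G \<longleftrightarrow> (\<nexists>f. induced_copy (cycle_graph 4) G f)"

definition induced_C5_in_W5 :: "'a sgraph \<Rightarrow> bool" where
  "induced_C5_in_W5 G \<longleftrightarrow>
    (\<forall>f. induced_copy (cycle_graph 5) G f \<longrightarrow>
      (\<exists>c\<in>verts G. \<forall>i\<in>verts (cycle_graph 5). (c, f i) \<in> edges G))"

definition W5hat_condition :: "'a sgraph \<Rightarrow> bool" where
  "W5hat_condition G \<longleftrightarrow>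
    (\<forall>f. induced_copy W5hat_graph G f \<longrightarrow>
      (\<exists>v\<in>verts G. v \<notin> f ` verts W5hat_graph \<and> (\<forall>i\<in>verts W5hat_graph. (v, f i) \<in> edges G)))"

text \<open>Simplices are finite; the dimension may be infinite, and the empty set counts as a simplex.
  The vertex set is \<open>\<Union>K\<close>.\<close>

definition abstract_simplicial_complex :: "'a set set \<Rightarrow> bool" where
  "abstract_simplicial_complex K \<longleftrightarrow>
    (\<forall>\<sigma>\<in>K. finite \<sigma>) \<and> (\<forall>\<sigma>\<in>K. \<forall>\<tau>. \<tau> \<subseteq> \<sigma> \<longrightarrow> \<tau> \<in> K)"

text \<open>The set \<open>A\<close> is not assumed to be finite, so a flag complex has no infinite clique in its
  1-skeleton.\<close>

definition flag_complex :: "'a set set \<Rightarrow> bool" where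
  "flag_complex K \<longleftrightarrow> abstract_simplicial_complex K \<and>
    (\<forall>A. (\<forall>x\<in>A. \<forall>y\<in>A. \<exists>\<sigma>\<in>K. x \<in> \<sigma> \<and> y \<in> \<sigma>) \<longrightarrow> (\<exists>\<sigma>\<in>K. A \<subseteq> \<sigma>))"

definition one_skeleton :: "'a set set \<Rightarrow> 'a sgraph" where
  "one_skeleton K = \<lparr>verts = \<Union>K, edges = {(x, y). x \<noteq> y \<and> {x, y} \<in> K}\<rparr>"

lemma simple_graph_one_skeleton: "simple_graph (one_skeleton K)"
  by (auto simp: simple_graph_def one_skeleton_def sym_def irrefl_def insert_commute)

definition link :: "'a set \<Rightarrow> 'a set set \<Rightarrow> 'a set set" where
  "link \<sigma> K = {\<tau> \<in> K. \<sigma> \<inter> \<tau> = {} \<and> \<sigma> \<union> \<tau> \<in> K}"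

definition SD :: "'a set set \<Rightarrow> nat \<Rightarrow> 'a \<Rightarrow> bool" where
  "SD K n v \<longleftrightarrow>
    (\<forall>i\<le>n. \<forall>\<sigma>\<in>K. \<sigma> \<noteq> {} \<and> \<sigma> \<subseteq> gsphere (one_skeleton K) (i + 1) v \<longrightarrow>
      \<Union>(link \<sigma> K) \<inter> gball (one_skeleton K) i v \<in> K \<and>
      \<Union>(link \<sigma> K) \<inter> gball (one_skeleton K) i v \<noteq> {})"

definition weakly_systolic :: "'a set set \<Rightarrow> bool" where
  "weakly_systolic K \<longleftrightarrow> flag_complex K \<and> (\<forall>v\<in>\<Union>K. \<forall>n. SD K n v)"

text \<open>A point is given by its barycentric coordinates \<open>p :: 'a \<Rightarrow> real\<close>.\<close>

definition realization_points :: "'a set set \<Rightarrow> ('a \<Rightarrow> real) set" where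
  "realization_points K =
    {p. (\<forall>v. 0 \<le> p v) \<and> {v. p v \<noteq> 0} \<in> K \<and> (\<Sum>v | p v \<noteq> 0. p v) = 1}"

definition closed_simplex :: "'a set set \<Rightarrow> 'a set \<Rightarrow> ('a \<Rightarrow> real) set" where
  "closed_simplex K \<sigma> = {p \<in> realization_points K. {v. p v \<noteq> 0} \<subseteq> \<sigma>}"

text \<open>The weak (coherent) topology: a set is open iff it meets every closed simplex in a relatively
  open set. On the closed simplex of a finite set, the product topology of \<open>'a \<Rightarrow> real\<close> induces
  the usual Euclidean topology.\<close>

definition realization :: "'a set set \<Rightarrow> ('a \<Rightarrow> real) topology" where
  "realization K = topology (\<lambda>U. U \<subseteq> realization_points K \<and>
    (\<forall>\<sigma>\<in>K. openin (top_of_set (closed_simplex K \<sigma>)) (U \<inter> closed_simplex K \<sigma>)))"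

lemma openin_realization:
  "openin (realization K) U \<longleftrightarrow> U \<subseteq> realization_points K \<and>
    (\<forall>\<sigma>\<in>K. openin (top_of_set (closed_simplex K \<sigma>)) (U \<inter> closed_simplex K \<sigma>))"
proof -
  let ?P = "\<lambda>U. U \<subseteq> realization_points K \<and>
    (\<forall>\<sigma>\<in>K. openin (top_of_set (closed_simplex K \<sigma>)) (U \<inter> closed_simplex K \<sigma>))"
  have "?P (S \<inter> T)" if "?P S" "?P T" for S T
  proof -
    have "(S \<inter> T) \<inter> C = (S \<inter> C) \<inter> (T \<inter> C)" for C
      by blast
    then show ?thesis
      using that by (auto simp: openin_Int)
  qed
  moreover have "?P (\<Union>\<U>)" if "\<forall>S\<in>\<U>. ?P S" for \<U>
  proof -
    have "openin (top_of_set C) (\<Union>\<U> \<inter> C)"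
      if "\<forall>S\<in>\<U>. openin (top_of_set C) (S \<inter> C)" for C
      unfolding Int_Union2 using that by (intro openin_Union) blast
    then show ?thesis
      using that by blast
  qed
  ultimately have "istopology ?P"
    unfolding istopology_def by blast
  then show ?thesis
    by (simp add: realization_def)
qed

lemma topspace_realization: "topspace (realization K) = realization_points K"
proof -
  have "openin (realization K) (realization_points K)"
    by (auto simp: openin_realization closed_simplex_def Int_absorb1)
  then show ?thesis
    by (metis openin_realization openin_subset openin_topspace subset_antisym)
qed

definition simply_connected_space :: "'b topology \<Rightarrow> bool" where
  "simply_connected_space X \<longleftrightarrow> path_connected_space X \<and>
    (\<forall>f. continuous_map (top_of_set (sphere (0::complex) 1)) X f \<longrightarrow>
      (\<exists>g. continuous_map (top_of_set (cball (0::complex) 1)) X g \<and>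
           (\<forall>z\<in>sphere 0 1. g z = f z)))"

end

(* All five conditions are equivalent to two conditions on the graph, for every base point v: two
   neighbours of a vertex a that are closer to v than a are equal or adjacent (vertex_cond), and
   adjacent vertices at the same distance n + 1 from v have a common neighbour at distance n
   (edge_cond).

   Given these, a closed walk in the ball of radius i + 1 around v can be pushed into the ball of
   radius i, which yields convexity of balls as well as contractibility of loops.

   Conversely, the absence of induced 4-cycles and the W5-hat condition suffice to build, one sphere
   after the other, a covering graph that satisfies both conditions at its base point. If the
   realization is simply connected, every closed walk lifts to a closed walk (a filling disc is
   discretised by a fine polar grid, using a Lebesgue number for the cover by open stars), so the
   cover is trivial and the two conditions hold in the graph itself. *)

theory Submission
  imports Defs
begin

subsection \<open>Distances and small induced subgraphs\<close>

text \<open>The cover is graded: it satisfies the two conditions only with respect to its own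
  levels, so a new sphere can be attached knowing just the last one. Once the covering map is seen
  to be injective, levels turn into distances, and since the base point is arbitrary, one cover per
  vertex suffices. Attaching a sphere is a quotient problem. Edges that do not lift yet must receive
  a common new end point when their lower ends are adjacent and they lead to the same vertex of
  \<open>G\<close>. This relation has to be transitive, and that is the one place where the W5-hat
  condition enters. The topology reduces to two facts. A compact set involves finitely many
  vertices, so a map from the circle or the disc can be treated through its coordinates in a product
  of lines. Two maps whose values always lie in a common simplex are joined by a straight line
  homotopy, which preserves the property of extending to the disc.\<close>

lemma verts_C5: "verts (cycle_graph 5) = {0,1,2,3,4}"
  by (auto simp: cycle_graph_def)

lemma verts_W5hat: "verts W5hat_graph = {0,1,2,3,4,5,6}"
  by (auto simp: W5hat_graph_def wheel_graph_def cycle_graph_def)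

locale conn_graph =
  fixes G :: "'a sgraph"
  assumes simple: "simple_graph G" and connected: "connected_graph G"
begin

abbreviation V where "V \<equiv> verts G"
abbreviation adj where "adj u v \<equiv> (u, v) \<in> edges G"
abbreviation adjeq where "adjeq u v \<equiv> u = v \<or> adj u v"
abbreviation gd where "gd \<equiv> gdist G"

lemma adj_sym: "adj u v \<Longrightarrow> adj v u"
  using simple by (auto simp: simple_graph_def sym_def)

lemma adj_irrefl [simp]: "\<not> adj u u"
  using simple by (auto simp: simple_graph_def irrefl_def)

lemma adj_verts: "adj u v \<Longrightarrow> u \<in> V" "adj u v \<Longrightarrow> v \<in> V"
  using simple by (auto simp: simple_graph_def)

lemma gd_le: "(u, v) \<in> edges G ^^ n \<Longrightarrow> gd u v \<le> n"
  unfolding gdist_def by (rule Least_le)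

lemma gd_walk: assumes "u \<in> V" "v \<in> V" shows "(u, v) \<in> edges G ^^ gd u v"
proof -
  obtain n where "(u, v) \<in> edges G ^^ n"
    using connected assms unfolding connected_graph_def by (meson rtrancl_imp_relpow)
  then show ?thesis unfolding gdist_def by (rule LeastI)
qed

lemma gd_refl [simp]: "gd u u = 0"
  using gd_le[of u u 0] by simp

lemma gd_eq_0: "u \<in> V \<Longrightarrow> v \<in> V \<Longrightarrow> gd u v = 0 \<longleftrightarrow> u = v"
  using gd_walk[of u v] by auto

lemma gd_triangle: "u \<in> V \<Longrightarrow> v \<in> V \<Longrightarrow> w \<in> V \<Longrightarrow> gd u w \<le> gd u v + gd v w"
  by (rule gd_le) (use gd_walk[of u v] gd_walk[of v w] in \<open>auto simp: relpow_add\<close>)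

lemma gd_adj: "adj u v \<Longrightarrow> gd u v = 1"
  using gd_le[of u v 1] gd_eq_0[of u v] adj_verts[of u v] adj_irrefl by fastforce

lemma gd_eq_1: "u \<in> V \<Longrightarrow> v \<in> V \<Longrightarrow> gd u v = 1 \<longleftrightarrow> adj u v"
  using gd_adj gd_walk[of u v] by auto

lemma gd_step: "v \<in> V \<Longrightarrow> adj u w \<Longrightarrow> gd v w \<le> Suc (gd v u)"
  using gd_triangle[of v u w] gd_adj[of u w] adj_verts by fastforce

lemma gd_pred:
  assumes "u \<in> V" "v \<in> V" "gd u v = Suc n"
  obtains w where "adj w v" "gd u w = n"
proof -
  obtain w where w: "(u, w) \<in> edges G ^^ n" "adj w v"
    using gd_walk[OF assms(1,2)] assms(3) by auto
  have "gd u w \<le> n" using gd_le w(1) .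
  moreover have "Suc n \<le> Suc (gd u w)" using gd_step[OF assms(1) w(2)] assms(3) by simp
  ultimately show ?thesis using that[OF w(2)] by simp
qed

lemma gd_eq_2: "u \<in> V \<Longrightarrow> v \<in> V \<Longrightarrow> gd u v = 2 \<longleftrightarrow> u \<noteq> v \<and> \<not> adj u v \<and> (\<exists>w. adj u w \<and> adj w v)"
proof
  assume a: "u \<in> V" "v \<in> V" "gd u v = 2"
  then obtain w where w: "adj w v" "gd u w = 1"
    using gd_pred[of u v 1] by auto
  then have "adj u w" using gd_eq_1 adj_verts a by blast
  moreover have "\<not> adj u v" using gd_adj a by fastforce
  moreover have "u \<noteq> v" using a(3) by auto
  ultimately show "u \<noteq> v \<and> \<not> adj u v \<and> (\<exists>w. adj u w \<and> adj w v)" using w by blast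
next
  assume a: "u \<in> V" "v \<in> V" "u \<noteq> v \<and> \<not> adj u v \<and> (\<exists>w. adj u w \<and> adj w v)"
  then obtain w where w: "adj u w" "adj w v" by blast
  have "gd u v \<le> 2" using gd_step[OF a(1) w(2)] gd_adj[OF w(1)] by simp
  moreover have "gd u v \<noteq> 0" "gd u v \<noteq> 1" using a gd_eq_0 gd_eq_1 by blast+
  ultimately show "gd u v = 2" by linarith
qed

text \<open>Restricted to a single vertex and to edges, \<open>SD\<^sub>n(v)\<close> becomes a condition on the graph.\<close>

definition vertex_cond :: "'a \<Rightarrow> bool" where
  "vertex_cond v \<longleftrightarrow> (\<forall>a s t. adj a s \<and> adj a t \<and> gd v a = Suc (gd v s) \<and> gd v s = gd v t \<longrightarrow> adjeq s t)"

definition edge_cond :: "'a \<Rightarrow> bool" where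
  "edge_cond v \<longleftrightarrow> (\<forall>a b n. adj a b \<and> gd v a = Suc n \<and> gd v b = Suc n \<longrightarrow>
     (\<exists>c. adj c a \<and> adj c b \<and> gd v c = n))"

definition vertex_edge where
  "vertex_edge \<longleftrightarrow> (\<forall>v\<in>V. vertex_cond v \<and> edge_cond v)"

lemma vertex_condD:
  "vertex_cond v \<Longrightarrow> adj a s \<Longrightarrow> adj a t \<Longrightarrow> gd v a = Suc n \<Longrightarrow> gd v s = n \<Longrightarrow> gd v t = n \<Longrightarrow> adjeq s t"
  unfolding vertex_cond_def by metis

lemma edge_condD:
  assumes "edge_cond v" "adj a b" "gd v a = Suc n" "gd v b = Suc n"
  obtains c where "adj c a" "adj c b" "gd v c = n"
  using assms unfolding edge_cond_def by metis

text \<open>No distinctness is required: a degenerate closed walk of length 4 satisfies the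
  disjunction trivially.\<close>

definition no_C4 where
  "no_C4 \<longleftrightarrow> (\<forall>a b c d. adj a b \<and> adj b c \<and> adj c d \<and> adj d a \<longrightarrow> adjeq a c \<or> adjeq b d)"

lemma no_C4D: "no_C4 \<Longrightarrow> adj a b \<Longrightarrow> adj b c \<Longrightarrow> adj c d \<Longrightarrow> adj d a \<Longrightarrow> a \<noteq> c \<Longrightarrow> \<not> adj a c \<Longrightarrow> b \<noteq> d \<Longrightarrow> adj b d"
  unfolding no_C4_def by blast

lemma no_induced_C4_iff: "no_induced_C4 G \<longleftrightarrow> no_C4"
proof
  assume n: "no_induced_C4 G"
  show no_C4 unfolding no_C4_def
  proof (intro allI impI, rule ccontr)
    fix a b c d assume *: "adj a b \<and> adj b c \<and> adj c d \<and> adj d a" "\<not> (adjeq a c \<or> adjeq b d)"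
    have "induced_copy (cycle_graph 4) G (\<lambda>i. [a,b,c,d] ! i)"
    proof -
      have 4: "{..<4::nat} = {0,1,2,3}" by auto
      have "adj a d" "adj b a" "adj c b" "adj d c" using * adj_sym by auto
      moreover have "\<not> adj c a" "\<not> adj d b" using * adj_sym by blast+
      moreover have "a \<noteq> b" "b \<noteq> c" "c \<noteq> d" "d \<noteq> a" using * by auto
      moreover have "{a,b,c,d} \<subseteq> V" using * adj_verts by blast
      ultimately show ?thesis unfolding induced_copy_def cycle_graph_def inj_on_def
        using * by (simp add: 4) auto
    qed
    then show False using n unfolding no_induced_C4_def by blast
  qed
next
  assume n: no_C4
  show "no_induced_C4 G" unfolding no_induced_C4_def
  proof
    assume "\<exists>f. induced_copy (cycle_graph 4) G f"
    then obtain f where f: "induced_copy (cycle_graph 4) G f" by blast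
    have e: "adj (f i) (f j) \<longleftrightarrow> (i, j) \<in> edges (cycle_graph 4)" if "i < 4" "j < 4" for i j
      using f that unfolding induced_copy_def cycle_graph_def by auto
    have i: "f i = f j \<longleftrightarrow> i = j" if "i < 4" "j < 4" for i j
      using f that unfolding induced_copy_def cycle_graph_def inj_on_def by auto
    have "adj (f 0) (f 1)" "adj (f 1) (f 2)" "adj (f 2) (f 3)" "adj (f 3) (f 0)"
      "\<not> adj (f 0) (f 2)" "\<not> adj (f 1) (f 3)"
      by (auto simp: e cycle_graph_def)
    moreover have "f 0 \<noteq> f 2" "f 1 \<noteq> f 3" by (auto simp: i)
    ultimately show False using n unfolding no_C4_def by blast
  qed
qed

lemma induced_C5_D:
  assumes f: "induced_copy (cycle_graph 5) G f"
  shows "adj (f 0) (f 1)" "adj (f 1) (f 2)" "adj (f 2) (f 3)" "adj (f 3) (f 4)" "adj (f 4) (f 0)"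
    "\<not> adjeq (f 0) (f 2)" "\<not> adjeq (f 0) (f 3)" "\<not> adjeq (f 1) (f 3)" "\<not> adjeq (f 1) (f 4)" "\<not> adjeq (f 2) (f 4)"
proof -
  have e: "adj (f i) (f j) \<longleftrightarrow> (i, j) \<in> edges (cycle_graph 5)" if "i < 5" "j < 5" for i j
    using f that unfolding induced_copy_def cycle_graph_def by auto
  have i: "f i = f j \<longleftrightarrow> i = j" if "i < 5" "j < 5" for i j
    using f that unfolding induced_copy_def cycle_graph_def inj_on_def by auto
  show "adj (f 0) (f 1)" "adj (f 1) (f 2)" "adj (f 2) (f 3)" "adj (f 3) (f 4)" "adj (f 4) (f 0)"
    "\<not> adjeq (f 0) (f 2)" "\<not> adjeq (f 0) (f 3)" "\<not> adjeq (f 1) (f 3)" "\<not> adjeq (f 1) (f 4)" "\<not> adjeq (f 2) (f 4)"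
    by (auto simp: e i cycle_graph_def)
qed

lemma induced_C5_I:
  assumes "adj a b" "adj b c" "adj c d" "adj d e" "adj e a"
    "\<not> adjeq a c" "\<not> adjeq a d" "\<not> adjeq b d" "\<not> adjeq b e" "\<not> adjeq c e"
  shows "induced_copy (cycle_graph 5) G (\<lambda>i. [a,b,c,d,e] ! i)"
proof -
  have 5: "{..<5::nat} = {0,1,2,3,4}" by auto
  have "adj a e" "adj b a" "adj c b" "adj d c" "adj e d" using assms adj_sym by auto
  moreover have "\<not> adj c a" "\<not> adj d a" "\<not> adj d b" "\<not> adj e b" "\<not> adj e c"
    using assms adj_sym by blast+
  moreover have "a \<noteq> b" "b \<noteq> c" "c \<noteq> d" "d \<noteq> e" "e \<noteq> a" using assms by auto
  moreover have "{a,b,c,d,e} \<subseteq> V" using assms adj_verts by blast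
  ultimately show ?thesis unfolding induced_copy_def cycle_graph_def inj_on_def
    using assms by (simp add: 5) auto
qed

lemma induced_W5hat_D:
  assumes l: "induced_copy W5hat_graph G f"
  shows "induced_copy (cycle_graph 5) G f" "\<And>i. i < 5 \<Longrightarrow> adj (f 5) (f i)"
    "adj (f 6) (f 0)" "adj (f 6) (f 1)" "\<not> adjeq (f 6) (f 2)" "\<not> adjeq (f 6) (f 3)"
    "\<not> adjeq (f 6) (f 4)" "\<not> adjeq (f 6) (f 5)"
proof -
  have V: "verts W5hat_graph = insert 6 (insert 5 {..<5})" "verts (cycle_graph 5) = {..<5}"
    by (auto simp: W5hat_graph_def wheel_graph_def cycle_graph_def)
  have e: "adj (f i) (f j) \<longleftrightarrow> (i,j) \<in> edges W5hat_graph" if "i < 7" "j < 7" for i j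
  proof -
    have "i \<in> verts W5hat_graph" "j \<in> verts W5hat_graph" unfolding V(1) using that by auto
    then show ?thesis using l unfolding induced_copy_def by blast
  qed
  have i: "inj_on f (insert 6 (insert 5 {..<5}))" "f ` (insert 6 (insert 5 {..<5})) \<subseteq> V"
    using l unfolding induced_copy_def V(1) by blast+
  show "induced_copy (cycle_graph 5) G f" unfolding induced_copy_def V
  proof (intro conjI ballI)
    show "inj_on f {..<5}" by (rule inj_on_subset[OF i(1)]) auto
    show "f ` {..<5} \<subseteq> V" using i(2) by auto
    fix i j :: nat assume "i \<in> {..<5}" "j \<in> {..<5}"
    then have "i < 7" "j < 7" "i \<noteq> 5" "j \<noteq> 5" "i \<noteq> 6" "j \<noteq> 6" by auto
    then show "(adj (f i) (f j)) = ((i, j) \<in> edges (cycle_graph 5))"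
      by (simp add: e W5hat_graph_def wheel_graph_def)
  qed
  show "adj (f 5) (f i)" if "i < 5" for i using that by (simp add: e W5hat_graph_def wheel_graph_def)
  have n: "f 6 \<noteq> f 2" "f 6 \<noteq> f 3" "f 6 \<noteq> f 4" "f 6 \<noteq> f 5"
    using inj_onD[OF i(1), of 6 2] inj_onD[OF i(1), of 6 3] inj_onD[OF i(1), of 6 4] inj_onD[OF i(1), of 6 5] by auto
  show "adj (f 6) (f 0)" "adj (f 6) (f 1)" "\<not> adjeq (f 6) (f 2)" "\<not> adjeq (f 6) (f 3)"
    "\<not> adjeq (f 6) (f 4)" "\<not> adjeq (f 6) (f 5)"
    using n by (simp_all add: e W5hat_graph_def wheel_graph_def cycle_graph_def)
qed

text \<open>The rim is \<open>a\<close> to \<open>e\<close> in cyclic order, \<open>x\<close> is the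
  centre, and \<open>y\<close> is attached to the rim edge \<open>a b\<close>.\<close>

lemma induced_W5hat_I:
  assumes "adj a b" "adj b c" "adj c d" "adj d e" "adj e a"
    "\<not> adjeq a c" "\<not> adjeq a d" "\<not> adjeq b d" "\<not> adjeq b e" "\<not> adjeq c e"
    "adj x a" "adj x b" "adj x c" "adj x d" "adj x e"
    "adj y a" "adj y b" "\<not> adjeq y c" "\<not> adjeq y d" "\<not> adjeq y e" "\<not> adjeq y x"
  shows "induced_copy W5hat_graph G (\<lambda>i. [a,b,c,d,e,x,y] ! i)"
proof -
  have 1: "adj a e" "adj b a" "adj c b" "adj d c" "adj e d" "adj a x" "adj b x" "adj c x" "adj d x" "adj e x"
    "adj a y" "adj b y" using assms adj_sym by auto
  have 2: "\<not> adj c a" "\<not> adj d a" "\<not> adj d b" "\<not> adj e b" "\<not> adj e c" "\<not> adj c y" "\<not> adj d y" "\<not> adj e y" "\<not> adj x y"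
    using assms adj_sym by blast+
  have 3: "a \<noteq> b" "b \<noteq> c" "c \<noteq> d" "d \<noteq> e" "e \<noteq> a" "x \<noteq> a" "x \<noteq> b" "x \<noteq> c" "x \<noteq> d" "x \<noteq> e" "y \<noteq> a" "y \<noteq> b"
    using assms by auto
  have 4: "{a,b,c,d,e,x,y} \<subseteq> V" using assms adj_verts by blast
  show ?thesis unfolding induced_copy_def inj_on_def verts_W5hat
  proof (intro conjI)
    show "\<forall>i\<in>{0, 1, 2, 3, 4, 5, 6}. \<forall>j\<in>{0, 1, 2, 3, 4, 5, 6}.
       ([a, b, c, d, e, x, y] ! i, [a, b, c, d, e, x, y] ! j) \<in> edges G \<longleftrightarrow> (i, j) \<in> edges W5hat_graph"
      using assms 1 2 by (simp add: W5hat_graph_def wheel_graph_def cycle_graph_def)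
    show "\<forall>i\<in>{0, 1, 2, 3, 4, 5, 6}. \<forall>j\<in>{0, 1, 2, 3, 4, 5, 6}.
       [a, b, c, d, e, x, y] ! i = [a, b, c, d, e, x, y] ! j \<longrightarrow> i = j"
      using assms 3 3[symmetric] by simp auto
    show "(!) [a, b, c, d, e, x, y] ` {0, 1, 2, 3, 4, 5, 6} \<subseteq> V" using 4 by simp
  qed
qed

end

subsection \<open>Weak modularity, convex balls and pentagons\<close>

context conn_graph begin

text \<open>Seen from \<open>a\<close>, a non-adjacent opposite vertex \<open>c\<close> has distance
  2, and \<open>b\<close> and \<open>d\<close> are two neighbours of it one level below, so
  \<open>vertex_cond a\<close> joins them.\<close>

lemma vertex_edge_no_C4:
  assumes ve: vertex_edge shows no_C4
  unfolding no_C4_def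
proof (intro allI impI, rule ccontr)
  fix a b c d assume *: "adj a b \<and> adj b c \<and> adj c d \<and> adj d a" "\<not> (adjeq a c \<or> adjeq b d)"
  have V: "a \<in> V" "c \<in> V" using * adj_verts by blast+
  then have "gd a c = Suc 1" using gd_eq_2[of a c] * by auto
  moreover have "gd a b = 1" "gd a d = 1" using * gd_adj adj_sym by blast+
  moreover have "adj c b" "adj c d" using * adj_sym by auto
  moreover have "vertex_cond a" using ve V unfolding vertex_edge_def by blast
  ultimately have "adjeq b d" by (metis vertex_condD)
  then show False using * by blast
qed

lemma triangle_conditionD:
  assumes "triangle_condition G" "u \<in> V" "adj a b" "gd u a = Suc n" "gd u b = Suc n"
  shows "\<exists>c. adj c a \<and> adj c b \<and> gd u c = n"
proof (cases n)
  \<comment> \<open>The triangle condition speaks only of distances above 1; at distance 1 the base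
    point itself is the common neighbour.\<close>
  case 0
  then have "adj u a" "adj u b" using gd_eq_1 assms adj_verts by (metis One_nat_def)+
  then show ?thesis using 0 by auto
next
  case (Suc m)
  have "a \<in> V" "b \<in> V" using adj_verts assms by blast+
  moreover have "1 = gdist G a b \<and> gdist G a b < gdist G u a \<and> gdist G u a = gdist G u b"
    using gd_adj assms Suc by simp
  ultimately obtain x where "adj a x" "adj b x" "gd u x = gd u a - 1"
    using assms(1,2) unfolding triangle_condition_def by blast
  then show ?thesis using adj_sym assms by auto
qed

lemma triangle_condition_iff: "triangle_condition G \<longleftrightarrow> (\<forall>u\<in>V. edge_cond u)"
proof
  assume "triangle_condition G"
  then show "\<forall>u\<in>V. edge_cond u" unfolding edge_cond_def using triangle_conditionD by blast
next
  assume e: "\<forall>u\<in>V. edge_cond u"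
  show "triangle_condition G" unfolding triangle_condition_def
  proof (intro ballI impI, elim conjE)
    fix u v w assume *: "u \<in> V" "v \<in> V" "w \<in> V" "1 = gdist G v w" "gdist G v w < gdist G u v" "gdist G u v = gdist G u w"
    then obtain n where n: "gd u v = Suc n" by (metis Suc_pred' less_nat_zero_code neq0_conv)
    have "adj v w" using * gd_eq_1 by metis
    then obtain c where "adj c v" "adj c w" "gd u c = n"
      using e * n edge_condD[of u v w n] by metis
    then show "\<exists>x\<in>V. adj v x \<and> adj w x \<and> gd u x = gd u v - 1"
      using n adj_sym adj_verts by (intro bexI[of _ c]) auto
  qed
qed

text \<open>The quadrangle condition holds vacuously: \<open>vertex_cond\<close> makes
  \<open>v\<close> and \<open>w\<close> equal or adjacent, against their distance 2.\<close>

lemma vertex_edge_weakly_modular: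
  assumes ve: vertex_edge shows "weakly_modular G"
  unfolding weakly_modular_def
proof
  show "triangle_condition G" using ve unfolding triangle_condition_iff vertex_edge_def by blast
  show "quadrangle_condition G" unfolding quadrangle_condition_def
  proof (intro ballI impI, elim conjE)
    fix u v w z assume *: "u \<in> V" "v \<in> V" "w \<in> V" "z \<in> V" "gd v z = 1" "gd w z = 1" "2 = gd v w" 
      "gd v w \<le> gd u v" "gd u v = gd u w" "gd u w = gd u z - 1"
    have a: "adj z v" "adj z w" using * gd_eq_1 adj_sym by metis+
    moreover have "gd u z = Suc (gd u v)" using * by linarith
    moreover have "vertex_cond u" using ve * unfolding vertex_edge_def by blast
    ultimately have "adjeq v w" using * by (metis vertex_condD)
    then show "\<exists>x\<in>V. adj v x \<and> adj w x \<and> gd u x = gd u v - 1"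
      using * gd_eq_2 by metis
  qed
qed

text \<open>If \<open>s\<close> and \<open>t\<close> were neither equal nor adjacent, they would
  have a common neighbour \<open>x\<close> closer to \<open>u\<close>. As \<open>x\<close> is two
  levels below \<open>a\<close>, the vertices \<open>a, s, x, t\<close> would form an induced
  4-cycle.\<close>

lemma weakly_modular_no_C4_vertex_edge:
  assumes wm: "weakly_modular G" and n: no_C4
  shows vertex_edge
  unfolding vertex_edge_def
proof (intro ballI conjI)
  fix u assume u: "u \<in> V"
  show "edge_cond u" using wm u triangle_condition_iff unfolding weakly_modular_def by blast
  show "vertex_cond u" unfolding vertex_cond_def
  proof (intro allI impI, rule ccontr, elim conjE)
    fix a s t assume *: "adj a s" "adj a t" "gd u a = Suc (gd u s)" "gd u s = gd u t" "\<not> adjeq s t"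
    have V: "s \<in> V" "t \<in> V" "a \<in> V" using * adj_verts by blast+
    have d2: "gd s t = 2" using gd_eq_2 V * adj_sym by blast
    have "gd u s \<noteq> 0" using gd_eq_0 u V * by metis
    then consider "gd u s = 1" | "2 \<le> gd u s" by linarith
    then have "\<exists>x. adj s x \<and> adj t x \<and> gd u x < gd u s"
    proof cases
      \<comment> \<open>The quadrangle condition needs distance at least 2; here \<open>x\<close> is
        \<open>u\<close>.\<close>
      case 1 then show ?thesis using u V * gd_eq_1 adj_sym gd_refl by (metis zero_less_one)
    next
      case 2
      have "gdist G s a = 1 \<and> gdist G t a = 1 \<and> 2 = gdist G s t \<and> gdist G s t \<le> gdist G u s \<and>
        gdist G u s = gdist G u t \<and> gdist G u t = gdist G u a - 1"
        using 2 * d2 gd_adj adj_sym by auto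
      then obtain x where "adj s x \<and> adj t x \<and> gd u x = gd u s - 1"
        using wm u V unfolding weakly_modular_def quadrangle_condition_def by blast
      then show ?thesis using 2 by auto
    qed
    then obtain x where x: "adj s x" "adj t x" "gd u x < gd u s" by blast
    have "\<not> adj a x" "a \<noteq> x" using gd_step[OF u, of x a] * x adj_sym by fastforce+
    then show False using no_C4D[OF n, of a s x t] * x adj_sym by blast
  qed
qed

text \<open>A step from the ball of radius \<open>i + 1\<close> towards the ball of radius \<open>i\<close>: consecutive edges of a
  walk are sent to equal or adjacent vertices, so a walk with \<open>N\<close> edges yields one with \<open>N - 1\<close>.\<close>

definition proj :: "'a \<Rightarrow> nat \<Rightarrow> 'a \<Rightarrow> 'a \<Rightarrow> 'a" where
  "proj v i a b = (if gd v a \<le> i then a else if gd v b \<le> i then b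
     else SOME c. adj c a \<and> adj c b \<and> gd v c = i)"

lemma proj:
  assumes v: "v \<in> V" and e: "edge_cond v" and ab: "adjeq a b" "a \<in> V" "gd v a \<le> Suc i" "gd v b \<le> Suc i"
  shows "proj v i a b \<in> V" "gd v (proj v i a b) \<le> i" "adjeq (proj v i a b) a" "adjeq (proj v i a b) b"
proof -
  have *: "adj (proj v i a b) a \<and> adj (proj v i a b) b \<and> gd v (proj v i a b) = i"
    if n: "\<not> gd v a \<le> i" "\<not> gd v b \<le> i"
  proof -
    have d: "gd v a = Suc i" "gd v b = Suc i" using n ab by auto
    have "\<exists>c. adj c a \<and> adj c b \<and> gd v c = i"
    proof (cases "a = b")
      case True
      then show ?thesis using gd_pred[OF v ab(2) d(1)] by blast
    next
      case False
      then have "adj a b" using ab by blast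
      then show ?thesis using edge_condD[OF e _ d] by blast
    qed
    then show ?thesis using someI_ex n unfolding proj_def by simp
  qed
  show "gd v (proj v i a b) \<le> i" using * proj_def by (metis order_refl)
  show 1: "adjeq (proj v i a b) a" using * ab adj_sym proj_def by metis
  show "adjeq (proj v i a b) b" using * ab adj_sym proj_def by metis
  show "proj v i a b \<in> V" using 1 ab adj_verts by metis
qed

text \<open>Both projections are close to the shared vertex \<open>b\<close>. If \<open>b\<close>
  lies in the smaller ball, the second one is \<open>b\<close> itself; otherwise both are neighbours
  of \<open>b\<close> one level below it and \<open>vertex_cond\<close> applies.\<close>

lemma proj_adjeq:
  assumes v: "v \<in> V" and e: "edge_cond v" and vc: "vertex_cond v"
    and ab: "adjeq a b" "adjeq b c" "a \<in> V" "b \<in> V" "gd v a \<le> Suc i" "gd v b \<le> Suc i" "gd v c \<le> Suc i"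
  shows "adjeq (proj v i a b) (proj v i b c)"
proof (cases "gd v b \<le> i")
  case True
  then have "proj v i b c = b" by (simp add: proj_def)
  then show ?thesis using proj(4)[OF v e ab(1,3,5,6)] by metis
next
  case False
  then have b: "gd v b = Suc i" using ab by simp
  have 1: "gd v x = i \<and> adj b x" if "gd v x \<le> i" "adjeq x b" for x
  proof -
    have "x \<noteq> b" using that b by auto
    then have "adj x b" using that by blast
    then show ?thesis using gd_step[OF v, of x b] that b adj_sym by auto
  qed
  show ?thesis
    using 1[OF proj(2)[OF v e ab(1,3,5,6)] proj(4)[OF v e ab(1,3,5,6)]]
      1[OF proj(2)[OF v e ab(2,4,6,7)] proj(3)[OF v e ab(2,4,6,7)]] vertex_condD[OF vc _ _ b] by blast
qed

lemma gd_walk_le: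
  assumes "\<And>k. k < N \<Longrightarrow> adjeq (c k) (c (Suc k))" "c 0 \<in> V"
  shows "gd (c 0) (c N) \<le> N"
  using assms
proof (induction N)
  case (Suc N)
  have "gd (c 0) (c N) \<le> N" using Suc by simp
  moreover have "adjeq (c N) (c (Suc N))" using Suc.prems by simp
  ultimately show ?case using gd_step[OF Suc.prems(2), of "c N" "c (Suc N)"] by (auto dest: sym)
qed simp

lemma geodesic_stays_in_ball:
  assumes v: "v \<in> V" and e: "edge_cond v" and vc: "vertex_cond v"
  assumes "\<And>k. k < N \<Longrightarrow> adj (c k) (c (Suc k))" "c 0 \<in> V" "gd (c 0) (c N) = N"
    "\<And>k. k \<le> N \<Longrightarrow> gd v (c k) \<le> Suc i" "gd v (c 0) \<le> i" "gd v (c N) \<le> i" "k \<le> N"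
  shows "gd v (c k) \<le> i"
  using assms(4-)
proof (induction N arbitrary: k)
  case (Suc M)
  have cV: "c k \<in> V" if "k \<le> Suc M" for k
    using Suc.prems(1)[of "k - 1"] Suc.prems(2) that adj_verts by (cases k) auto
  show ?case
  proof (cases "gd v (c M) \<le> i")
    case True
    have "gd (c 0) (c M) \<le> M" using gd_walk_le[of M c] Suc.prems by simp
    moreover have "gd (c 0) (c (Suc M)) \<le> Suc (gd (c 0) (c M))"
      using gd_step Suc.prems by blast
    ultimately have "gd (c 0) (c M) = M" using Suc.prems(3) by simp
    then have "k \<le> M \<Longrightarrow> gd v (c k) \<le> i" using Suc.IH[of k] Suc.prems True by simp
    then show ?thesis using Suc.prems le_Suc_eq by blast
  next
    case False
    \<comment> \<open>The end points are kept because of the order of the cases in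
      \<open>proj\<close>: \<open>c 0\<close> is inside, hence selected on the first edge, while on
      the last edge \<open>c M\<close> is outside and the end \<open>c (Suc M)\<close> is
      selected.\<close>
    define q where "q k = proj v i (c k) (c (Suc k))" for k
    have "adjeq (q k) (q (Suc k))" if "k < M" for k
      unfolding q_def using that Suc.prems cV by (intro proj_adjeq[OF v e vc]) auto
    moreover have q0: "q 0 = c 0" unfolding q_def proj_def using Suc.prems by simp
    ultimately have "gd (q 0) (q M) \<le> M" using gd_walk_le[of M q] Suc.prems by simp
    moreover have "q M = c (Suc M)" unfolding q_def proj_def using False Suc.prems by simp
    ultimately show ?thesis using Suc.prems q0 by simp
  qed
qed simp

lemma vertex_edge_convex_balls:
  assumes ve: vertex_edge shows "has_convex_balls G"
  unfolding has_convex_balls_def gconvex_def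
proof (intro ballI allI subsetI)
  fix v r u w y assume *: "v \<in> V" "u \<in> gball G r v" "w \<in> gball G r v" "y \<in> ginterval G u w"
  have V: "u \<in> V" "w \<in> V" "y \<in> V" and d: "gd v u \<le> r" "gd v w \<le> r" "gd u y + gd y w = gd u w"
    using * unfolding gball_def ginterval_def by auto
  obtain f where f: "f 0 = u" "f (gd u y) = y" "\<And>i. i < gd u y \<Longrightarrow> adj (f i) (f (Suc i))"
    using gd_walk[of u y] V unfolding relpow_fun_conv by blast
  obtain g where g: "g 0 = y" "g (gd y w) = w" "\<And>i. i < gd y w \<Longrightarrow> adj (g i) (g (Suc i))"
    using gd_walk[of y w] V unfolding relpow_fun_conv by blast
  define N where "N = gd u w"
  define c where "c k = (if k \<le> gd u y then f k else g (k - gd u y))" for k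
  have c0: "c 0 = u" "c (gd u y) = y" using f by (auto simp: c_def)
  have dd: "gd u w - gd u y = gd y w" using d by simp
  have cN: "c N = w" using g f d dd unfolding N_def c_def by (cases "gd y w = 0") auto
  have cs: "adj (c k) (c (Suc k))" if k: "k < N" for k
  proof -
    consider "k < gd u y" | "k = gd u y" | "k > gd u y" by linarith
    then show ?thesis
    proof cases
      case 2 then show ?thesis using g(1) g(3)[of 0] f(2) k d unfolding c_def N_def by auto
    next
      case 3 then show ?thesis using g(3)[of "k - gd u y"] k d unfolding c_def N_def by (auto simp: Suc_diff_le)
    qed (use f in \<open>auto simp: c_def\<close>)
  qed
  have e: "edge_cond v" "vertex_cond v" using ve * unfolding vertex_edge_def by auto
  \<comment> \<open>The geodesic lies in some large ball around \<open>v\<close>; the radius is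
    lowered to \<open>r\<close> in steps of one.\<close>
  have main: "gd v (c k) \<le> r" if "\<And>k. k \<le> N \<Longrightarrow> gd v (c k) \<le> r + m" "k \<le> N" for m k
    using that
  proof (induction m arbitrary: k)
    case (Suc m)
    have "gd v (c k) \<le> r + m" if "k \<le> N" for k
    proof (rule geodesic_stays_in_ball[OF *(1) e, of N c "r + m"])
      show "c 0 \<in> V" "gd (c 0) (c N) = N" using V c0 cN N_def by simp_all
      show "gd v (c j) \<le> Suc (r + m)" if "j \<le> N" for j using Suc.prems(1)[OF that] by simp
    qed (use cs c0 cN d that in auto)
    then show ?case using Suc.IH Suc.prems by blast
  qed simp
  have "gd v (c k) \<le> r + N" if k: "k \<le> N" for k
  proof -
    have 1: "c k \<in> V" using cs[of "k-1"] adj_verts k V c0 by (cases k) auto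
    have "gd (c 0) (c k) \<le> k" using gd_walk_le[of k c] cs k c0 V by simp
    then show ?thesis using gd_triangle[OF *(1) V(1) 1] d c0 k by simp
  qed
  then have "gd v (c (gd u y)) \<le> r" using main d unfolding N_def by force
  then show "y \<in> gball G r v" using V c0 unfolding gball_def by simp
qed

section \<open>Convex balls and centred pentagons\<close>

lemma convex_ballsD:
  assumes "has_convex_balls G" "v \<in> V" "gd v s \<le> i" "gd v t \<le> i" "\<not> adjeq s t" "adj s a" "adj a t"
  shows "gd v a \<le> i"
proof -
  have V: "s \<in> V" "t \<in> V" "a \<in> V" using assms adj_verts by blast+
  have "gd s t = 2" using gd_eq_2 assms V by blast
  then have "a \<in> ginterval G s t" using gd_adj assms V unfolding ginterval_def by simp
  then have "a \<in> gball G i v"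
    using assms V unfolding has_convex_balls_def gconvex_def gball_def by blast
  then show ?thesis unfolding gball_def by simp
qed

lemma convex_balls_vertex_cond:
  assumes "has_convex_balls G" "v \<in> V" shows "vertex_cond v"
  unfolding vertex_cond_def
proof (intro allI impI, rule ccontr, elim conjE)
  fix a s t assume *: "adj a s" "adj a t" "gd v a = Suc (gd v s)" "gd v s = gd v t" "\<not> adjeq s t"
  then show False using convex_ballsD[OF assms, of s "gd v s" t a] adj_sym by simp
qed

lemma weakly_modular_convex_vertex_edge:
  assumes "weakly_modular G" "has_convex_balls G" shows vertex_edge
  using assms convex_balls_vertex_cond triangle_condition_iff
  unfolding vertex_edge_def weakly_modular_def by blast

text \<open>Seen from \<open>f 0\<close>, the opposite edge \<open>f 2, f 3\<close> lies at distance
  2, and its common neighbour \<open>c\<close> closer to \<open>f 0\<close> is the centre: the two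
  remaining adjacencies complete 4-cycles through \<open>f 0\<close> and \<open>c\<close>.\<close>

lemma vertex_edge_C5_in_W5:
  assumes ve: vertex_edge shows "induced_C5_in_W5 G"
  unfolding induced_C5_in_W5_def
proof (intro allI impI)
  fix f assume "induced_copy (cycle_graph 5) G f"
  note C = induced_C5_D[OF this]
  have V: "f 0 \<in> V" "f 2 \<in> V" "f 3 \<in> V" using C adj_verts by blast+
  have "gd (f 0) (f 2) = 2" "gd (f 0) (f 3) = 2"
    using C V gd_eq_2[of "f 0" "f 2"] gd_eq_2[of "f 0" "f 3"] adj_sym by blast+
  then have "gd (f 0) (f 2) = Suc 1" "gd (f 0) (f 3) = Suc 1" by simp_all
  then obtain c where c: "adj c (f 2)" "adj c (f 3)" "gd (f 0) c = 1"
    using edge_condD C V ve unfolding vertex_edge_def by metis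
  have c0: "adj c (f 0)" using c V gd_eq_1 adj_verts adj_sym by metis
  note n4 = no_C4D[OF vertex_edge_no_C4[OF ve]]
  have "c \<noteq> f 1" "c \<noteq> f 4" using c C adj_sym by blast+
  then have "adj c (f 1)" "adj c (f 4)"
    using n4[of "f 0" "f 1" "f 2" c] n4[of "f 0" c "f 3" "f 4"] C c c0 adj_sym by blast+
  then show "\<exists>c\<in>V. \<forall>i\<in>verts (cycle_graph 5). adj c (f i)"
    unfolding verts_C5 using c c0 adj_verts by (intro bexI[of _ c]) auto
qed

text \<open>Lower neighbours \<open>v'\<close> of \<open>v\<close> and \<open>w'\<close> of
  \<open>w\<close>, unless one of them already serves both, have a common neighbour \<open>p\<close>
  in the ball of radius \<open>n\<close>. Either \<open>p\<close> is the required vertex, or the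
  five vertices form an induced pentagon whose centre is.\<close>

lemma convex_balls_C5_edge_cond:
  assumes cb: "has_convex_balls G" and w5: "induced_C5_in_W5 G" and u: "u \<in> V" shows "edge_cond u"
  unfolding edge_cond_def
proof (intro allI impI, elim conjE)
  fix v w n assume *: "adj v w" "gd u v = Suc n" "gd u w = Suc n"
  have V: "v \<in> V" "w \<in> V" using * adj_verts by blast+
  obtain v' w' where v': "adj v' v" "gd u v' = n" and w': "adj w' w" "gd u w' = n"
    using gd_pred[OF u V(1) *(2)] gd_pred[OF u V(2) *(3)] by metis
  have V': "v' \<in> V" "w' \<in> V" using v' w' adj_verts by blast+
  \<comment> \<open>The unit ball around \<open>a\<close> contains \<open>b\<close> and
    \<open>d\<close>, so for non-adjacent \<open>b\<close> and \<open>d\<close> convexity puts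
    \<open>c\<close> into it as well.\<close>
  have C4: no_C4 unfolding no_C4_def
  proof (intro allI impI, rule ccontr)
    fix a b c d assume h: "adj a b \<and> adj b c \<and> adj c d \<and> adj d a" "\<not> (adjeq a c \<or> adjeq b d)"
    then have "gd a c \<le> 1" using convex_ballsD[OF cb, of a b 1 d c] adj_verts(1)[of a b] gd_adj adj_sym
      by (metis order_refl)
    moreover have "a \<in> V" "c \<in> V" using h adj_verts by blast+
    ultimately show False using h gd_eq_0 gd_eq_1 by (metis One_nat_def le_SucE le_zero_eq)
  qed
  show "\<exists>c. adj c v \<and> adj c w \<and> gd u c = n"
  proof (cases "adj v' w \<or> adj w' v")
    case True then show ?thesis using v' w' by blast
  next
    case False
    have ne: "v' \<noteq> w" "w' \<noteq> v" "v' \<noteq> w'" using v' w' * False by auto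
    have na: "\<not> adj v' w'"
      using no_C4D[OF C4, of v' v w w'] v' w' * False ne adj_sym by blast
    \<comment> \<open>Otherwise \<open>v', v, w, w'\<close> is a geodesic between points of the ball
      of radius \<open>n\<close>, and convexity would draw \<open>v\<close> into that ball.\<close>
    have "\<exists>p. adj v' p \<and> adj p w' "
    proof (rule ccontr)
      assume np: "\<not> ?thesis"
      have "gd v' w' \<le> 3"
        using gd_le[of v' w' 3] v' w' * adj_sym by (fastforce simp: numeral_3_eq_3)
      moreover have "gd v' w' \<noteq> 0" "gd v' w' \<noteq> 1" "gd v' w' \<noteq> 2" using gd_eq_0 gd_eq_1 gd_eq_2 V' ne na np by metis+
      ultimately have 3: "gd v' w' = 3" by linarith
      have "gd v w' = 2" using gd_eq_2[of v w'] V V' ne w' * False adj_sym by blast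
      then have "v \<in> ginterval G v' w'" using 3 gd_adj[OF v'(1)] V unfolding ginterval_def by simp
      then have "v \<in> gball G n u" using cb u V' v' w' unfolding has_convex_balls_def gconvex_def
        by (metis (mono_tags, lifting) gball_def mem_Collect_eq order_refl subsetD)
      then show False using * unfolding gball_def by simp
    qed
    then obtain p where p: "adj v' p" "adj p w'" by blast
    have pn: "gd u p \<le> n" using convex_ballsD[OF cb u _ _ _ p] v' w' ne na by simp
    have pd: "p \<noteq> v" "p \<noteq> w" using pn * by auto
    show ?thesis
    proof (cases "adj p v \<or> adj p w")
      case True
      then have "adj p v" "adj p w"
        using no_C4D[OF C4, of p v w w'] no_C4D[OF C4, of p w v v'] False p * v' w' ne pd adj_sym by blast+
      moreover from this have "gd u p = n" using gd_step[OF u, of p v] * pn by simp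
      ultimately show ?thesis by blast
    next
      case n: False
      \<comment> \<open>The centre is adjacent to the non-adjacent \<open>v'\<close> and
        \<open>w'\<close>, so convexity keeps it in the ball of radius \<open>n\<close>.\<close>
      have "induced_copy (cycle_graph 5) G (\<lambda>i. [v',v,w,w',p] ! i)"
        using v' * w' p n ne na pd False adj_sym by (intro induced_C5_I) blast+
      then obtain c where c: "\<forall>i\<in>verts (cycle_graph 5). adj c ([v',v,w,w',p] ! i)"
        using w5 unfolding induced_C5_in_W5_def by blast
      then have c: "adj c v'" "adj c v" "adj c w" "adj c w'" unfolding verts_C5 by auto
      then have "gd u c \<le> n" using convex_ballsD[OF cb u, of v' n w' c] v' w' ne na adj_sym by auto
      then have "gd u c = n" using gd_step[OF u c(2)] * by simp
      then show ?thesis using c by blast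
    qed
  qed
qed

lemma convex_C5_vertex_edge:
  assumes "has_convex_balls G" "induced_C5_in_W5 G" shows vertex_edge
  using convex_balls_C5_edge_cond[OF assms] convex_balls_vertex_cond[OF assms(1)]
  unfolding vertex_edge_def by blast

text \<open>The base point is the extra vertex \<open>f 6\<close>. The edge from the centre
  \<open>f 5\<close> to the rim vertex \<open>f 3\<close> opposite to it lies at distance 2, and its
  common neighbour \<open>y\<close> adjacent to \<open>f 6\<close> dominates everything:
  \<open>f 0\<close> and \<open>f 1\<close> by \<open>vertex_cond\<close> at \<open>f 5\<close>,
  then \<open>f 2\<close> and \<open>f 4\<close> by 4-cycles.\<close>

lemma vertex_edge_W5hat:
  assumes ve: vertex_edge shows "W5hat_condition G"
  unfolding W5hat_condition_def
proof (intro allI impI)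
  fix f assume W: "induced_copy W5hat_graph G f"
  note C = induced_C5_D[OF induced_W5hat_D(1)[OF W]] and D = induced_W5hat_D(3-)[OF W]
  have E: "adj (f 5) (f 0)" "adj (f 5) (f 1)" "adj (f 5) (f 2)" "adj (f 5) (f 3)" "adj (f 5) (f 4)"
    using induced_W5hat_D(2)[OF W] by auto
  have V: "f 6 \<in> V" "f 5 \<in> V" "f 2 \<in> V" "f 3 \<in> V" "f 4 \<in> V" using D C E adj_verts by blast+
  have d2: "gd (f 6) (f 2) = 2" "gd (f 6) (f 4) = 2" "gd (f 6) (f 5) = 2"
    using gd_eq_2[of "f 6" "f 2"] gd_eq_2[of "f 6" "f 4"] gd_eq_2[of "f 6" "f 5"] V D C E adj_sym by blast+
  have c: "vertex_cond (f 6)" "edge_cond (f 6)" using ve V unfolding vertex_edge_def by auto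
  have "gd (f 6) (f 3) = 2"
  proof -
    have "gd (f 6) (f 3) \<le> 3" using gd_step[OF V(1) C(3)] d2 by simp
    \<comment> \<open>At distance 3, the non-adjacent \<open>f 2\<close> and \<open>f 4\<close>
      would both be neighbours of \<open>f 3\<close> one level below.\<close>
    moreover have "gd (f 6) (f 3) \<noteq> 3" using vertex_condD[OF c(1), of "f 3" "f 2" "f 4" 2] d2 C adj_sym by auto
    moreover have "gd (f 6) (f 3) \<noteq> 0" "gd (f 6) (f 3) \<noteq> 1" using D gd_eq_0 gd_eq_1 V by metis+
    ultimately show ?thesis by linarith
  qed
  then obtain y where y: "adj y (f 5)" "adj y (f 3)" "gd (f 6) y = 1"
    using edge_condD[OF c(2) E(4), of 1] d2 by auto
  have y6: "adj (f 6) y" using y gd_eq_1 V adj_verts by metis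
  have 1: "gd (f 6) (f 0) = 1" "gd (f 6) (f 1) = 1" using D gd_adj by auto
  have "adjeq y (f 0)" "adjeq y (f 1)"
    using vertex_condD[OF c(1), of "f 5" y _ 1] E y d2 1 adj_sym by auto
  moreover have n: "y \<noteq> f 0" "y \<noteq> f 1" "y \<noteq> f 2" "y \<noteq> f 4" using y C y6 D adj_sym by blast+
  ultimately have y01: "adj y (f 0)" "adj y (f 1)" by auto
  note n4 = no_C4D[OF vertex_edge_no_C4[OF ve]]
  have y24: "adj y (f 2)" "adj y (f 4)"
    using n4[of "f 1" y "f 3" "f 2"] n4[of "f 0" y "f 3" "f 4"] C y y01 n adj_sym by blast+
  show "\<exists>v\<in>V. v \<notin> f ` verts W5hat_graph \<and> (\<forall>i\<in>verts W5hat_graph. adj v (f i))"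
    unfolding verts_W5hat using y y01 y24 y6 n adj_sym adj_verts(2)[OF y6] by (intro bexI[of _ y]) auto
qed

end

section \<open>Flag complexes: the SD conditions read off the graph\<close>

locale conn_flag =
  fixes X :: "'a set set"
  assumes flag: "flag_complex X" and conn: "connected_graph (one_skeleton X)"
begin

sublocale conn_graph "one_skeleton X"
  using conn simple_graph_one_skeleton by unfold_locales

lemma V_eq: "V = \<Union>X" by (simp add: one_skeleton_def)

lemma adj_iff: "adj x y \<longleftrightarrow> x \<noteq> y \<and> {x, y} \<in> X"
  by (simp add: one_skeleton_def)

lemma simplex_finite: "\<sigma> \<in> X \<Longrightarrow> finite \<sigma>"
  and simplex_subset: "\<sigma> \<in> X \<Longrightarrow> \<tau> \<subseteq> \<sigma> \<Longrightarrow> \<tau> \<in> X"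
  using flag unfolding flag_complex_def abstract_simplicial_complex_def by auto

lemma simplex_adjeq: "\<sigma> \<in> X \<Longrightarrow> x \<in> \<sigma> \<Longrightarrow> y \<in> \<sigma> \<Longrightarrow> adjeq x y"
  unfolding adj_iff using simplex_subset[of \<sigma> "{x,y}"] by blast

lemma simplex_subset_V: "\<sigma> \<in> X \<Longrightarrow> \<sigma> \<subseteq> V"
  unfolding V_eq by auto

text \<open>Finiteness of \<open>A\<close> is a consequence, not a hypothesis. This matters for the
  SD conditions, where the set of common lower neighbours is not known to be finite
  beforehand.\<close>

lemma simplexI: "A \<subseteq> V \<Longrightarrow> (\<And>x y. x \<in> A \<Longrightarrow> y \<in> A \<Longrightarrow> adjeq x y) \<Longrightarrow> A \<in> X"
proof -
  assume A: "A \<subseteq> V" "\<And>x y. x \<in> A \<Longrightarrow> y \<in> A \<Longrightarrow> adjeq x y"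
  have "\<exists>\<sigma>\<in>X. x \<in> \<sigma> \<and> y \<in> \<sigma>" if "x \<in> A" "y \<in> A" for x y
  proof (cases "x = y")
    case True then show ?thesis using A(1) that unfolding V_eq by blast
  next
    case False
    then have "{x,y} \<in> X" using A(2)[OF that] adj_iff by blast
    then show ?thesis by blast
  qed
  then obtain \<sigma> where "\<sigma> \<in> X" "A \<subseteq> \<sigma>" using flag unfolding flag_complex_def by blast
  then show "A \<in> X" using simplex_subset by blast
qed

lemma link_vertices:
  assumes "\<sigma> \<in> X"
  shows "\<Union>(link \<sigma> X) = {x \<in> V. x \<notin> \<sigma> \<and> (\<forall>y\<in>\<sigma>. adj x y)}"
proof (intro set_eqI iffI)
  fix x assume "x \<in> \<Union>(link \<sigma> X)"
  then obtain \<tau> where t: "x \<in> \<tau>" "\<tau> \<in> X" "\<sigma> \<inter> \<tau> = {}" "\<sigma> \<union> \<tau> \<in> X" unfolding link_def by blast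
  then have "x \<notin> \<sigma>" by blast
  then show "x \<in> {x \<in> V. x \<notin> \<sigma> \<and> (\<forall>y\<in>\<sigma>. adj x y)}"
    using t simplex_adjeq[OF t(4)] simplex_subset_V[OF t(2)] by blast
next
  fix x assume "x \<in> {x \<in> V. x \<notin> \<sigma> \<and> (\<forall>y\<in>\<sigma>. adj x y)}"
  then have x: "x \<in> V" "x \<notin> \<sigma>" "\<forall>y\<in>\<sigma>. adj x y" by auto
  have "\<sigma> \<union> {x} \<in> X"
    using x simplex_subset_V[OF assms] simplex_adjeq[OF assms] adj_sym by (intro simplexI) blast+
  then have "{x} \<in> link \<sigma> X" using x simplex_subset unfolding link_def by auto
  then show "x \<in> \<Union>(link \<sigma> X)" by blast
qed

lemma weakly_systolic_imp_vertex_edge: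
  assumes "weakly_systolic X" shows vertex_edge
  unfolding vertex_edge_def
proof (intro ballI conjI)
  fix v assume v: "v \<in> V"
  have SD: "\<Union>(link \<sigma> X) \<inter> gball (one_skeleton X) i v \<in> X"
      "\<Union>(link \<sigma> X) \<inter> gball (one_skeleton X) i v \<noteq> {}"
    if "\<sigma> \<in> X" "\<sigma> \<noteq> {}" "\<sigma> \<subseteq> gsphere (one_skeleton X) (i + 1) v" for \<sigma> i
    using assms v that unfolding weakly_systolic_def SD_def V_eq by blast+
  show "vertex_cond v" unfolding vertex_cond_def
  proof (intro allI impI, elim conjE)
    fix a s t assume *: "adj a s" "adj a t" "gd v a = Suc (gd v s)" "gd v s = gd v t"
    have V: "a \<in> V" "s \<in> V" "t \<in> V" using * adj_verts by blast+
    have a: "{a} \<in> X" using V by (intro simplexI) auto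
    have "{a} \<subseteq> gsphere (one_skeleton X) (gd v s + 1) v" using V * unfolding gsphere_def by simp
    then have "\<Union>(link {a} X) \<inter> gball (one_skeleton X) (gd v s) v \<in> X" by (intro SD(1)[OF a]) auto
    moreover have "s \<in> \<Union>(link {a} X) \<inter> gball (one_skeleton X) (gd v s) v"
      "t \<in> \<Union>(link {a} X) \<inter> gball (one_skeleton X) (gd v s) v"
      unfolding link_vertices[OF a] gball_def using * V adj_sym by auto
    ultimately show "adjeq s t" using simplex_adjeq by blast
  qed
  show "edge_cond v" unfolding edge_cond_def
  proof (intro allI impI, elim conjE)
    fix a b n assume *: "adj a b" "gd v a = Suc n" "gd v b = Suc n"
    have V: "a \<in> V" "b \<in> V" using * adj_verts by blast+
    have a: "{a, b} \<in> X" using * adj_iff by blast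
    have "{a, b} \<subseteq> gsphere (one_skeleton X) (n + 1) v" using V * unfolding gsphere_def by simp
    then have "\<Union>(link {a, b} X) \<inter> gball (one_skeleton X) n v \<noteq> {}" by (intro SD(2)[OF a]) auto
    then obtain c where c: "adj c a" "adj c b" "gd v c \<le> n"
      unfolding link_vertices[OF a] gball_def by auto
    then have "gd v c = n" using gd_step[OF v c(1)] * by simp
    then show "\<exists>c. adj c a \<and> adj c b \<and> gd v c = n" using c by blast
  qed
qed

text \<open>Link vertices in the ball of radius \<open>i\<close> have distance exactly
  \<open>i\<close>, so \<open>vertex_cond\<close> at any vertex of the simplex makes them a clique.
  That there is one at all is shown by adding the vertices of the simplex one by one.\<close>

lemma vertex_edge_SD:
  assumes ve: vertex_edge and v: "v \<in> V" shows "SD X n v"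
  unfolding SD_def
proof (intro allI impI ballI, elim conjE)
  fix i \<sigma> assume s: "\<sigma> \<in> X" "\<sigma> \<noteq> {}" "\<sigma> \<subseteq> gsphere (one_skeleton X) (i + 1) v"
  have c: "vertex_cond v" "edge_cond v" using ve v unfolding vertex_edge_def by auto
  have d: "gd v x = Suc i" if "x \<in> \<sigma>" for x using s that unfolding gsphere_def by auto
  let ?L = "\<Union>(link \<sigma> X) \<inter> gball (one_skeleton X) i v"
  have L: "?L = {x \<in> V. gd v x = i \<and> (\<forall>y\<in>\<sigma>. adj x y)}"
  proof (intro set_eqI iffI)
    fix x assume "x \<in> ?L"
    then have x: "x \<in> V" "\<forall>y\<in>\<sigma>. adj x y" "gd v x \<le> i" unfolding link_vertices[OF s(1)] gball_def by auto
    obtain y where "y \<in> \<sigma>" using s by blast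
    then have "gd v x = i" using gd_step[OF v, of x y] d x by simp
    then show "x \<in> {x \<in> V. gd v x = i \<and> (\<forall>y\<in>\<sigma>. adj x y)}" using x by blast
  next
    fix x assume "x \<in> {x \<in> V. gd v x = i \<and> (\<forall>y\<in>\<sigma>. adj x y)}"
    then have "x \<in> V" "gd v x = i" "\<forall>y\<in>\<sigma>. adj x y" by auto
    moreover from this have "x \<notin> \<sigma>" by (metis adj_irrefl)
    ultimately show "x \<in> ?L" unfolding link_vertices[OF s(1)] gball_def by simp
  qed
  obtain s0 where s0: "s0 \<in> \<sigma>" using s by blast
  have "?L \<in> X"
  proof (rule simplexI)
    show "?L \<subseteq> V" using L by auto
    fix x y assume "x \<in> ?L" "y \<in> ?L"
    then have "gd v x = i" "gd v y = i" "adj s0 x" "adj s0 y" using s0 adj_sym unfolding L by auto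
    then show "adjeq x y" using vertex_condD[OF c(1) _ _ d[OF s0]] by blast
  qed
  moreover have "?L \<noteq> {}"
  proof -
    have fin: "finite \<sigma>" using simplex_finite s by blast
    have "\<exists>y. y \<in> V \<and> gd v y = i \<and> (\<forall>x\<in>A. adj y x)" if "finite A" "A \<noteq> {}" "A \<subseteq> \<sigma>" for A
      using that
    proof (induction A rule: finite_ne_induct)
      case (singleton x)
      then have x: "x \<in> V" "gd v x = Suc i" using d simplex_subset_V[OF s(1)] by auto
      obtain w where "adj w x" "gd v w = i" by (rule gd_pred[OF v x])
      then show ?case using adj_verts(1)[of w x] by auto
    next
      case (insert x A)
      then obtain y where y: "y \<in> V" "gd v y = i" "\<forall>t\<in>A. adj y t" by blast
      obtain t0 where t0: "t0 \<in> A" using insert by blast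
      have x: "adj t0 x" using simplex_adjeq[OF s(1)] insert t0 by blast
      have t0d: "gd v t0 = Suc i" "gd v x = Suc i" using d t0 insert by auto
      then obtain z where z: "adj z t0" "adj z x" "gd v z = i"
        using edge_condD[OF c(2) x] by blast
      show ?case
      proof (cases "adj y x")
        case True then show ?thesis using y by auto
      next
        \<comment> \<open>The lower neighbour \<open>z\<close> of the edge \<open>t0 x\<close>
          replaces \<open>y\<close>. It is adjacent to \<open>y\<close>, and for each
          \<open>t\<close> in \<open>A\<close> the 4-cycle \<open>y, z, x, t\<close> lacks the
          diagonal \<open>y x\<close>, so it has the diagonal \<open>z t\<close>.\<close>
        case nx: False
        have yx: "y \<noteq> x" using y t0d by auto
        have yz: "adj y z"
          using vertex_condD[OF c(1), of t0 y z i] t0 y z t0d adj_sym nx by blast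
        have "adj z t" if t: "t \<in> A" for t
        proof -
          have "adj t x" using simplex_adjeq[OF s(1)] insert t by blast
          moreover have "z \<noteq> t" using z d[of t] insert t by auto
          ultimately show ?thesis
            using no_C4D[OF vertex_edge_no_C4[OF ve], of y z x t] yz z y t nx yx adj_sym by blast
        qed
        then show ?thesis using z adj_verts by blast
      qed
    qed
    then obtain y where "y \<in> V \<and> gd v y = i \<and> (\<forall>x\<in>\<sigma>. adj y x)" using fin s by blast
    then show ?thesis unfolding L by blast
  qed
  ultimately show "?L \<in> X \<and> ?L \<noteq> {}" ..
qed

lemma weakly_systolic_iff_vertex_edge: "weakly_systolic X \<longleftrightarrow> vertex_edge"
  using weakly_systolic_imp_vertex_edge vertex_edge_SD flag
  unfolding weakly_systolic_def V_eq by blast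

end

subsection \<open>The universal cover, level by level\<close>

text \<open>Vertices of the cover are nonempty lists: the head is the image in \<open>G\<close>, and the length is
  one more than the distance from the base point \<open>[v\<^sub>0]\<close>.\<close>

locale graded_cover = conn_graph G for G :: "'a sgraph" +
  fixes v0 :: 'a and U :: "'a list set" and E :: "('a list \<times> 'a list) set"
  assumes E_verts: "(x, y) \<in> E \<Longrightarrow> x \<in> U" 
    and E_sym: "(x, y) \<in> E \<Longrightarrow> (y, x) \<in> E"
    and U_hd: "x \<in> U \<Longrightarrow> hd x \<in> verts G"
    and root: "[v0] \<in> U"
    and nonroot: "x \<in> U \<Longrightarrow> x \<noteq> [v0] \<Longrightarrow> \<exists>y. (y, x) \<in> E \<and> length x = Suc (length y)"
    and U_length: "x \<in> U \<Longrightarrow> length x \<ge> 1"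
    and E_length: "(x, y) \<in> E \<Longrightarrow> length y \<le> Suc (length x)"
    and cover_vertex: "(x, s) \<in> E \<Longrightarrow> (x, t) \<in> E \<Longrightarrow> length x = Suc (length s) \<Longrightarrow> length t = length s
      \<Longrightarrow> s = t \<or> (s, t) \<in> E"
    and cover_edge: "(x, y) \<in> E \<Longrightarrow> length x = length y \<Longrightarrow>
      \<exists>c. (c, x) \<in> E \<and> (c, y) \<in> E \<and> length x = Suc (length c)"
    and E_hom: "(x, y) \<in> E \<Longrightarrow> (hd x, hd y) \<in> edges G"
    and local_inj: "(x, y) \<in> E \<Longrightarrow> (x, z) \<in> E \<Longrightarrow> hd y = hd z \<Longrightarrow> y = z"
    and local_adj: "(x, y) \<in> E \<Longrightarrow> (x, z) \<in> E \<Longrightarrow> (hd y, hd z) \<in> edges G \<Longrightarrow> (y, z) \<in> E"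
begin

lemma E_verts': "(x, y) \<in> E \<Longrightarrow> y \<in> U"
  using E_sym E_verts by blast

end

text \<open>Below level \<open>i\<close> every edge of \<open>G\<close> has a lift; the vertices of
  length \<open>i\<close> form the frontier, where lifts may still be missing. As lengths start at
  1, the frontier belongs to the sphere of radius \<open>i - 1\<close>.\<close>

locale partial_cover = graded_cover +
  fixes i :: nat
  assumes bounded: "x \<in> U \<Longrightarrow> length x \<le> i"
    and local_surj: "x \<in> U \<Longrightarrow> length x < i \<Longrightarrow> (hd x, v) \<in> edges G \<Longrightarrow> \<exists>y. (x, y) \<in> E \<and> hd y = v"
    and i_pos: "i \<ge> 1"
    and no_C4: no_C4
    and W5hat: "W5hat_condition G"
begin

text \<open>A pair \<open>(x, z)\<close> in \<open>Z\<close> is an edge at \<open>hd x\<close> that does not lift to \<open>x\<close> yet. Its new end point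
  \<open>ext x z\<close> is shared by adjacent \<open>x\<close> with the same \<open>z\<close>, and the chosen list after \<open>z\<close> is a
  representative of this class.\<close>

definition Z :: "('a list \<times> 'a) set" where
  "Z = {(x, z). x \<in> U \<and> length x = i \<and> adj (hd x) z \<and> (\<forall>y. (x, y) \<in> E \<longrightarrow> hd y \<noteq> z)}"

lemma Z_D: "(x, z) \<in> Z \<Longrightarrow> x \<in> U" "(x, z) \<in> Z \<Longrightarrow> length x = i" "(x, z) \<in> Z \<Longrightarrow> adj (hd x) z"
    "(x, z) \<in> Z \<Longrightarrow> (x, y) \<in> E \<Longrightarrow> hd y \<noteq> z"
  unfolding Z_def by auto

text \<open>Below the frontier an edge to \<open>z\<close> would lift, and \<open>local_adj\<close>
  would carry the lift over to \<open>x\<close>, where it is missing.\<close>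

lemma Z_lower:
  assumes "(x, z) \<in> Z" "(a, x) \<in> E" "length a < i"
  shows "\<not> adj (hd a) z" "hd a \<noteq> z"
proof
  assume "adj (hd a) z"
  then obtain y where y: "(a, y) \<in> E" "hd y = z" using local_surj assms E_verts by blast
  then have "(x, y) \<in> E" using local_adj[OF assms(2)] Z_D(3)[OF assms(1)] by blast
  then show False using Z_D(4)[OF assms(1)] y by blast
next
  show "hd a \<noteq> z" using Z_D(4)[OF assms(1)] E_sym[OF assms(2)] by blast
qed

text \<open>A lift at \<open>y\<close> would be carried over to \<open>x\<close> by
  \<open>local_adj\<close>, so a missing edge is missing at all neighbours over vertices adjacent to
  \<open>z\<close>.\<close>

lemma Z_neighbour:
  assumes xz: "(x, z) \<in> Z" and xy: "(x, y) \<in> E" and a: "adj (hd y) z"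
  shows "(y, z) \<in> Z"
proof -
  have y: "y \<in> U" using xy E_verts' by blast
  have "\<not> length y < i" using Z_lower(1)[OF xz E_sym[OF xy]] a by blast
  then have "length y = i" using bounded[OF y] by simp
  moreover have "hd z' \<noteq> z" if "(y, z') \<in> E" for z'
  proof
    assume "hd z' = z"
    then have "(x, z') \<in> E" using local_adj[OF E_sym[OF xy] that] Z_D(3)[OF xz] by blast
    then show False using Z_D(4)[OF xz] \<open>hd z' = z\<close> by blast
  qed
  ultimately show ?thesis using y a unfolding Z_def by blast
qed

text \<open>If \<open>x\<close> and \<open>w\<close> are not adjacent, then \<open>x, a, b, w\<close> and \<open>z\<close> form an induced pentagon
  centred at \<open>y\<close>, where \<open>a\<close> lies below the edge \<open>xy\<close> and \<open>b\<close> below \<open>yw\<close>; a vertex \<open>c\<close> below the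
  edge \<open>ab\<close> completes it to a \<open>W\<^sub>5\<close>-hat. A vertex dominating it lifts to a vertex below \<open>x\<close>, where
  the cover is already complete, so that \<open>x\<close> has a neighbour over \<open>z\<close>, a contradiction.\<close>

lemma Z_trans:
  assumes Z: "(x, z) \<in> Z" "(y, z) \<in> Z" "(w, z) \<in> Z" and xy: "(x, y) \<in> E" and yw: "(y, w) \<in> E"
  shows "x = w \<or> (x, w) \<in> E"
proof (rule ccontr)
  assume n: "\<not> ?thesis"
  have len: "length x = i" "length y = i" "length w = i" using Z Z_D(2) by auto
  have adjz: "adj (hd x) z" "adj (hd y) z" "adj (hd w) z" using Z Z_D(3) by auto
  have yx: "(y, x) \<in> E" using xy E_sym by blast
  have xw: "hd x \<noteq> hd w" "\<not> adj (hd x) (hd w)" using n local_inj[OF yx yw] local_adj[OF yx yw] by auto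
  obtain a where a: "(a, x) \<in> E" "(a, y) \<in> E" "Suc (length a) = i" using cover_edge[OF xy] len by auto
  obtain b where b: "(b, y) \<in> E" "(b, w) \<in> E" "Suc (length b) = i" using cover_edge[OF yw] len by auto
  have az: "\<not> adj (hd a) z" "hd a \<noteq> z" using Z_lower[OF Z(1) a(1)] a by auto
  have bz: "\<not> adj (hd b) z" "hd b \<noteq> z" using Z_lower[OF Z(3) b(2)] b by auto
  \<comment> \<open>Otherwise \<open>hd a, hd x, z, hd w\<close> would be an induced 4-cycle; the
    same holds for \<open>b\<close> and \<open>x\<close>.\<close>
  have aw: "(a, w) \<notin> E"
    using no_C4D[OF no_C4, of "hd a" "hd x" z "hd w"] a az xw adjz E_hom adj_sym by blast
  have bx: "(b, x) \<notin> E"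
    using no_C4D[OF no_C4, of "hd b" "hd x" z "hd w"] b bz xw adjz E_hom adj_sym by blast
  have ab: "(a, b) \<in> E"
    using cover_vertex[of y a b] a b aw len E_sym by auto
  obtain c where c: "(c, a) \<in> E" "(c, b) \<in> E" "length a = Suc (length c)"
    using cover_edge[OF ab] a b by auto
  \<comment> \<open>The vertex \<open>c\<close> is two levels below \<open>p\<close>, hence neither
    equal nor adjacent to it in the cover; at the common neighbour \<open>q\<close> this passes down
    to \<open>G\<close>.\<close>
  have far: "hd c \<noteq> hd p \<and> \<not> adj (hd c) (hd p)" if "(q, c) \<in> E" "(q, p) \<in> E" "length p = i" for p q
  proof -
    have 1: "c \<noteq> p" "(c, p) \<notin> E" using c a that E_length[of c p] by auto
    then show ?thesis using local_inj[OF that(1,2)] local_adj[OF that(1,2)] by auto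
  qed
  have ca: "(a, c) \<in> E" and cb: "(b, c) \<in> E" using c E_sym by auto
  have cx: "hd c \<noteq> hd x" "\<not> adj (hd c) (hd x)" and cy: "hd c \<noteq> hd y" "\<not> adj (hd c) (hd y)"
    and cw: "hd c \<noteq> hd w" "\<not> adj (hd c) (hd w)"
    using far[OF ca a(1)] far[OF ca a(2)] far[OF cb b(2)] len by auto
  have "hd c \<noteq> z" using E_hom[OF ca] az by auto
  have "\<not> adj (hd c) z"
    using no_C4D[OF no_C4, of "hd c" "hd a" "hd y" z] E_hom[OF c(1)] E_hom[OF a(2)] adjz cy az adj_sym by blast
  have "length a < i" "length b < i" using a(3) b(3) by simp_all
  then have "a \<noteq> w" "b \<noteq> x" using len by fastforce+
  have ba: "(b, a) \<in> E" using ab E_sym by blast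
  have aw': "hd a \<noteq> hd w" "\<not> adj (hd a) (hd w)"
    using local_inj[OF ba b(2)] local_adj[OF ba b(2)] aw \<open>a \<noteq> w\<close> by blast+
  have bx': "hd b \<noteq> hd x" "\<not> adj (hd b) (hd x)"
    using local_inj[OF ab a(1)] local_adj[OF ab a(1)] bx \<open>b \<noteq> x\<close> by blast+
  have "induced_copy W5hat_graph G (\<lambda>i. [hd a, hd b, hd w, z, hd x, hd y, hd c] ! i)"
  proof (rule induced_W5hat_I)
    show "adj (hd a) (hd b)" "adj (hd b) (hd w)" "adj (hd w) z" "adj z (hd x)" "adj (hd x) (hd a)"
      "adj (hd y) (hd a)" "adj (hd y) (hd b)" "adj (hd y) (hd w)" "adj (hd y) z" "adj (hd y) (hd x)"
      "adj (hd c) (hd a)" "adj (hd c) (hd b)"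
      using E_hom ab b adjz a c yw yx adj_sym by blast+
    show "\<not> adjeq (hd a) (hd w)" "\<not> adjeq (hd a) z" "\<not> adjeq (hd b) z" "\<not> adjeq (hd b) (hd x)"
      "\<not> adjeq (hd w) (hd x)" "\<not> adjeq (hd c) (hd w)" "\<not> adjeq (hd c) z" "\<not> adjeq (hd c) (hd x)"
      "\<not> adjeq (hd c) (hd y)"
      using aw' az bz bx' xw cw cx cy \<open>hd c \<noteq> z\<close> \<open>\<not> adj (hd c) z\<close> adj_sym by metis+
  qed
  then obtain v where v: "\<forall>i\<in>verts W5hat_graph. adj v ([hd a, hd b, hd w, z, hd x, hd y, hd c] ! i)"
    using W5hat unfolding W5hat_condition_def by blast
  then have v: "adj v (hd a)" "adj v (hd b)" "adj v (hd w)" "adj v z" "adj v (hd x)" "adj v (hd c)"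
    unfolding verts_W5hat by auto
  obtain v' where v': "(a, v') \<in> E" "hd v' = v"
    using local_surj[of a v] E_verts[OF a(1)] a v adj_sym by auto
  have "(v', x) \<in> E" "(v', b) \<in> E" "(v', c) \<in> E"
    using local_adj[OF v'(1)] v' v a ab ca by auto
  \<comment> \<open>Being adjacent to \<open>c\<close>, which has length \<open>i - 2\<close>, the
    vertex \<open>v'\<close> lies below the frontier, so its edge to \<open>z\<close> lifts.\<close>
  then have "length v' < i"
    using E_length[of c v'] E_sym c a by fastforce
  then obtain z' where z': "(v', z') \<in> E" "hd z' = z"
    using local_surj[of v' z] E_verts'[OF v'(1)] v v' by auto
  then have "(x, z') \<in> E" using local_adj[OF \<open>(v', x) \<in> E\<close> z'(1)] adjz by auto
  then show False using Z_D(4)[OF Z(1)] z' by blast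
qed

section \<open>Attaching the next sphere\<close>

definition ext :: "'a list \<Rightarrow> 'a \<Rightarrow> 'a list" where
  "ext x z = z # (SOME y. (y, z) \<in> Z \<and> (x = y \<or> (x, y) \<in> E))"

lemma hd_ext [simp]: "hd (ext x z) = z"
  by (simp add: ext_def)

lemma ext_some:
  assumes "(x, z) \<in> Z" shows "\<exists>y. ext x z = z # y \<and> (y, z) \<in> Z \<and> (x = y \<or> (x, y) \<in> E)"
  unfolding ext_def using someI[of "\<lambda>y. (y, z) \<in> Z \<and> (x = y \<or> (x, y) \<in> E)" x] assms by auto

lemma length_ext: "(x, z) \<in> Z \<Longrightarrow> length (ext x z) = Suc i"
  using ext_some Z_D(2) by fastforce

text \<open>By transitivity the predicates under the choice operator coincide for \<open>x\<close>
  and \<open>y\<close>, so the same representative is chosen. This takes the place of a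
  quotient.\<close>

lemma ext_eq:
  assumes xz: "(x, z) \<in> Z" "(y, z) \<in> Z" "x = y \<or> (x, y) \<in> E"
  shows "ext x z = ext y z"
proof -
  have "(x = w \<or> (x, w) \<in> E) \<longleftrightarrow> (y = w \<or> (y, w) \<in> E)" if "(w, z) \<in> Z" for w
    using xz that Z_trans E_sym by metis
  then have "(\<lambda>w. (w, z) \<in> Z \<and> (x = w \<or> (x, w) \<in> E)) = (\<lambda>w. (w, z) \<in> Z \<and> (y = w \<or> (y, w) \<in> E))"
    by blast
  then show ?thesis unfolding ext_def by simp
qed

lemma ext_eqD:
  assumes xz: "(x, z) \<in> Z" "(y, z') \<in> Z" and e: "ext x z = ext y z'"
  shows "z' = z" "x = y \<or> (x, y) \<in> E"
proof -
  obtain w where w: "ext x z = z # w" "(w, z) \<in> Z" "x = w \<or> (x, w) \<in> E" using ext_some[OF xz(1)] by blast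
  obtain w' where w': "ext y z' = z' # w'" "(w', z') \<in> Z" "y = w' \<or> (y, w') \<in> E" using ext_some[OF xz(2)] by blast
  show z: "z' = z" using w w' e by simp
  show "x = y \<or> (x, y) \<in> E" using w w' e xz Z_trans[of x z w y] E_sym by auto
qed

definition U' where "U' = U \<union> {ext x z |x z. (x, z) \<in> Z}"

text \<open>New vertices are joined only above a common frontier vertex, which is what
  \<open>cover_edge\<close> requires at the new level.\<close>

definition E' where
  "E' = E \<union> {(x, ext x z) |x z. (x, z) \<in> Z} \<union> {(ext x z, x) |x z. (x, z) \<in> Z} \<union>
    {(ext x z, ext x z') |x z z'. (x, z) \<in> Z \<and> (x, z') \<in> Z \<and> adj z z'}"

lemma E'_I: "(x, y) \<in> E \<Longrightarrow> (x, y) \<in> E'" "(x, z) \<in> Z \<Longrightarrow> (x, ext x z) \<in> E'" "(x, z) \<in> Z \<Longrightarrow> (ext x z, x) \<in> E'"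
    "(x, z) \<in> Z \<Longrightarrow> (x, z') \<in> Z \<Longrightarrow> adj z z' \<Longrightarrow> (ext x z, ext x z') \<in> E'"
  unfolding E'_def by blast+

lemma E'_cases:
  assumes "(p, q) \<in> E'"
  obtains (old) "(p, q) \<in> E" "length p \<le> i" "length q \<le> i"
  | (up) z where "(p, z) \<in> Z" "q = ext p z" "length p = i" "length q = Suc i"
  | (down) z where "(q, z) \<in> Z" "p = ext q z" "length p = Suc i" "length q = i"
  | (new) x z z' where "(x, z) \<in> Z" "(x, z') \<in> Z" "adj z z'" "p = ext x z" "q = ext x z'"
      "length p = Suc i" "length q = Suc i"
proof -
  consider "(p, q) \<in> E" | z where "(p, z) \<in> Z" "q = ext p z" | z where "(q, z) \<in> Z" "p = ext q z"
  | x z z' where "(x, z) \<in> Z" "(x, z') \<in> Z" "adj z z'" "p = ext x z" "q = ext x z'"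
    using assms unfolding E'_def by blast
  then show ?thesis
  proof cases
    case 1
    show ?thesis by (rule old) (use 1 bounded E_verts E_verts' in blast)+
  next
    case 2
    show ?thesis by (rule up) (use 2 length_ext Z_D(2) in blast)+
  next
    case 3
    show ?thesis by (rule down) (use 3 length_ext Z_D(2) in blast)+
  next
    case 4
    show ?thesis using new[OF 4] length_ext[OF 4(1)] length_ext[OF 4(2)] 4(4,5) by simp
  qed
qed

lemma E'_sym: "(p, q) \<in> E' \<Longrightarrow> (q, p) \<in> E'"
  by (erule E'_cases) (use E'_I E_sym adj_sym in blast)+

lemma E'_old: "(p, q) \<in> E' \<Longrightarrow> length p \<le> i \<Longrightarrow> length q \<le> i \<Longrightarrow> (p, q) \<in> E"
  by (erule E'_cases) auto

lemma E'_up: "(p, q) \<in> E' \<Longrightarrow> length p \<le> i \<Longrightarrow> length q = Suc i \<Longrightarrow> \<exists>z. (p, z) \<in> Z \<and> q = ext p z"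
  by (erule E'_cases) auto

lemma E'_down: "(p, q) \<in> E' \<Longrightarrow> length p = Suc i \<Longrightarrow> length q \<le> i \<Longrightarrow> (q, hd p) \<in> Z \<and> p = ext q (hd p)"
  by (erule E'_cases) auto

lemma E'_new: "(p, q) \<in> E' \<Longrightarrow> length p = Suc i \<Longrightarrow> length q = Suc i \<Longrightarrow>
   \<exists>x. (x, hd p) \<in> Z \<and> (x, hd q) \<in> Z \<and> adj (hd p) (hd q) \<and> p = ext x (hd p) \<and> q = ext x (hd q)"
  by (erule E'_cases) auto

lemma E'_length: "(p, q) \<in> E' \<Longrightarrow> length q \<le> Suc (length p) \<and> length p \<le> Suc i"
  by (erule E'_cases) (auto dest: E_length)

lemma E'_hom: "(p, q) \<in> E' \<Longrightarrow> adj (hd p) (hd q)"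
  by (erule E'_cases) (use E_hom Z_D(3) adj_sym hd_ext in metis)+

lemma E'_vertex:
  assumes "(p, s) \<in> E'" "(p, t) \<in> E'" "length p = Suc (length s)" "length t = length s"
  shows "s = t \<or> (s, t) \<in> E"
proof (cases "length p \<le> i")
  case True
  then show ?thesis using assms E'_old[of p s] E'_old[of p t] cover_vertex[of p s t] by simp
next
  case False
  then have "length p = Suc i" using E'_length[OF assms(1)] by simp
  then have "(s, hd p) \<in> Z \<and> p = ext s (hd p)" "(t, hd p) \<in> Z \<and> p = ext t (hd p)"
    using E'_down[OF assms(1)] E'_down[OF assms(2)] assms by auto
  then show ?thesis using ext_eqD(2) by metis
qed

text \<open>Both properties are symmetric in \<open>q\<close> and \<open>r\<close>, so ordering them
  by level leaves six combinations of levels. The restrictions on \<open>Z\<close> settle the mixed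
  ones; only the case of three new vertices needs the absence of induced 4-cycles.\<close>

lemma E'_local_aux:
  assumes pq: "(p, q) \<in> E'" and pr: "(p, r) \<in> E'" and le: "length q \<le> length r"
  shows "(hd q = hd r \<longrightarrow> q = r) \<and> (adj (hd q) (hd r) \<longrightarrow> (q, r) \<in> E')"
proof -
  have lp: "length p \<le> Suc i" "length q \<le> Suc i" "length r \<le> Suc i"
    using E'_length pq pr E'_sym by blast+
  consider (1) "length p \<le> i" "length r \<le> i" | (2) "length p \<le> i" "length q \<le> i" "length r = Suc i"
    | (3) "length p \<le> i" "length q = Suc i" "length r = Suc i"
    | (4) "length p = Suc i" "length r \<le> i" | (5) "length p = Suc i" "length q \<le> i" "length r = Suc i"
    | (6) "length p = Suc i" "length q = Suc i" "length r = Suc i"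
    using lp le by linarith
  then show ?thesis
  proof cases
    case 1
    then have "(p, q) \<in> E" "(p, r) \<in> E" using pq pr E'_old le by auto
    then show ?thesis using local_inj local_adj E'_I by blast
  next
    case 2
    then have q: "(p, q) \<in> E" using E'_old pq by blast
    obtain z where z: "(p, z) \<in> Z" "r = ext p z" using 2 E'_up pr by blast
    have "(q, r) \<in> E'" if "adj (hd q) (hd r)"
    proof -
      have "(q, z) \<in> Z" using Z_neighbour[OF z(1) q] that z by simp
      then show ?thesis using ext_eq[OF z(1), of q] q z E'_I by metis
    qed
    then show ?thesis using Z_D(4)[OF z(1) q] z by auto
  next
    case 3
    then obtain z z' where "(p, z) \<in> Z" "q = ext p z" "(p, z') \<in> Z" "r = ext p z'" using E'_up pq pr by blast
    then show ?thesis using E'_I(4) by auto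
  next
    case 4
    then have z: "(q, hd p) \<in> Z" "p = ext q (hd p)" "(r, hd p) \<in> Z" "p = ext r (hd p)"
      using E'_down pq pr le by auto
    then have "q = r \<or> (q, r) \<in> E" using ext_eqD(2) by metis
    then show ?thesis using E_hom E'_I(1) by fastforce
  next
    case 5
    then have z: "(q, hd p) \<in> Z" "p = ext q (hd p)" using E'_down pq by auto
    obtain x where x: "(x, hd p) \<in> Z" "(x, hd r) \<in> Z" "p = ext x (hd p)" "r = ext x (hd r)"
      using E'_new pr 5 by blast
    have xq: "x = q \<or> (x, q) \<in> E" using ext_eqD(2) z x by metis
    \<comment> \<open>The edge from \<open>x\<close> to \<open>hd r\<close> has no lift yet, so the
      old vertex \<open>q\<close> cannot be its end point; nor can \<open>x\<close> itself, as
      \<open>hd x\<close> is adjacent to \<open>hd r\<close>.\<close>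
    have "hd q \<noteq> hd r" using xq Z_D(3,4)[OF x(2)] by auto
    moreover have "(q, r) \<in> E'" if "adj (hd q) (hd r)"
    proof -
      have "(q, hd r) \<in> Z" using xq Z_neighbour[OF x(2) _ that] x by blast
      then show ?thesis using ext_eq[OF x(2) _ xq] x E'_I by metis
    qed
    ultimately show ?thesis by blast
  next
    case 6
    obtain x where x: "(x, hd p) \<in> Z" "(x, hd q) \<in> Z" "p = ext x (hd p)" "q = ext x (hd q)"
      using E'_new pq 6 by blast
    obtain y where y: "(y, hd p) \<in> Z" "(y, hd r) \<in> Z" "p = ext y (hd p)" "r = ext y (hd r)"
      using E'_new pr 6 by blast
    have xy: "x = y \<or> (x, y) \<in> E" using ext_eqD(2) y x by metis
    then have yx: "y = x \<or> (y, x) \<in> E" using E_sym by blast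
    have "(q, r) \<in> E'" if a: "adj (hd q) (hd r)"
    proof (cases "(y, hd q) \<in> Z \<or> (x, hd r) \<in> Z")
      case True
      then show ?thesis
      proof
        assume h: "(y, hd q) \<in> Z"
        then have "q = ext y (hd q)" using ext_eq[OF x(2) h xy] x by simp
        then show ?thesis using E'_I(4)[OF h y(2) a] y by simp
      next
        assume h: "(x, hd r) \<in> Z"
        then have "r = ext x (hd r)" using ext_eq[OF y(2) h yx] y by simp
        then show ?thesis using E'_I(4)[OF x(2) h a] x by simp
      qed
    next
      \<comment> \<open>The missing edges propagate neither from \<open>x\<close> to
        \<open>y\<close> nor back, so \<open>hd x, hd q, hd r, hd y\<close> would be an induced
        4-cycle.\<close>
      case False
      then have "(x, y) \<in> E" "(y, x) \<in> E" using xy yx x y by auto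
      moreover from this have "\<not> adj (hd y) (hd q)" "\<not> adj (hd x) (hd r)" "hd y \<noteq> hd q" "hd x \<noteq> hd r"
        using Z_neighbour[OF x(2)] Z_neighbour[OF y(2)] False Z_D(4)[OF x(2)] Z_D(4)[OF y(2)] by auto
      ultimately have "adj (hd q) (hd y)"
        using no_C4D[OF no_C4 Z_D(3)[OF x(2)] a adj_sym[OF Z_D(3)[OF y(2)]] E_hom[of y x]] by metis
      then show ?thesis using \<open>\<not> adj (hd y) (hd q)\<close> adj_sym by blast
    qed
    moreover have "q = r" if "hd q = hd r"
      using ext_eq[OF x(2) _ xy] x(4) y(2,4) that by simp
    ultimately show ?thesis by blast
  qed
qed

lemma E'_local: "(p, q) \<in> E' \<Longrightarrow> (p, r) \<in> E' \<Longrightarrow> hd q = hd r \<Longrightarrow> q = r"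
    "(p, q) \<in> E' \<Longrightarrow> (p, r) \<in> E' \<Longrightarrow> adj (hd q) (hd r) \<Longrightarrow> (q, r) \<in> E'"
  using E'_local_aux[of p q r] E'_local_aux[of p r q] E'_sym adj_sym by (metis nat_le_linear)+

lemma extension: "partial_cover G v0 U' E' (Suc i)"
proof
  fix x y z s t v
  show "x \<in> U'" if "(x, y) \<in> E'" using that
    unfolding U'_def by (rule E'_cases) (use E_verts Z_D(1) in blast)+
  show "(y, x) \<in> E'" if "(x, y) \<in> E'" using that by (rule E'_sym)
  have U'_cases: "x \<in> U \<or> (\<exists>y z. (y, z) \<in> Z \<and> x = ext y z \<and> length x = Suc i)" if "x \<in> U'"
    using that length_ext unfolding U'_def by blast
  show "hd x \<in> V" if "x \<in> U'"
    using U'_cases[OF that] U_hd Z_D(3) adj_verts by fastforce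
  show "[v0] \<in> U'" using root unfolding U'_def by blast
  show "\<exists>y. (y, x) \<in> E' \<and> length x = Suc (length y)" if "x \<in> U'" "x \<noteq> [v0]"
    using U'_cases[OF that(1)] nonroot that(2) E'_I(1) E'_I(2) Z_D(2) by metis
  show "1 \<le> length x" if "x \<in> U'" using U'_cases[OF that] U_length by auto
  show "length y \<le> Suc (length x)" if "(x, y) \<in> E'" using E'_length[OF that] by blast
  show "s = t \<or> (s, t) \<in> E'" if "(x, s) \<in> E'" "(x, t) \<in> E'" "length x = Suc (length s)" "length t = length s"
    using E'_vertex[OF that] E'_I(1) by blast
  show "\<exists>c. (c, x) \<in> E' \<and> (c, y) \<in> E' \<and> length x = Suc (length c)" if "(x, y) \<in> E'" "length x = length y"
    using that(1)
  proof (cases rule: E'_cases)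
    case old
    then show ?thesis using cover_edge that(2) E'_I(1) by blast
  next
    case (new w z z')
    then show ?thesis using E'_I(2) Z_D(2) by metis
  qed (use that(2) in auto)
  show "adj (hd x) (hd y)" if "(x, y) \<in> E'" using E'_hom[OF that] .
  show "y = z" if "(x, y) \<in> E'" "(x, z) \<in> E'" "hd y = hd z" using E'_local(1) that by blast
  show "(y, z) \<in> E'" if "(x, y) \<in> E'" "(x, z) \<in> E'" "adj (hd y) (hd z)" using E'_local(2) that by blast
  show "length x \<le> Suc i" if "x \<in> U'" using U'_cases[OF that] bounded by fastforce
  show "\<exists>y. (x, y) \<in> E' \<and> hd y = v" if "x \<in> U'" "length x < Suc i" "adj (hd x) v"
  proof -
    have x: "x \<in> U" using U'_cases[OF that(1)] that by auto
    show ?thesis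
    proof (cases "length x < i")
      case True
      then show ?thesis using local_surj x that E'_I(1) by blast
    next
      case False
      then have l: "length x = i" using bounded[OF x] by simp
      show ?thesis
      proof (cases "(x, v) \<in> Z")
        case True
        then show ?thesis using E'_I(2) hd_ext by blast
      next
        case False
        then show ?thesis using l x that E'_I(1) unfolding Z_def by blast
      qed
    qed
  qed
qed (use i_pos no_C4 W5hat in auto)

end

locale full_cover = graded_cover +
  assumes full_surj: "x \<in> U \<Longrightarrow> (hd x, v) \<in> edges G \<Longrightarrow> \<exists>y. (x, y) \<in> E \<and> hd y = v"

section \<open>The union of all levels\<close>

context conn_graph begin

text \<open>The root has length 1 and is itself the frontier, so no edge has to lift yet.\<close>

lemma initial_partial_cover:
  assumes "v0 \<in> V" no_C4 "W5hat_condition G"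
  shows "partial_cover G v0 {[v0]} {} 1"
  using assms by unfold_locales auto

text \<open>Each axiom of \<open>full_cover\<close> concerns at most two vertices or edges at a
  time, so it is inherited from one stage of an increasing chain.\<close>

lemma ex_full_cover:
  assumes "v0 \<in> V" no_C4 "W5hat_condition G"
  shows "\<exists>U E. full_cover G v0 U E"
proof -
  let ?P = "\<lambda>n (U, E). partial_cover G v0 U E (Suc n)"
  let ?Q = "\<lambda>(n::nat) (U, E) (U', E'). U \<subseteq> U' \<and> E \<subseteq> E'"
  have "\<exists>S. ?P 0 S" using initial_partial_cover[OF assms] by auto
  moreover have "\<exists>T. ?P (Suc n) T \<and> ?Q n S T" if P: "?P n S" for n S
  proof -
    obtain U E where S: "S = (U, E)" by fastforce
    then interpret partial_cover G v0 U E "Suc n" using P by simp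
    have "?P (Suc n) (U', E') \<and> ?Q n S (U', E')"
      unfolding S using extension by (auto simp: U'_def E'_def)
    then show ?thesis by blast
  qed
  ultimately obtain S where S: "\<And>n. ?P n (S n)" "\<And>n. ?Q n (S n) (S (Suc n))"
    using dependent_nat_choice[of ?P ?Q] by metis
  define U where "U n = fst (S n)" for n
  define E where "E n = snd (S n)" for n
  have P: "partial_cover G v0 (U n) (E n) (Suc n)" for n using S(1)[of n] by (auto simp: U_def E_def split_beta)
  have "U n \<subseteq> U (Suc n)" "E n \<subseteq> E (Suc n)" for n using S(2)[of n] by (auto simp: U_def E_def split_beta)
  then have mono: "U m \<subseteq> U n" "E m \<subseteq> E n" if "m \<le> n" for m n
    using that lift_Suc_mono_le[of U] lift_Suc_mono_le[of E] by auto
  interpret P: partial_cover G v0 "U n" "E n" "Suc n" for n by (rule P)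
  have two: "\<exists>n. e \<in> E n \<and> e' \<in> E n" if ee: "e \<in> (\<Union>n. E n)" "e' \<in> (\<Union>n. E n)" for e e'
  proof -
    obtain m n where "e \<in> E m" "e' \<in> E n" using ee by auto
    then have "e \<in> E (max m n) \<and> e' \<in> E (max m n)" using mono(2) by (meson max.cobounded1 max.cobounded2 subsetD)
    then show ?thesis by blast
  qed
  have "full_cover G v0 (\<Union>n. U n) (\<Union>n. E n)"
  proof
    fix x y z s t v
    show "x \<in> (\<Union>n. U n)" if "(x, y) \<in> (\<Union>n. E n)" using that P.E_verts by blast
    show "(y, x) \<in> (\<Union>n. E n)" if "(x, y) \<in> (\<Union>n. E n)" using that P.E_sym by blast
    show "hd x \<in> V" if "x \<in> (\<Union>n. U n)" using that P.U_hd by blast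
    show "[v0] \<in> (\<Union>n. U n)" using P.root by blast
    show "\<exists>y. (y, x) \<in> (\<Union>n. E n) \<and> length x = Suc (length y)" if "x \<in> (\<Union>n. U n)" "x \<noteq> [v0]"
      using that P.nonroot by blast
    show "1 \<le> length x" if "x \<in> (\<Union>n. U n)" using that P.U_length by blast
    show "length y \<le> Suc (length x)" if "(x, y) \<in> (\<Union>n. E n)" using that P.E_length by blast
    show "s = t \<or> (s, t) \<in> (\<Union>n. E n)" if "(x, s) \<in> (\<Union>n. E n)" "(x, t) \<in> (\<Union>n. E n)" "length x = Suc (length s)" "length t = length s"
      using two[OF that(1,2)] P.cover_vertex that(3,4) by blast
    show "\<exists>c. (c, x) \<in> (\<Union>n. E n) \<and> (c, y) \<in> (\<Union>n. E n) \<and> length x = Suc (length c)" if "(x, y) \<in> (\<Union>n. E n)" "length x = length y"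
      using that P.cover_edge by blast
    show "adj (hd x) (hd y)" if "(x, y) \<in> (\<Union>n. E n)" using that P.E_hom by blast
    show "y = z" if "(x, y) \<in> (\<Union>n. E n)" "(x, z) \<in> (\<Union>n. E n)" "hd y = hd z"
      using two[OF that(1,2)] P.local_inj that(3) by blast
    show "(y, z) \<in> (\<Union>n. E n)" if "(x, y) \<in> (\<Union>n. E n)" "(x, z) \<in> (\<Union>n. E n)" "adj (hd y) (hd z)"
      using two[OF that(1,2)] P.local_adj that(3) by blast
    show "\<exists>y. (x, y) \<in> (\<Union>n. E n) \<and> hd y = v" if xv: "x \<in> (\<Union>n. U n)" "adj (hd x) v"
    proof -
      obtain n where "x \<in> U n" using xv by blast
      \<comment> \<open>At this stage \<open>x\<close> is strictly below the frontier, where all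
        edges lift.\<close>
      then have "x \<in> U (max n (length x))" using mono(1) by (meson max.cobounded1 subsetD)
      then show ?thesis using P.local_surj[of x "max n (length x)" v] xv by (auto simp: less_Suc_eq_le)
    qed
  qed
  then show ?thesis by blast
qed

end

subsection \<open>Monodromy\<close>

context conn_graph begin

text \<open>A discrete null homotopy of the closed walk \<open>c\<close> of length \<open>m\<close>: row \<open>0\<close> of the grid \<open>\<mu>\<close> is
  constant, the last row runs through \<open>c\<close> (each step taking \<open>s\<close> columns), every row is closed,
  and the corners of every cell are pairwise equal or adjacent.\<close>

definition null_homotopy :: "(nat \<Rightarrow> 'a) \<Rightarrow> nat \<Rightarrow> nat \<Rightarrow> nat \<Rightarrow> (nat \<Rightarrow> nat \<Rightarrow> 'a) \<Rightarrow> bool" where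
  "null_homotopy c m N s \<mu> \<longleftrightarrow>
     (\<forall>j\<le>N. \<forall>k<m * s. adjeq (\<mu> j k) (\<mu> j (Suc k))) \<and>
     (\<forall>j<N. \<forall>k\<le>m * s. adjeq (\<mu> j k) (\<mu> (Suc j) k)) \<and>
     (\<forall>j<N. \<forall>k<m * s. adjeq (\<mu> j k) (\<mu> (Suc j) (Suc k))) \<and>
     (\<forall>k\<le>m * s. \<mu> 0 k = \<mu> 0 0) \<and>
     (\<forall>j\<le>N. \<mu> j (m * s) = \<mu> j 0) \<and>
     (\<forall>k\<le>m. \<mu> N (k * s) = c k) \<and>
     (\<forall>k<m. \<forall>l. k * s \<le> l \<and> l \<le> Suc k * s \<longrightarrow> \<mu> N l \<in> {c k, c (Suc k)})"

definition null_homotopic :: "(nat \<Rightarrow> 'a) \<Rightarrow> nat \<Rightarrow> bool" where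
  "null_homotopic c m \<longleftrightarrow> (\<exists>N s \<mu>. null_homotopy c m N s \<mu>)"

end

context full_cover begin

text \<open>Walks may pause, since neighbouring points of a grid can carry the same label; a pause
  lifts to a pause.\<close>

definition Eeq where "Eeq x y \<longleftrightarrow> x \<in> U \<and> (x = y \<or> (x, y) \<in> E)"

lemma Eeq_sym: "Eeq x y \<Longrightarrow> Eeq y x"
  unfolding Eeq_def using E_sym E_verts' by blast

lemma Eeq_refl: "x \<in> U \<Longrightarrow> Eeq x x"
  unfolding Eeq_def by blast

lemma Eeq_U: "Eeq x y \<Longrightarrow> x \<in> U" "Eeq x y \<Longrightarrow> y \<in> U"
  unfolding Eeq_def using E_verts' by blast+

lemma Eeq_hd: "Eeq x y \<Longrightarrow> adjeq (hd x) (hd y)"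
  unfolding Eeq_def using E_hom by blast

lemma Eeq_inj: "Eeq x y \<Longrightarrow> Eeq x z \<Longrightarrow> hd y = hd z \<Longrightarrow> y = z"
  unfolding Eeq_def using local_inj E_hom adj_irrefl by metis

lemma Eeq_local:
  assumes "Eeq x y" "Eeq x z" "adjeq (hd y) (hd z)" shows "Eeq y z"
proof (cases "hd y = hd z")
  case True
  then show ?thesis using Eeq_inj assms Eeq_refl Eeq_U by metis
next
  case False
  then have "adj (hd y) (hd z)" using assms by blast
  then show ?thesis using assms local_adj E_verts' E_sym unfolding Eeq_def by blast
qed

definition nxt :: "'a list \<Rightarrow> 'a \<Rightarrow> 'a list" where
  "nxt x v = (SOME y. Eeq x y \<and> hd y = v)"

lemma nxt:
  assumes "x \<in> U" "adjeq (hd x) v" shows "Eeq x (nxt x v)" "hd (nxt x v) = v"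
proof -
  have "\<exists>y. Eeq x y \<and> hd y = v"
    using assms full_surj unfolding Eeq_def by blast
  then have "Eeq x (nxt x v) \<and> hd (nxt x v) = v" unfolding nxt_def by (rule someI_ex)
  then show "Eeq x (nxt x v)" "hd (nxt x v) = v" by auto
qed

lemma nxt_unique: "Eeq x y \<Longrightarrow> nxt x (hd y) = y"
  using nxt Eeq_inj Eeq_U Eeq_hd by metis

primrec lift :: "'a list \<Rightarrow> (nat \<Rightarrow> 'a) \<Rightarrow> nat \<Rightarrow> 'a list" where
  "lift x c 0 = x"
| "lift x c (Suc k) = nxt (lift x c k) (c (Suc k))"

lemma lift:
  assumes "x \<in> U" "hd x = c 0" "\<And>k. k < n \<Longrightarrow> adjeq (c k) (c (Suc k))"
  shows "k \<le> n \<Longrightarrow> lift x c k \<in> U \<and> hd (lift x c k) = c k"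
    and "k < n \<Longrightarrow> Eeq (lift x c k) (lift x c (Suc k))"
proof -
  have *: "lift x c k \<in> U \<and> hd (lift x c k) = c k" if "k \<le> n" for k
    using that
  proof (induction k)
    case (Suc k)
    then have "lift x c k \<in> U" "adjeq (hd (lift x c k)) (c (Suc k))" using assms(3)[of k] by auto
    then show ?case using Eeq_U(2)[OF nxt(1)] nxt(2) by simp
  qed (use assms in simp)
  then show "k \<le> n \<Longrightarrow> lift x c k \<in> U \<and> hd (lift x c k) = c k" .
  assume "k < n"
  then show "Eeq (lift x c k) (lift x c (Suc k))" using *[of k] nxt assms(3)[of k] by simp
qed

text \<open>Across a cell, lift the diagonal from \<open>c k\<close> to \<open>c' (Suc k)\<close>.
  Its end \<open>r\<close> is next to the lift of \<open>c' k\<close>, so by uniqueness it is the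
  next vertex of the lifted second row; it is also next to the lift of
  \<open>c (Suc k)\<close>.\<close>

lemma lift_adjacent_rows:
  assumes x: "Eeq x x'" "hd x = c 0" "hd x' = c' 0"
    and c: "\<And>k. k < n \<Longrightarrow> adjeq (c k) (c (Suc k))" "\<And>k. k < n \<Longrightarrow> adjeq (c' k) (c' (Suc k))"
      "\<And>k. k \<le> n \<Longrightarrow> adjeq (c k) (c' k)" "\<And>k. k < n \<Longrightarrow> adjeq (c k) (c' (Suc k))"
  shows "k \<le> n \<Longrightarrow> Eeq (lift x c k) (lift x' c' k)"
proof (induction k)
  case (Suc k)
  let ?p = "lift x c k" and ?p' = "lift x' c' k" and ?q = "lift x c (Suc k)" and ?q' = "lift x' c' (Suc k)"
  have xU: "x \<in> U" "x' \<in> U" using Eeq_U x by auto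
  have pp: "Eeq ?p ?p'" using Suc by simp
  have pq: "Eeq ?p ?q" "Eeq ?p' ?q'" using lift(2)[of x c n, OF xU(1) x(2) c(1)] lift(2)[of x' c' n, OF xU(2) x(3) c(2)] Suc.prems by auto
  have h: "hd ?p = c k" "hd ?p' = c' k" "hd ?q = c (Suc k)" "hd ?q' = c' (Suc k)"
    using lift(1)[of x c n, OF xU(1) x(2) c(1)] lift(1)[of x' c' n, OF xU(2) x(3) c(2)] Suc.prems Suc_leD by metis+
  define r where "r = nxt ?p (c' (Suc k))"
  have r: "Eeq ?p r" "hd r = c' (Suc k)"
    unfolding r_def using nxt[OF Eeq_U(1)[OF pp]] c(4)[of k] h Suc.prems by auto
  have "Eeq ?p' r" using Eeq_local[OF pp r(1)] r h c(2)[of k] Suc.prems by simp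
  then have "r = ?q'" using Eeq_inj[OF _ pq(2)] r h by metis
  then show ?case using Eeq_local[OF pq(1), of ?q'] r h c(3)[of "Suc k"] Suc.prems by simp
qed (use x in simp)

text \<open>Within one block the labels are only \<open>c k\<close> and \<open>c (Suc k)\<close>. By
  local injectivity the lift can only alternate between the two lifted vertices, and the label at
  the end of the block decides which one is reached.\<close>

lemma lift_refinement:
  assumes x: "x \<in> U" "hd x = c 0"
    and c: "\<And>k. k < m \<Longrightarrow> adjeq (c k) (c (Suc k))"
    and \<mu>: "\<And>k. k < m * s \<Longrightarrow> adjeq (\<mu> k) (\<mu> (Suc k))" "\<And>k. k \<le> m \<Longrightarrow> \<mu> (k * s) = c k"
      "\<And>k l. k < m \<Longrightarrow> k * s \<le> l \<Longrightarrow> l \<le> Suc k * s \<Longrightarrow> \<mu> l \<in> {c k, c (Suc k)}"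
  shows "k \<le> m \<Longrightarrow> lift x \<mu> (k * s) = lift x c k"
proof (induction k)
  case (Suc k)
  let ?p = "lift x c k" and ?q = "lift x c (Suc k)"
  have x0: "hd x = \<mu> 0" using x \<mu>(2)[of 0] by simp
  have IH: "lift x \<mu> (k * s) = ?p" and k: "k < m" using Suc by auto
  have pq: "Eeq ?p ?q" using lift(2)[of x c m, OF x c] k by blast
  have h: "hd ?p = c k" "hd ?q = c (Suc k)" using lift(1)[of x c m, OF x c] Suc.prems Suc_leD by metis+
  have "lift x \<mu> (k * s + l) \<in> {?p, ?q}" if "l \<le> s" for l
    using that
  proof (induction l)
    case 0 then show ?case using IH by simp
  next
    case (Suc l)
    have "Suc k * s \<le> m * s" using k by (intro mult_le_mono1) simp
    then have l: "k * s + l < m * s" using Suc.prems by simp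
    let ?r = "lift x \<mu> (k * s + l)" and ?r' = "lift x \<mu> (k * s + Suc l)"
    have "Eeq ?r ?r'" using lift(2)[of x \<mu> "m * s", OF x(1) x0 \<mu>(1) l] by simp
    moreover have "hd ?r' \<in> {c k, c (Suc k)}"
      using lift(1)[of x \<mu> "m * s" "k * s + Suc l", OF x(1) x0 \<mu>(1)] l \<mu>(3)[OF k, of "k * s + Suc l"] Suc.prems by simp
    moreover have "Eeq ?r ?p" "Eeq ?r ?q"
      using Suc pq Eeq_refl Eeq_sym Eeq_U by (metis Suc_leD insertE singletonD)+
    ultimately show ?case using Eeq_inj h by (metis insert_iff empty_iff)
  qed
  from this[of s] have s: "lift x \<mu> (Suc k * s) \<in> {?p, ?q}" by (simp add: add.commute)
  have "Suc k * s \<le> m * s" using k by (intro mult_le_mono1) simp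
  then have "hd (lift x \<mu> (Suc k * s)) = c (Suc k)"
    using lift(1)[of x \<mu> "m * s" "Suc k * s", OF x(1) x0 \<mu>(1)] \<mu>(2)[OF Suc.prems] by simp
  then show ?case using s pq h Eeq_U Eeq_inj Eeq_refl by (metis insert_iff empty_iff)
qed simp

text \<open>Closedness of the lift passes from row to row, for every start above the row. The
  constant row lifts to a constant. If row \<open>j\<close> lifts to a closed walk at
  \<open>y\<close>, the next lift starts and ends at neighbours of \<open>y\<close> over the same
  vertex, and these coincide.\<close>

lemma lift_null_homotopic:
  assumes "null_homotopic c m" and x: "x \<in> U" "hd x = c 0"
    and c: "\<And>k. k < m \<Longrightarrow> adjeq (c k) (c (Suc k))"
  shows "lift x c m = x"
proof -
  obtain N s \<mu> where h: "null_homotopy c m N s \<mu>"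
    using assms(1)[unfolded null_homotopic_def] by (elim exE)
  note h = h[unfolded null_homotopy_def]
  note \<mu> =
    h[THEN conjunct1, rule_format]
    h[THEN conjunct2, THEN conjunct1, rule_format]
    h[THEN conjunct2, THEN conjunct2, THEN conjunct1, rule_format]
    h[THEN conjunct2, THEN conjunct2, THEN conjunct2, THEN conjunct1, rule_format]
    h[THEN conjunct2, THEN conjunct2, THEN conjunct2, THEN conjunct2, THEN conjunct1, rule_format]
    h[THEN conjunct2, THEN conjunct2, THEN conjunct2, THEN conjunct2, THEN conjunct2, THEN conjunct1, rule_format]
    h[THEN conjunct2, THEN conjunct2, THEN conjunct2, THEN conjunct2, THEN conjunct2, THEN conjunct2, rule_format, OF _ conjI]
  have "lift x (\<mu> j) (m * s) = x" if "j \<le> N" "x \<in> U" "hd x = \<mu> j 0" for j x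
    using that
  proof (induction j arbitrary: x)
    case 0
    have "lift x (\<mu> 0) k = x" if "k \<le> m * s" for k
      using that
    proof (induction k)
      case (Suc k)
      then have "\<mu> 0 (Suc k) = hd x" using \<mu>(4)[of "Suc k"] 0(3) by metis
      then show ?case using Suc nxt_unique[OF Eeq_refl[OF 0(2)]] by simp
    qed simp
    then show ?case by simp
  next
    case (Suc j)
    define y where "y = nxt x (\<mu> j 0)"
    have "adjeq (hd x) (\<mu> j 0)" using \<mu>(2)[of j 0] Suc.prems adj_sym by auto
    then have y: "Eeq x y" "hd y = \<mu> j 0" unfolding y_def using nxt Suc.prems by auto
    have "Eeq (lift y (\<mu> j) (m * s)) (lift x (\<mu> (Suc j)) (m * s))"
      by (rule lift_adjacent_rows[of y x "\<mu> j" "\<mu> (Suc j)" "m * s", OF Eeq_sym[OF y(1)] y(2) Suc.prems(3)])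
        (use \<mu>(1)[of j] \<mu>(1)[of "Suc j"] \<mu>(2)[of j] \<mu>(3)[of j] Suc.prems in auto)
    moreover have "lift y (\<mu> j) (m * s) = y" using Suc y Eeq_U by simp
    moreover have "hd (lift x (\<mu> (Suc j)) (m * s)) = \<mu> (Suc j) (m * s)"
      using lift(1)[of x "\<mu> (Suc j)" "m * s" "m * s", OF Suc.prems(2,3) \<mu>(1)[OF Suc.prems(1)]] by simp
    then have "hd (lift x (\<mu> (Suc j)) (m * s)) = hd x" using \<mu>(5)[OF Suc.prems(1)] Suc.prems by simp
    ultimately show ?case using Eeq_inj y Eeq_sym by metis
  qed
  then have "lift x (\<mu> N) (m * s) = x" using x \<mu>(6)[of 0] by simp
  moreover have "lift x (\<mu> N) (m * s) = lift x c m"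
    by (rule lift_refinement[of x c m s "\<mu> N" m]) (use x c \<mu>(1)[of N] \<mu>(6,7) in auto)
  ultimately show ?thesis by simp
qed

lemma walk_from_root:
  assumes "x \<in> U"
  shows "\<exists>e. e 0 = [v0] \<and> e (length x - 1) = x \<and> (\<forall>k<length x - 1. (e k, e (Suc k)) \<in> E)"
  using assms
proof (induction "length x" arbitrary: x rule: less_induct)
  case less
  show ?case
  proof (cases "x = [v0]")
    case True
    then show ?thesis by (intro exI[of _ "\<lambda>_. [v0]"]) simp
  next
    case False
    then obtain y where y: "(y, x) \<in> E" "length x = Suc (length y)" using nonroot less.prems by blast
    have "length y \<ge> 1" using U_length E_verts[OF y(1)] by blast
    obtain e where e: "e 0 = [v0]" "e (length y - 1) = y" "\<forall>k<length y - 1. (e k, e (Suc k)) \<in> E"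
      using less.hyps[of y] y E_verts by auto
    have "(e(length y := x)) 0 = [v0] \<and> (e(length y := x)) (length x - 1) = x \<and>
      (\<forall>k<length x - 1. ((e(length y := x)) k, (e(length y := x)) (Suc k)) \<in> E)"
    proof (intro conjI allI impI)
      fix k assume "k < length x - 1"
      then consider "k < length y - 1" | "k = length y - 1" using y by linarith
      then show "((e(length y := x)) k, (e(length y := x)) (Suc k)) \<in> E"
        using e y \<open>length y \<ge> 1\<close> by cases auto
    qed (use e y \<open>length y \<ge> 1\<close> in auto)
    then show ?thesis by blast
  qed
qed

text \<open>Walks from the root to \<open>x\<close> and to \<open>y\<close> project to walks with
  the same end, and going along one and back along the other is a closed walk in \<open>G\<close>.
  Its lift at the root is closed; read forwards it reaches \<open>x\<close> at time
  \<open>n\<close>, read backwards it reaches \<open>y\<close> at the same time.\<close>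

lemma hd_inj:
  assumes nh: "\<And>c m. c 0 = c m \<Longrightarrow> (\<And>k. k \<le> m \<Longrightarrow> c k \<in> V) \<Longrightarrow>
      (\<And>k. k < m \<Longrightarrow> adjeq (c k) (c (Suc k))) \<Longrightarrow> null_homotopic c m"
  shows "inj_on hd U"
proof (rule inj_onI)
  fix x y assume xy: "x \<in> U" "y \<in> U" "hd x = hd y"
  obtain e where e: "e 0 = [v0]" "e (length x - 1) = x" "\<And>k. k<length x - 1 \<Longrightarrow> (e k, e (Suc k)) \<in> E"
    using walk_from_root[OF xy(1)] by blast
  obtain f where f: "f 0 = [v0]" "f (length y - 1) = y" "\<And>k. k<length y - 1 \<Longrightarrow> (f k, f (Suc k)) \<in> E"
    using walk_from_root[OF xy(2)] by blast
  define n where "n = length x - 1"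
  define m where "m = n + (length y - 1)"
  note defs = n_def m_def
  define c where "c k = (if k \<le> n then hd (e k) else hd (f (m - k)))" for k
  have f': "Eeq (f (m - k)) (f (m - Suc k))" if "n \<le> k" "k < m" for k
  proof -
    have "m - k = Suc (m - Suc k)" "m - Suc k < length y - 1" using that unfolding defs by auto
    then show ?thesis using f(3)[of "m - Suc k"] E_sym E_verts' unfolding Eeq_def by metis
  qed
  have e': "Eeq (e k) (e (Suc k))" if "k < n" for k using that e(3) E_verts unfolding Eeq_def n_def by blast
  have mid: "hd (e n) = hd (f (m - n))" using e(2) f(2) xy unfolding defs by simp
  have c2: "c k = hd (f (m - k))" if "n \<le> k" for k using that mid unfolding c_def by (cases "k = n") auto
  have ce: "adjeq (c k) (c (Suc k))" if "k < m" for k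
  proof (cases "k < n")
    case True then show ?thesis using Eeq_hd[OF e'[OF True]] unfolding c_def by simp
  next
    case False then show ?thesis using Eeq_hd[OF f'[of k]] that c2 by simp
  qed
  have c0: "c 0 = v0" "c m = v0" using e(1) f(1) c2[of m] unfolding c_def by (auto simp: m_def)
  have cV: "c k \<in> V" if "k \<le> m" for k
    using that
  proof (induction k)
    case 0 then show ?case using c0 U_hd[OF root] by simp
  next
    case (Suc k) then show ?case using ce[of k] adj_verts(2) by (metis Suc_le_eq Suc_leD)
  qed
  have "null_homotopic c m" using nh[of c m] c0 cV ce by simp
  then have closed: "lift [v0] c m = [v0]" using lift_null_homotopic[of c m "[v0]"] root ce c0 by simp
  have "lift [v0] c k = e k" if "k \<le> n" for k
    using that
  proof (induction k)
    case (Suc k)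
    then show ?case using nxt_unique[OF e'[of k]] unfolding c_def by simp
  qed (use e in simp)
  then have ln: "lift [v0] c n = x" using e(2) unfolding n_def by simp
  \<comment> \<open>Since the lift ends at the root, it can be followed backwards, where local
    injectivity forces it to agree with \<open>f\<close>.\<close>
  have "k \<le> m - n \<longrightarrow> lift [v0] c (m - k) = f k" for k
  proof (induction k)
    case 0 then show ?case using closed f by simp
  next
    case (Suc k)
    show ?case
    proof
      assume k: "Suc k \<le> m - n"
      have s: "Suc (m - Suc k) = m - k" "m - Suc k < m" "m - (m - Suc k) = Suc k" "m - (m - k) = k" using k by auto
      have h0: "hd [v0] = c 0" using c0 by simp
      have "Eeq (lift [v0] c (m - Suc k)) (lift [v0] c (m - k))"
        using lift(2)[of "[v0]" c m, OF root h0 ce s(2)] s by simp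
      then have 1: "Eeq (f k) (lift [v0] c (m - Suc k))" using Suc k Eeq_sym by simp
      have "Eeq (f (Suc k)) (f k)" using f'[of "m - Suc k"] s k by simp
      then have 2: "Eeq (f k) (f (Suc k))" by (rule Eeq_sym)
      have "n \<le> m - Suc k" using k by simp
      then have "hd (lift [v0] c (m - Suc k)) = hd (f (Suc k))"
        using lift(1)[of "[v0]" c m "m - Suc k", OF root h0 ce] c2[of "m - Suc k"] s by simp
      then show "lift [v0] c (m - Suc k) = f (Suc k)" using Eeq_inj[OF 1 2] by simp
    qed
  qed
  from this[of "m - n"] have "lift [v0] c n = y" using f(2) by (simp add: m_def)
  then show "x = y" using ln by simp
qed

lemma hd_walk_lift:
  assumes "x \<in> U" "(hd x, v) \<in> edges G ^^ n"
  shows "\<exists>y\<in>U. hd y = v \<and> length y \<le> length x + n"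
  using assms(2)
proof (induction n arbitrary: v)
  case (Suc n)
  then obtain w where w: "(hd x, w) \<in> edges G ^^ n" "adj w v" by auto
  then obtain y where y: "y \<in> U" "hd y = w" "length y \<le> length x + n" using Suc by blast
  then obtain z where "(y, z) \<in> E" "hd z = v" using full_surj w by blast
  then show ?case using E_verts' E_length[of y z] y by (intro bexI[of _ z]) auto
qed (use assms in auto)

text \<open>Walks in the cover project and walks in \<open>G\<close> lift, so under injectivity a
  vertex of length \<open>l\<close> lies over a vertex at distance \<open>l - 1\<close> from
  \<open>v0\<close>. Edges of \<open>G\<close> lift too, so \<open>cover_vertex\<close> and
  \<open>cover_edge\<close> become the two conditions in \<open>G\<close>.\<close>

lemma cover_trivial:
  assumes inj: "inj_on hd U"
  shows "vertex_cond v0 \<and> edge_cond v0"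
proof -
  have v0: "v0 \<in> V" using U_hd[OF root] by simp
  have dist: "gd v0 (hd x) = length x - 1" if x: "x \<in> U" for x
  proof (rule antisym)
    obtain e where e: "e 0 = [v0]" "e (length x - 1) = x" "\<forall>k<length x - 1. (e k, e (Suc k)) \<in> E"
      using walk_from_root[OF x] by blast
    have "gd (hd (e 0)) (hd (e (length x - 1))) \<le> length x - 1"
      using e E_hom v0 by (intro gd_walk_le[of _ "\<lambda>k. hd (e k)"]) auto
    then show "gd v0 (hd x) \<le> length x - 1" using e by simp
    obtain y where "y \<in> U" "hd y = hd x" "length y \<le> 1 + gd v0 (hd x)"
      using hd_walk_lift[OF root, of "hd x" "gd v0 (hd x)"] gd_walk[OF v0 U_hd[OF x]] by auto
    then show "length x - 1 \<le> gd v0 (hd x)" using inj x unfolding inj_on_def by auto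
  qed
  have ex: "\<exists>x\<in>U. hd x = v \<and> length x = Suc (gd v0 v)" if v: "v \<in> V" for v
  proof -
    obtain x where x: "x \<in> U" "hd x = v"
      using hd_walk_lift[OF root, of v] gd_walk[OF v0 v] by auto
    then show ?thesis using dist[OF x(1)] U_length[OF x(1)] by auto
  qed
  have edge: "(x, y) \<in> E" if xy: "x \<in> U" "y \<in> U" "adj (hd x) (hd y)" for x y
  proof -
    obtain z where "(x, z) \<in> E" "hd z = hd y" using full_surj[OF xy(1,3)] by blast
    then show ?thesis using inj xy E_verts' unfolding inj_on_def by metis
  qed
  show ?thesis
  proof
    show "vertex_cond v0" unfolding vertex_cond_def
    proof (intro allI impI, elim conjE)
      fix a s t assume *: "adj a s" "adj a t" "gd v0 a = Suc (gd v0 s)" "gd v0 s = gd v0 t"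
      obtain x where x: "x \<in> U" "hd x = a" "length x = Suc (gd v0 a)" using ex[of a] * adj_verts by blast
      obtain y where y: "y \<in> U" "hd y = s" "length y = Suc (gd v0 s)" using ex[of s] * adj_verts by blast
      obtain z where z: "z \<in> U" "hd z = t" "length z = Suc (gd v0 t)" using ex[of t] * adj_verts by blast
      have "y = z \<or> (y, z) \<in> E"
        using cover_vertex[of x y z] edge[of x y] edge[of x z] x y z * by simp
      then show "adjeq s t" using E_hom y z by blast
    qed
    show "edge_cond v0" unfolding edge_cond_def
    proof (intro allI impI, elim conjE)
      fix a b n assume *: "adj a b" "gd v0 a = Suc n" "gd v0 b = Suc n"
      obtain x where x: "x \<in> U" "hd x = a" "length x = Suc (gd v0 a)" using ex[of a] * adj_verts by blast
      obtain y where y: "y \<in> U" "hd y = b" "length y = Suc (gd v0 b)" using ex[of b] * adj_verts by blast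
      obtain c where c: "(c, x) \<in> E" "(c, y) \<in> E" "length x = Suc (length c)"
        using cover_edge[of x y] edge[of x y] x y * by auto
      then have "gd v0 (hd c) = n" using dist[of c] E_verts x * by auto
      then show "\<exists>c. adj c a \<and> adj c b \<and> gd v0 c = n" using c x y E_hom by blast
    qed
  qed
qed

end

context conn_graph begin

lemma local_global_vertex_edge:
  assumes "no_C4" "W5hat_condition G"
    and nh: "\<And>c m. c 0 = c m \<Longrightarrow> (\<And>k. k \<le> m \<Longrightarrow> c k \<in> V) \<Longrightarrow>
      (\<And>k. k < m \<Longrightarrow> adjeq (c k) (c (Suc k))) \<Longrightarrow> null_homotopic c m"
  shows vertex_edge
  unfolding vertex_edge_def
proof
  fix v assume "v \<in> V"
  then obtain U E where "full_cover G v U E" using ex_full_cover[OF _ assms(1,2)] by blast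
  then interpret full_cover G v U E .
  show "vertex_cond v \<and> edge_cond v" by (rule cover_trivial[OF hd_inj]) (rule nh)
qed

end

subsection \<open>Maps into the geometric realization\<close>

text \<open>The argument jumps at 1. On the lower half circle it is rewritten through the conjugate,
  where it is continuous, and \<open>p 0 = p 1\<close> makes the two formulas agree at 1.\<close>

lemma continuous_on_circle_of_loop:
  fixes p :: "real \<Rightarrow> 'b::topological_space"
  assumes p: "continuous_on {0..1} p" and eq: "p 0 = p 1"
  shows "continuous_on (sphere 0 1) (\<lambda>z. p (Arg2pi z / (2 * pi)))"
proof -
  have Arg2pi_eq: "1 - Arg2pi (cnj y) / (2 * pi) = Arg2pi y / (2 * pi) \<or> Arg2pi y = 0 \<and> Arg2pi (cnj y) = 0" if "cmod y = 1" for y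
    using that Arg2pi_eq_0_pi Arg2pi_eq_pi by (force simp: Arg2pi_cnj field_split_simps)
  have le: "Arg2pi z \<le> 2 * pi" for z
    by (simp add: Arg2pi order_le_less)
  have "continuous_on (sphere 0 1) (\<lambda>z. if Im z \<le> 0 then p (1 - Arg2pi (cnj z) / (2 * pi)) else p (Arg2pi z / (2 * pi)))"
  proof (rule continuous_on_cases_le)
    show "continuous_on {z \<in> sphere 0 1. Im z \<le> 0} (\<lambda>z. p (1 - Arg2pi (cnj z) / (2 * pi)))"
      by (intro continuous_on_compose2[OF p] continuous_intros continuous_on_compose2[OF continuous_on_upperhalf_Arg2pi])
        (auto simp: Arg2pi le)
    show "continuous_on {z \<in> sphere 0 1. 0 \<le> Im z} (\<lambda>z. p (Arg2pi z / (2 * pi)))"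
      by (intro continuous_on_compose2[OF p] continuous_intros continuous_on_compose2[OF continuous_on_upperhalf_Arg2pi])
        (auto simp: Arg2pi le)
    show "p (1 - Arg2pi (cnj z) / (2 * pi)) = p (Arg2pi z / (2 * pi))" if "z \<in> sphere 0 1" "Im z = 0" for z
      using Arg2pi_eq[of z] that eq by auto
  qed (intro continuous_intros)
  moreover have "p (1 - Arg2pi (cnj z) / (2 * pi)) = p (Arg2pi z / (2 * pi))" if "z \<in> sphere 0 1" for z
    using Arg2pi_eq[of z] that eq by auto
  ultimately show ?thesis by (elim continuous_on_eq) simp
qed

lemma dist_cis_le: "dist (cis a) (cis b) \<le> \<bar>a - b\<bar>"
proof -
  have "cis a - cis b = cis b * (exp (\<i> * of_real (a - b)) - 1)"
    by (simp add: cis_conv_exp algebra_simps flip: exp_add)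
  then have "dist (cis a) (cis b) = 2 * \<bar>sin ((a - b) / 2)\<bar>"
    by (simp add: dist_norm norm_mult dist_exp_i_1 del: of_real_diff)
  then show ?thesis using abs_sin_x_le_abs_x[of "(a - b) / 2"] by simp
qed

lemma Arg2pi_cis: "0 \<le> t \<Longrightarrow> t < 2 * pi \<Longrightarrow> Arg2pi (cis t) = t"
  using Arg2pi_unique[of 1 t "cis t"] by (simp add: cis_conv_exp)

lemma finite_imp_closed_fun:
  fixes A :: "('a \<Rightarrow> 'b::t2_space) set"
  assumes "finite A" shows "closed A"
proof -
  have "closed (\<Inter>v. {q. q v = p v})" for p :: "'a \<Rightarrow> 'b"
    by (intro closed_INT ballI closed_Collect_eq continuous_intros continuous_on_product_coordinates)
  moreover have "(\<Inter>v. {q. q v = p v}) = {p}" for p :: "'a \<Rightarrow> 'b" by auto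
  ultimately have "closed (\<Union>p\<in>A. {p})" using assms by (intro closed_UN) auto
  then show ?thesis by simp
qed

section \<open>Points of the realization and its weak topology\<close>

abbreviation supp :: "('a \<Rightarrow> real) \<Rightarrow> 'a set" where "supp p \<equiv> {v. p v \<noteq> 0}"

context conn_flag begin

abbreviation "R \<equiv> realization X"
abbreviation "P \<equiv> realization_points X"

lemma realization_pointI:
  assumes "\<And>v. 0 \<le> p v" "supp p \<subseteq> \<sigma>" "\<sigma> \<in> X" "sum p \<sigma> = 1"
  shows "p \<in> P"
proof -
  have "sum p (supp p) = sum p \<sigma>"
    by (rule sum.mono_neutral_left) (use assms simplex_finite in auto)
  then show ?thesis using assms simplex_subset unfolding realization_points_def by auto
qed

lemma realization_pointD: "p \<in> P \<Longrightarrow> 0 \<le> p v" "p \<in> P \<Longrightarrow> supp p \<in> X"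
  unfolding realization_points_def by auto

lemma realization_point_sum:
  assumes "p \<in> P" "supp p \<subseteq> W" "finite W" shows "sum p W = 1"
proof -
  have "sum p (supp p) = sum p W"
    by (rule sum.mono_neutral_left) (use assms in auto)
  then show ?thesis using assms unfolding realization_points_def by auto
qed

lemma supp_nonempty: "p \<in> P \<Longrightarrow> supp p \<noteq> {}"
proof
  assume "p \<in> P" "supp p = {}"
  then have "sum p {} = 1" unfolding realization_points_def by (metis (mono_tags, lifting) mem_Collect_eq)
  then show False by simp
qed

lemma realization_point_convex:
  assumes "p \<in> P" "q \<in> P" "supp p \<union> supp q \<in> X" "0 \<le> s" "s \<le> (1::real)"
  shows "(\<lambda>v. (1 - s) * p v + s * q v) \<in> P"
proof (rule realization_pointI[OF _ _ assms(3)])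
  show "0 \<le> (1 - s) * p v + s * q v" for v using assms realization_pointD by simp
  show "supp (\<lambda>v. (1 - s) * p v + s * q v) \<subseteq> supp p \<union> supp q" by auto
  have f: "finite (supp p \<union> supp q)" using simplex_finite assms(3) by blast
  have "sum p (supp p \<union> supp q) = 1" "sum q (supp p \<union> supp q) = 1"
    using realization_point_sum[OF assms(1) _ f] realization_point_sum[OF assms(2) _ f] by auto
  then show "(\<Sum>v\<in>supp p \<union> supp q. (1 - s) * p v + s * q v) = 1"
    by (simp add: sum.distrib flip: sum_distrib_left)
qed

definition vertex_point :: "'a \<Rightarrow> 'a \<Rightarrow> real" where
  "vertex_point u = (\<lambda>v. if v = u then 1 else 0)"

lemma supp_vertex_point: "supp (vertex_point u) = {u}"
  by (auto simp: vertex_point_def)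

lemma vertex_point_realization: "u \<in> V \<Longrightarrow> vertex_point u \<in> P"
  by (rule realization_pointI[of _ "{u}"]) (auto simp: vertex_point_def intro: simplexI)

text \<open>A map whose values involve only finitely many vertices is continuous for the weak topology
  iff it is continuous for the product topology, and compactness forces finiteness.\<close>

definition tame :: "'b::topological_space set \<Rightarrow> ('b \<Rightarrow> 'a \<Rightarrow> real) \<Rightarrow> bool" where
  "tame S h \<longleftrightarrow> continuous_on S h \<and> h ` S \<subseteq> P \<and> (\<exists>W. finite W \<and> (\<forall>z\<in>S. supp (h z) \<subseteq> W))"

lemma tame_realization_point: "tame S h \<Longrightarrow> z \<in> S \<Longrightarrow> h z \<in> P"
  unfolding tame_def by blast

lemma closed_closed_simplex:
  assumes "\<sigma> \<in> X" shows "closed (closed_simplex X \<sigma>)"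
proof -
  have "closed_simplex X \<sigma> = (\<Inter>v. {p. 0 \<le> p v}) \<inter> (\<Inter>v\<in>-\<sigma>. {p. p v = 0}) \<inter> {p. sum p \<sigma> = 1}"
    (is "_ = ?r")
  proof (intro set_eqI iffI)
    fix p assume "p \<in> closed_simplex X \<sigma>"
    then have p: "p \<in> P" "supp p \<subseteq> \<sigma>" unfolding closed_simplex_def by auto
    then show "p \<in> ?r" using realization_pointD(1) realization_point_sum[OF p simplex_finite[OF assms]] by auto
  next
    fix p assume p: "p \<in> ?r"
    then have "p \<in> P" by (intro realization_pointI[OF _ _ assms]) auto
    then show "p \<in> closed_simplex X \<sigma>" using p unfolding closed_simplex_def by auto
  qed
  moreover have "closed ?r"
    by (intro closed_Int closed_INT ballI closed_Collect_le closed_Collect_eq continuous_intros continuous_on_sum) auto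
  ultimately show ?thesis by simp
qed

text \<open>The image lies in the closed simplices on subsets of \<open>W\<close>. There are
  finitely many, so the preimage of a closed set is a finite union of closed sets.\<close>

lemma tame_imp_continuous_map:
  assumes "tame S h" shows "continuous_map (top_of_set S) R h"
proof -
  obtain W where W: "finite W" "\<And>z. z \<in> S \<Longrightarrow> supp (h z) \<subseteq> W" and c: "continuous_on S h" and P: "h ` S \<subseteq> P"
    using assms unfolding tame_def by blast
  have "closedin (top_of_set S) {z \<in> S. h z \<in> C}" if C: "closedin R C" for C
  proof -
    have cs: "closed (C \<inter> closed_simplex X \<sigma>)" if s: "\<sigma> \<in> X" for \<sigma>
    proof -
      have "openin R (P - C)" using C by (simp add: closedin_def topspace_realization)
      then have "openin (top_of_set (closed_simplex X \<sigma>)) ((P - C) \<inter> closed_simplex X \<sigma>)"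
        using s unfolding openin_realization by blast
      moreover have "C \<inter> closed_simplex X \<sigma> = closed_simplex X \<sigma> - (P - C) \<inter> closed_simplex X \<sigma>"
        using C closedin_subset[OF C] by (auto simp: closed_simplex_def)
      ultimately have "closedin (top_of_set (closed_simplex X \<sigma>)) (C \<inter> closed_simplex X \<sigma>)"
        by (simp add: closedin_diff)
      then show ?thesis using closed_closed_simplex[OF s] closedin_closed_trans by blast
    qed
    have "{z \<in> S. h z \<in> C} = (\<Union>\<sigma>\<in>X \<inter> Pow W. S \<inter> h -` (C \<inter> closed_simplex X \<sigma>))"
    proof (intro set_eqI iffI)
      fix z assume z: "z \<in> {z \<in> S. h z \<in> C}"
      then have "h z \<in> P" using P by auto
      then have "supp (h z) \<in> X \<inter> Pow W" "h z \<in> closed_simplex X (supp (h z))"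
        using z realization_pointD W unfolding closed_simplex_def by auto
      then show "z \<in> (\<Union>\<sigma>\<in>X \<inter> Pow W. S \<inter> h -` (C \<inter> closed_simplex X \<sigma>))" using z by blast
    qed auto
    moreover have "closedin (top_of_set S) (\<Union>\<sigma>\<in>X \<inter> Pow W. S \<inter> h -` (C \<inter> closed_simplex X \<sigma>))"
      using W cs by (intro closedin_Union) (auto simp del: vimage_Int intro!: continuous_closedin_preimage[OF c])
    ultimately show ?thesis by simp
  qed
  then show ?thesis unfolding continuous_map_closedin using P by (auto simp: topspace_realization)
qed

text \<open>Choose one point of \<open>K\<close> for each support. A closed simplex contains only
  finitely many chosen points, so every set of chosen points is closed in the weak topology. Hence
  the chosen points form a compact discrete set.\<close>

lemma compact_realization_finite:
  assumes K: "compactin R K" shows "finite (supp ` K)"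
proof -
  define pick where "pick \<tau> = (SOME p. p \<in> K \<and> supp p = \<tau>)" for \<tau>
  have pick: "pick \<tau> \<in> K" "supp (pick \<tau>) = \<tau>" if "\<tau> \<in> supp ` K" for \<tau>
    using someI_ex[of "\<lambda>p. p \<in> K \<and> supp p = \<tau>"] that unfolding pick_def by auto
  define Q where "Q = pick ` supp ` K"
  have KP: "K \<subseteq> P" using compactin_subset_topspace[OF K] by (simp add: topspace_realization)
  have QK: "Q \<subseteq> K" using pick unfolding Q_def by blast
  have op: "openin R (P - A)" if A: "A \<subseteq> Q" for A
    unfolding openin_realization
  proof (intro conjI ballI)
    fix \<sigma> assume s: "\<sigma> \<in> X"
    have "A \<inter> closed_simplex X \<sigma> \<subseteq> pick ` Pow \<sigma>"
    proof
      fix p assume p: "p \<in> A \<inter> closed_simplex X \<sigma>"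
      then obtain \<tau> where "\<tau> \<in> supp ` K" "p = pick \<tau>" using A unfolding Q_def by blast
      moreover have "supp p \<subseteq> \<sigma>" using p unfolding closed_simplex_def by auto
      ultimately show "p \<in> pick ` Pow \<sigma>" using pick(2) by auto
    qed
    then have "finite (A \<inter> closed_simplex X \<sigma>)"
      using simplex_finite[OF s] finite_subset by blast
    then have "open (- (A \<inter> closed_simplex X \<sigma>))"
      by (intro open_Compl finite_imp_closed_fun)
    moreover have "(P - A) \<inter> closed_simplex X \<sigma> = closed_simplex X \<sigma> \<inter> - (A \<inter> closed_simplex X \<sigma>)"
      unfolding closed_simplex_def by auto
    ultimately show "openin (top_of_set (closed_simplex X \<sigma>)) ((P - A) \<inter> closed_simplex X \<sigma>)"
      by (metis openin_open_Int)
  qed simp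
  have "closedin R Q"
    using op[of Q] QK KP by (simp add: closedin_def topspace_realization)
  then have Qc: "compactin R Q" using closed_compactin[OF K QK] by blast
  \<comment> \<open>Each of these open sets contains exactly one point of \<open>Q\<close>.\<close>
  have "\<exists>\<F>. finite \<F> \<and> \<F> \<subseteq> (\<lambda>q. P - (Q - {q})) ` Q \<and> Q \<subseteq> \<Union>\<F>"
  proof -
    have "\<forall>U\<in>(\<lambda>q. P - (Q - {q})) ` Q. openin R U" using op by auto
    moreover have "Q \<subseteq> \<Union>((\<lambda>q. P - (Q - {q})) ` Q)" using QK KP by auto
    ultimately show ?thesis using Qc unfolding compactin_def by blast
  qed
  then obtain \<F> where F: "finite \<F>" "\<F> \<subseteq> (\<lambda>q. P - (Q - {q})) ` Q" "Q \<subseteq> \<Union>\<F>" by blast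
  then obtain Q0 where Q0: "finite Q0" "Q0 \<subseteq> Q" "\<F> = (\<lambda>q. P - (Q - {q})) ` Q0"
    by (metis finite_subset_image)
  have "Q \<subseteq> Q0" using F(3) unfolding Q0(3) by blast
  then have "finite Q" using Q0 finite_subset by blast
  moreover have "supp ` K \<subseteq> supp ` Q"
  proof
    fix \<tau> assume t: "\<tau> \<in> supp ` K"
    show "\<tau> \<in> supp ` Q"
    proof (rule image_eqI)
      show "\<tau> = supp (pick \<tau>)" by (rule pick(2)[OF t, symmetric])
      show "pick \<tau> \<in> Q" unfolding Q_def using t by (rule imageI)
    qed
  qed
  ultimately show ?thesis using finite_subset by blast
qed

text \<open>The weak topology is finer than the product topology, which gives continuity;
  compactness of the image gives the finite vertex set.\<close>

lemma continuous_map_imp_tame: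
  assumes c: "continuous_map (top_of_set S) R h" and S: "compact S"
  shows "tame S h"
  unfolding tame_def
proof (intro conjI)
  show P: "h ` S \<subseteq> P"
    using continuous_map_image_subset_topspace[OF c] by (simp add: topspace_realization)
  have "continuous_map (top_of_set S) euclidean h"
    unfolding continuous_map_def
  proof (intro conjI allI impI)
    fix W :: "('a \<Rightarrow> real) set" assume W: "openin euclidean W"
    have "openin R (W \<inter> P)" unfolding openin_realization
    proof (intro conjI ballI)
      fix \<sigma> assume "\<sigma> \<in> X"
      have "W \<inter> P \<inter> closed_simplex X \<sigma> = closed_simplex X \<sigma> \<inter> W" unfolding closed_simplex_def by auto
      then show "openin (top_of_set (closed_simplex X \<sigma>)) (W \<inter> P \<inter> closed_simplex X \<sigma>)"
        using W by (simp add: openin_open_Int)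
    qed simp
    then have "openin (top_of_set S) {x \<in> topspace (top_of_set S). h x \<in> W \<inter> P}"
      using c unfolding continuous_map_def by blast
    moreover have "{x \<in> topspace (top_of_set S). h x \<in> W \<inter> P} = {x \<in> topspace (top_of_set S). h x \<in> W}"
      using P by auto
    ultimately show "openin (top_of_set S) {x \<in> topspace (top_of_set S). h x \<in> W}" by simp
  qed simp
  then show "continuous_on S h" by (simp add: continuous_map_iff_continuous)
  have "compactin R (h ` S)"
    by (rule image_compactin[OF _ c]) (simp add: S compactin_subtopology)
  then have f: "finite (supp ` h ` S)" by (rule compact_realization_finite)
  have "finite (\<Union>(supp ` h ` S))"
    by (rule finite_Union[OF f]) (use P realization_pointD(2) simplex_finite in blast)
  then show "\<exists>W. finite W \<and> (\<forall>z\<in>S. supp (h z) \<subseteq> W)" by blast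
qed

lemma tame_coordinate: "tame S h \<Longrightarrow> continuous_on S (\<lambda>z. h z v)"
  by (rule continuous_on_product_then_coordinatewise) (simp add: tame_def)

lemma tame_compose:
  assumes "tame S h" "continuous_on T k" "k ` T \<subseteq> S" shows "tame T (\<lambda>z. h (k z))"
  unfolding tame_def
proof (intro conjI)
  show "continuous_on T (\<lambda>z. h (k z))"
    by (rule continuous_on_compose2[OF _ assms(2,3)]) (use assms(1) in \<open>simp add: tame_def\<close>)
  show "(\<lambda>z. h (k z)) ` T \<subseteq> P" using tame_realization_point[OF assms(1)] assms(3) by blast
  obtain W where W: "finite W" "\<And>z. z \<in> S \<Longrightarrow> supp (h z) \<subseteq> W" using assms(1) unfolding tame_def by blast
  then show "\<exists>W. finite W \<and> (\<forall>z\<in>T. supp (h (k z)) \<subseteq> W)"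
    using assms(3) by (intro exI[of _ W] conjI ballI W) auto
qed

lemma tame_straight_line:
  assumes f: "tame S f" and g: "tame S g" and s: "continuous_on S s" "\<And>z. z \<in> S \<Longrightarrow> 0 \<le> s z \<and> s z \<le> (1::real)"
    and simp: "\<And>z. z \<in> S \<Longrightarrow> supp (f z) \<union> supp (g z) \<in> X"
  shows "tame S (\<lambda>z v. (1 - s z) * f z v + s z * g z v)"
  unfolding tame_def
proof (intro conjI)
  show "continuous_on S (\<lambda>z v. (1 - s z) * f z v + s z * g z v)"
    by (intro continuous_on_coordinatewise_then_product continuous_intros s tame_coordinate[OF f] tame_coordinate[OF g])
  show "(\<lambda>z v. (1 - s z) * f z v + s z * g z v) ` S \<subseteq> P"
    using realization_point_convex[OF tame_realization_point[OF f] tame_realization_point[OF g] simp] s by blast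
  obtain A where A: "finite A" "\<forall>z\<in>S. supp (f z) \<subseteq> A" using f unfolding tame_def by blast
  obtain B where B: "finite B" "\<forall>z\<in>S. supp (g z) \<subseteq> B" using g unfolding tame_def by blast
  have "\<forall>z\<in>S. supp (\<lambda>v. (1 - s z) * f z v + s z * g z v) \<subseteq> A \<union> B"
  proof (intro ballI subsetI)
    fix z v assume z: "z \<in> S" "v \<in> supp (\<lambda>v. (1 - s z) * f z v + s z * g z v)"
    then have "f z v \<noteq> 0 \<or> g z v \<noteq> 0" by auto
    then show "v \<in> A \<union> B" using A B z by blast
  qed
  then show "\<exists>W. finite W \<and> (\<forall>z\<in>S. supp (\<lambda>v. (1 - s z) * f z v + s z * g z v) \<subseteq> W)"
    using A B by blast
qed

text \<open>The set \<open>T v\<close> is the preimage of the open star of \<open>v\<close>, and the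
  star of \<open>lab z\<close> contains the image of the ball of radius \<delta> around
  \<open>z\<close> in \<open>K\<close>. So points closer than \<delta> have labels in one common
  support, hence equal or adjacent.\<close>

lemma tame_Lebesgue:
  fixes K :: "'b::metric_space set"
  assumes h: "tame K h" and K: "compact K"
  obtains \<delta> lab where "\<delta> > 0" "\<And>z z'. z \<in> K \<Longrightarrow> z' \<in> K \<Longrightarrow> dist z z' < \<delta> \<Longrightarrow> lab z \<in> supp (h z')"
proof -
  have "\<exists>T. open T \<and> K \<inter> (\<lambda>z. h z v) -` {0<..} = K \<inter> T" for v
    using tame_coordinate[OF h, of v] open_greaterThan
    unfolding continuous_on_open_invariant by (metis Int_commute)
  then obtain T where T: "\<And>v. open (T v)" "\<And>v. K \<inter> (\<lambda>z. h z v) -` {0<..} = K \<inter> T v" by metis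
  have "K \<subseteq> \<Union>(range T)"
  proof
    fix z assume z: "z \<in> K"
    then obtain v where "h z v \<noteq> 0" using supp_nonempty[OF tame_realization_point[OF h]] by blast
    then have "h z v > 0" using realization_pointD(1)[OF tame_realization_point[OF h z], of v] by simp
    then have "z \<in> K \<inter> T v" using z unfolding T(2)[symmetric] by simp
    then show "z \<in> \<Union>(range T)" by blast
  qed
  then obtain \<delta> where d: "\<delta> > 0" "\<And>z. z \<in> K \<Longrightarrow> \<exists>G\<in>range T. ball z \<delta> \<subseteq> G"
    using Heine_Borel_lemma[OF K, of "range T"] T(1) by blast
  have "\<forall>z\<in>K. \<exists>v. ball z \<delta> \<subseteq> T v" using d(2) by blast
  then obtain lab where l: "\<And>z. z \<in> K \<Longrightarrow> ball z \<delta> \<subseteq> T (lab z)" using bchoice[of K] by metis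
  show ?thesis
  proof (rule that[OF d(1)])
    fix z z' assume "z \<in> K" "z' \<in> K" "dist z z' < \<delta>"
    then have "z' \<in> K \<inter> T (lab z)" using l[of z] by (auto simp: subset_iff)
    then show "lab z \<in> supp (h z')" unfolding T(2)[symmetric] by simp
  qed
qed

definition fills :: "(complex \<Rightarrow> 'a \<Rightarrow> real) \<Rightarrow> bool" where
  "fills f \<longleftrightarrow> (\<exists>g. tame (cball 0 1) g \<and> (\<forall>z\<in>sphere 0 1. g z = f z))"

lemma simply_connected_iff_fills:
  "simply_connected_space R \<longleftrightarrow> path_connected_space R \<and> (\<forall>f. tame (sphere 0 1) f \<longrightarrow> fills f)"
proof -
  have "continuous_map (top_of_set (sphere 0 1)) R f \<longleftrightarrow> tame (sphere 0 1) f" for f :: "complex \<Rightarrow> _"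
    using tame_imp_continuous_map continuous_map_imp_tame compact_sphere by blast
  moreover have "continuous_map (top_of_set (cball 0 1)) R f \<longleftrightarrow> tame (cball 0 1) f" for f :: "complex \<Rightarrow> _"
    using tame_imp_continuous_map continuous_map_imp_tame compact_cball by blast
  ultimately show ?thesis unfolding simply_connected_space_def fills_def by simp
qed

text \<open>The filling of \<open>g\<close> is shrunk to the disc of radius 1/2, and the annulus
  around it carries the straight line homotopy from \<open>g\<close> to \<open>f\<close>, with
  parameter \<open>2 * norm z - 1\<close>.\<close>

lemma fills_contiguous:
  assumes f: "tame (sphere 0 1) f" and g: "tame (sphere 0 1) g"
    and simp: "\<And>z. z \<in> sphere 0 1 \<Longrightarrow> supp (f z) \<union> supp (g z) \<in> X" and "fills g"
  shows "fills f"
proof -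
  obtain G where G: "tame (cball 0 1) G" "\<And>z. z \<in> sphere 0 1 \<Longrightarrow> G z = g z"
    using \<open>fills g\<close> unfolding fills_def by blast
  define C :: "complex set" where "C = {z \<in> cball 0 1. 1/2 \<le> norm z}"
  define H where "H = (\<lambda>z v. (1 - (2 * norm z - 1)) * g (sgn z) v + (2 * norm z - 1) * f (sgn z) v)"
  define F where "F = (\<lambda>z. if norm z \<le> 1/2 then G (2 * z) else H z)"
  have sgn: "continuous_on C sgn" "sgn ` C \<subseteq> sphere 0 1"
    unfolding C_def by (auto intro!: continuous_intros simp: norm_sgn)
  have H: "tame C H" unfolding H_def
  proof (rule tame_straight_line)
    show "tame C (\<lambda>z. g (sgn z))" "tame C (\<lambda>z. f (sgn z))"
      using tame_compose[OF g sgn] tame_compose[OF f sgn] by auto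
    show "continuous_on C (\<lambda>z. 2 * cmod z - 1)" by (intro continuous_intros)
    show "0 \<le> 2 * cmod z - 1 \<and> 2 * cmod z - 1 \<le> 1" if "z \<in> C" for z using that unfolding C_def by auto
    show "supp (g (sgn z)) \<union> supp (f (sgn z)) \<in> X" if "z \<in> C" for z
      using simp[of "sgn z"] sgn(2) that by (auto simp: Un_commute)
  qed
  define D :: "complex set" where "D = {z \<in> cball 0 1. norm z \<le> 1/2}"
  have Gt: "tame D (\<lambda>z. G (2 * z))"
    by (rule tame_compose[OF G(1)]) (auto simp: D_def norm_mult intro!: continuous_intros)
  have "tame (cball 0 1) F"
    unfolding tame_def
  proof (intro conjI)
    show "continuous_on (cball 0 1) F" unfolding F_def
    proof (rule continuous_on_cases_le)
      show "continuous_on {z \<in> cball 0 1. cmod z \<le> 1/2} (\<lambda>z. G (2 * z))"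
        using Gt unfolding tame_def D_def by blast
      show "continuous_on {z \<in> cball 0 1. 1/2 \<le> cmod z} H"
        using H unfolding tame_def C_def by blast
      show "continuous_on (cball 0 1) cmod" by (intro continuous_intros)
      fix z :: complex assume z: "cmod z = 1/2"
      then have "2 * z = sgn z" by (simp add: sgn_div_norm scaleR_conv_of_real z)
      moreover have "sgn z \<in> sphere 0 1" using z by (auto simp: norm_sgn)
      ultimately show "G (2 * z) = H z" using G(2)[of "sgn z"] unfolding H_def by (simp add: z)
    qed
    have c: "z \<in> D \<or> z \<in> C \<and> \<not> cmod z \<le> 1/2" if "z \<in> cball 0 1" for z using that unfolding C_def D_def by auto
    have FG: "F z = G (2 * z)" if "z \<in> D" for z using that unfolding D_def F_def by simp
    have FH: "F z = H z" if "\<not> cmod z \<le> 1/2" for z using that unfolding F_def by simp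
    show "F ` cball 0 1 \<subseteq> P"
    proof
      fix p assume "p \<in> F ` cball 0 1"
      then obtain z where z: "z \<in> cball 0 1" "p = F z" by blast
      show "p \<in> P" using c[OF z(1)] FG[of z] FH[of z] z tame_realization_point[OF Gt] tame_realization_point[OF H] by auto
    qed
    obtain A where A: "finite A" "\<And>z. z\<in>D \<Longrightarrow> supp (G (2 * z)) \<subseteq> A" using Gt unfolding tame_def by blast
    obtain B where B: "finite B" "\<And>z. z\<in>C \<Longrightarrow> supp (H z) \<subseteq> B" using H unfolding tame_def by blast
    have "supp (F z) \<subseteq> A \<union> B" if z: "z \<in> cball 0 1" for z
      using c[OF z]
    proof
      assume "z \<in> D" then show ?thesis using A(2)[of z] FG[of z] by auto
    next
      assume "z \<in> C \<and> \<not> cmod z \<le> 1/2" then show ?thesis using B(2)[of z] FH[of z] by auto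
    qed
    then show "\<exists>W. finite W \<and> (\<forall>z\<in>cball 0 1. supp (F z) \<subseteq> W)" using A B by blast
  qed
  moreover have "F z = f z" if "z \<in> sphere 0 1" for z
    using that unfolding F_def H_def by (simp add: sgn_div_norm)
  ultimately show ?thesis unfolding fills_def by blast
qed

lemma path_component_of_tame:
  fixes g :: "real \<Rightarrow> 'a \<Rightarrow> real"
  assumes "tame {0..1} g" shows "path_component_of R (g 0) (g 1)"
proof -
  have "pathin R g" unfolding pathin_def by (rule tame_imp_continuous_map[OF assms])
  then show ?thesis unfolding path_component_of_def by blast
qed

lemma tame_const:
  assumes "p \<in> P" shows "tame S (\<lambda>_. p)"
  unfolding tame_def using assms realization_pointD(2) simplex_finite by (auto intro!: exI[of _ "supp p"])

lemma path_component_segment: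
  assumes "p \<in> P" "q \<in> P" "supp p \<union> supp q \<in> X" shows "path_component_of R p q"
proof -
  have "tame {0..1::real} (\<lambda>z v. (1 - z) * p v + z * q v)"
    by (rule tame_straight_line[of _ "\<lambda>_. p" "\<lambda>_. q"]) (use assms tame_const in \<open>auto intro!: continuous_intros\<close>)
  from path_component_of_tame[OF this] show ?thesis by simp
qed

lemma path_connected_realization: "path_connected_space R"
  unfolding path_connected_space_iff_path_component topspace_realization
proof (intro ballI)
  fix p q assume pq: "p \<in> P" "q \<in> P"
  obtain u v where uv: "u \<in> supp p" "v \<in> supp q" using supp_nonempty pq by blast
  have V: "u \<in> V" "v \<in> V" using uv realization_pointD(2) pq simplex_subset_V by blast+
  have 1: "path_component_of R p (vertex_point u)" 
    using uv realization_pointD(2)[OF pq(1)] vertex_point_realization[OF V(1)] pq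
    by (intro path_component_segment) (auto simp: supp_vertex_point insert_absorb)
  have 2: "path_component_of R (vertex_point v) q"
    using uv realization_pointD(2)[OF pq(2)] vertex_point_realization[OF V(2)] pq
    by (intro path_component_segment) (auto simp: supp_vertex_point insert_absorb)
  have "(u, v) \<in> (edges (one_skeleton X))\<^sup>*" using connected V unfolding connected_graph_def by blast
  then have "path_component_of R (vertex_point u) (vertex_point v)"
  proof (induction rule: rtrancl_induct)
    case base
    then show ?case using vertex_point_realization[OF V(1)] by (simp add: path_component_of_refl topspace_realization)
  next
    case (step y z)
    then have "y \<in> V" "z \<in> V" "{y, z} \<in> X" using adj_verts adj_iff by blast+
    then have "path_component_of R (vertex_point y) (vertex_point z)"
      using vertex_point_realization by (intro path_component_segment) (auto simp: supp_vertex_point insert_commute)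
    then show ?case by (rule path_component_of_trans[OF step.IH])
  qed
  then show "path_component_of R p q"
    by (rule path_component_of_trans[OF path_component_of_trans[OF 1] 2])
qed

end

subsection \<open>Piecewise linear loops\<close>

context conn_flag begin

text \<open>A sum of tent functions centred at the integers, collected by the vertex visited there.
  In this form continuity in \<open>u\<close> is immediate, also where a vertex occurs
  repeatedly.\<close>

definition pl :: "(nat \<Rightarrow> 'a) \<Rightarrow> nat \<Rightarrow> real \<Rightarrow> 'a \<Rightarrow> real" where
  "pl c m u = (\<lambda>v. \<Sum>k | k \<le> m \<and> c k = v. max 0 (1 - \<bar>u - real k\<bar>))"

lemma pl_segment:
  assumes "k < m" "real k \<le> u" "u \<le> real k + 1"
  shows "pl c m u = (\<lambda>v. (1 - (u - real k)) * vertex_point (c k) v + (u - real k) * vertex_point (c (Suc k)) v)"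
proof
  fix v
  let ?g = "\<lambda>j. if c j = v then max 0 (1 - \<bar>u - real j\<bar>) else 0"
  have z: "max 0 (1 - \<bar>u - real j\<bar>) = 0" if "j \<noteq> k" "j \<noteq> Suc k" for j
  proof -
    have "real j + 1 \<le> real k \<or> real k + 2 \<le> real j"
      using that by (cases "j < k") linarith+
    then show ?thesis using assms by auto
  qed
  have "pl c m u v = (\<Sum>j\<in>{j \<in> {..m}. c j = v}. max 0 (1 - \<bar>u - real j\<bar>))"
    unfolding pl_def by (rule sum.cong) auto
  also have "\<dots> = sum ?g {..m}" by (rule sum.inter_filter) simp
  also have "\<dots> = sum ?g {k, Suc k}"
    using assms(1) z by (intro sum.mono_neutral_right) auto
  also have "\<dots> = (1 - (u - real k)) * vertex_point (c k) v + (u - real k) * vertex_point (c (Suc k)) v"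
    using assms by (auto simp: vertex_point_def)
  finally show "pl c m u v = (1 - (u - real k)) * vertex_point (c k) v + (u - real k) * vertex_point (c (Suc k)) v" .
qed

lemma pl_vertex: "0 < m \<Longrightarrow> k \<le> m \<Longrightarrow> pl c m (real k) = vertex_point (c k)"
  using pl_segment[of k m "real k" c] pl_segment[of "m - 1" m "real m" c]
  by (cases "k = m") (auto simp: vertex_point_def of_nat_diff)

lemma supp_pl_segment:
  assumes "k < m" "real k \<le> u" "u \<le> real k + 1"
  shows "supp (pl c m u) \<subseteq> {c k, c (Suc k)}"
  unfolding pl_segment[OF assms] by (auto simp: vertex_point_def)

definition closed_walk :: "(nat \<Rightarrow> 'a) \<Rightarrow> nat \<Rightarrow> bool" where
  "closed_walk c m \<longleftrightarrow> 0 < m \<and> c 0 = c m \<and> (\<forall>k\<le>m. c k \<in> V) \<and> (\<forall>k<m. adjeq (c k) (c (Suc k)))"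

lemma closed_walkD:
  assumes "closed_walk c m"
  shows "0 < m" "c 0 = c m" "\<And>k. k \<le> m \<Longrightarrow> c k \<in> V" "\<And>k. k < m \<Longrightarrow> adjeq (c k) (c (Suc k))"
  using assms unfolding closed_walk_def by blast+

lemma step_simplex:
  assumes "closed_walk c m" "k < m" shows "{c k, c (Suc k)} \<in> X"
proof (rule simplexI)
  show "{c k, c (Suc k)} \<subseteq> V" using closed_walkD(3)[OF assms(1)] assms(2) by auto
  fix x y assume "x \<in> {c k, c (Suc k)}" "y \<in> {c k, c (Suc k)}"
  then show "adjeq x y"
    using closed_walkD(4)[OF assms] adj_sym by (elim insertE emptyE) metis+
qed

definition loop :: "(nat \<Rightarrow> 'a) \<Rightarrow> nat \<Rightarrow> complex \<Rightarrow> 'a \<Rightarrow> real" where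
  "loop c m z = pl c m (real m * (Arg2pi z / (2 * pi)))"

lemma Arg2pi_segment:
  assumes "0 < m"
  obtains k where "k < m" "real k \<le> real m * (Arg2pi z / (2 * pi))" "real m * (Arg2pi z / (2 * pi)) \<le> real k + 1"
proof -
  let ?u = "real m * (Arg2pi z / (2 * pi))"
  have a: "0 \<le> Arg2pi z / (2 * pi)" "Arg2pi z / (2 * pi) < 1"
    using Arg2pi_ge_0[of z] Arg2pi_lt_2pi[of z] by auto
  then have u: "0 \<le> ?u" "?u < real m" 
    using mult_nonneg_nonneg[OF _ a(1), of "real m"] mult_strict_left_mono[OF a(2), of "real m"] assms
    by (simp_all del: times_divide_eq_right)
  have "real (nat \<lfloor>?u\<rfloor>) \<le> ?u" "?u \<le> real (nat \<lfloor>?u\<rfloor>) + 1" using u(1) by linarith+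
  moreover from this u have "nat \<lfloor>?u\<rfloor> < m" by linarith
  ultimately show ?thesis using that by blast
qed

lemma pl_realization_point:
  assumes "closed_walk c m" "k < m" "real k \<le> u" "u \<le> real k + 1"
  shows "pl c m u \<in> P"
proof -
  have "c k \<in> V" "c (Suc k) \<in> V" using closed_walkD(3)[OF assms(1)] assms(2) by auto
  moreover have "{c k} \<union> {c (Suc k)} \<in> X" using step_simplex[OF assms(1,2)] by (simp add: insert_commute)
  ultimately show ?thesis unfolding pl_segment[OF assms(2-4)]
    using assms(3,4) by (intro realization_point_convex vertex_point_realization) (simp_all add: supp_vertex_point)
qed

lemma loop_tame:
  assumes c: "closed_walk c m" shows "tame (sphere 0 1) (loop c m)"
  unfolding tame_def
proof (intro conjI)
  have m: "0 < m" using closed_walkD(1)[OF c] .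
  have "continuous_on {0..1} (\<lambda>t. pl c m (real m * t))"
    unfolding pl_def by (intro continuous_on_coordinatewise_then_product continuous_intros)
  moreover have "pl c m (real m * 0) = pl c m (real m * 1)"
    using pl_vertex[OF m, of 0 c] pl_vertex[OF m, of m c] closed_walkD(2)[OF c] by simp
  ultimately show "continuous_on (sphere 0 1) (loop c m)"
    unfolding loop_def[abs_def] by (rule continuous_on_circle_of_loop)
  show "loop c m ` sphere 0 1 \<subseteq> P"
  proof
    fix p assume "p \<in> loop c m ` sphere 0 1"
    then obtain z where "p = loop c m z" by blast
    then show "p \<in> P" using Arg2pi_segment[OF m, of z] pl_realization_point[OF c] unfolding loop_def by metis
  qed
  have "supp (loop c m z) \<subseteq> c ` {..m}" for z
  proof -
    obtain k where "k < m" "real k \<le> real m * (Arg2pi z / (2 * pi))" "real m * (Arg2pi z / (2 * pi)) \<le> real k + 1"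
      using Arg2pi_segment[OF m] by blast
    from supp_pl_segment[OF this, of c] \<open>k < m\<close> show ?thesis unfolding loop_def by (auto simp: subset_iff)
  qed
  then show "\<exists>W. finite W \<and> (\<forall>z\<in>sphere 0 1. supp (loop c m z) \<subseteq> W)" by (intro exI[of _ "c ` {..m}"]) simp
qed

text \<open>At \<open>t = 1\<close> the argument falls back to 0, and the equation holds because the
  walk is closed.\<close>

lemma loop_cis:
  assumes c: "closed_walk c m" and t: "0 \<le> t" "t \<le> 1"
  shows "loop c m (cis (2 * pi * t)) = pl c m (real m * t)"
proof (cases "t = 1")
  case True
  have m: "0 < m" using closed_walkD(1)[OF c] .
  have "loop c m (cis (2 * pi * t)) = pl c m 0"
    using True Arg2pi_of_real[of 1] unfolding loop_def by simp
  then show ?thesis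
    using pl_vertex[OF m, of 0 c] pl_vertex[OF m, of m c] closed_walkD(2)[OF c] True by simp
next
  case False
  then have "Arg2pi (cis (2 * pi * t)) = 2 * pi * t" using t by (intro Arg2pi_cis) auto
  then show ?thesis unfolding loop_def by simp
qed

lemma fills_loop_contiguous:
  assumes c: "closed_walk c m" and c': "closed_walk c' m"
    and adj: "\<And>k. k < m \<Longrightarrow> adjeq (c k) (c' k) \<and> adjeq (c k) (c' (Suc k)) \<and> adjeq (c (Suc k)) (c' k) \<and> adjeq (c (Suc k)) (c' (Suc k))"
    and f: "fills (loop c' m)"
  shows "fills (loop c m)"
proof (rule fills_contiguous[OF loop_tame[OF c] loop_tame[OF c'] _ f])
  fix z
  have m: "0 < m" using closed_walkD(1)[OF c] .
  obtain k where k: "k < m" "real k \<le> real m * (Arg2pi z / (2 * pi))" "real m * (Arg2pi z / (2 * pi)) \<le> real k + 1"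
    using Arg2pi_segment[OF m] by blast
  have "{c k, c (Suc k), c' k, c' (Suc k)} \<in> X"
  proof (rule simplexI)
    show "{c k, c (Suc k), c' k, c' (Suc k)} \<subseteq> V"
      using closed_walkD(3)[OF c] closed_walkD(3)[OF c'] k by auto
    fix x y assume "x \<in> {c k, c (Suc k), c' k, c' (Suc k)}" "y \<in> {c k, c (Suc k), c' k, c' (Suc k)}"
    then show "adjeq x y"
      using adj[OF k(1)] closed_walkD(4)[OF c k(1)] closed_walkD(4)[OF c' k(1)] adj_sym
      by (elim insertE emptyE) metis+
  qed
  moreover have "supp (loop c m z) \<union> supp (loop c' m z) \<subseteq> {c k, c (Suc k), c' k, c' (Suc k)}"
    using supp_pl_segment[OF k, of c] supp_pl_segment[OF k, of c'] unfolding loop_def by blast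
  ultimately show "supp (loop c m z) \<union> supp (loop c' m z) \<in> X" using simplex_subset by blast
qed

lemma closed_walk_double:
  assumes c: "closed_walk c m" shows "closed_walk (\<lambda>j. c (j div 2)) (2 * m)"
  unfolding closed_walk_def
proof (intro conjI allI impI)
  note D = closed_walkD[OF c]
  fix k assume "k < 2 * m"
  then have "k div 2 < m" by auto
  moreover have "Suc k div 2 = k div 2 \<or> Suc k div 2 = Suc (k div 2)" by linarith
  ultimately show "adjeq (c (k div 2)) (c (Suc k div 2))" using D(4)[of "k div 2"] by auto
qed (use closed_walkD[OF c] in auto)

text \<open>The doubled loop pauses on the first half of each arc and moves on the second, so on the
  arc of step \<open>k\<close> both loops stay in the simplex of \<open>c k\<close> and
  \<open>c (Suc k)\<close>.\<close>

lemma fills_loop_double: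
  assumes c: "closed_walk c m" and f: "fills (loop (\<lambda>j. c (j div 2)) (2 * m))"
  shows "fills (loop c m)"
proof -
  let ?C = "\<lambda>j. c (j div 2)"
  note D = closed_walkD[OF c] and C = closed_walk_double[OF c]
  show "fills (loop c m)"
  proof (rule fills_contiguous[OF loop_tame[OF c] loop_tame[OF C] _ f])
    fix z
    define u where "u = real m * (Arg2pi z / (2 * pi))"
    obtain k where k: "k < m" "real k \<le> u" "u \<le> real k + 1"
      using Arg2pi_segment[OF D(1)] unfolding u_def by blast
    have u: "real (2 * m) * (Arg2pi z / (2 * pi)) = 2 * u" by (simp add: u_def)
    have "supp (loop ?C (2 * m) z) \<subseteq> {c k, c (Suc k)}"
    proof (cases "2 * u \<le> real (2 * k) + 1")
      case True
      then have "supp (pl ?C (2 * m) (2 * u)) \<subseteq> {?C (2 * k), ?C (Suc (2 * k))}"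
        using k by (intro supp_pl_segment) auto
      then show ?thesis unfolding loop_def u by auto
    next
      case False
      then have "supp (pl ?C (2 * m) (2 * u)) \<subseteq> {?C (Suc (2 * k)), ?C (Suc (Suc (2 * k)))}"
        using k by (intro supp_pl_segment) auto
      then show ?thesis unfolding loop_def u by auto
    qed
    moreover have "supp (loop c m z) \<subseteq> {c k, c (Suc k)}"
      using supp_pl_segment[OF k, of c] unfolding loop_def u_def by blast
    ultimately have "supp (loop c m z) \<union> supp (loop ?C (2 * m) z) \<subseteq> {c k, c (Suc k)}" by blast
    then show "supp (loop c m z) \<union> supp (loop ?C (2 * m) z) \<in> X"
      by (rule simplex_subset[OF step_simplex[OF c k(1)]])
  qed
qed

text \<open>The radius decreases by projection while the length of the walk doubles, hence the
  induction over \<open>i\<close> for all \<open>c\<close> and \<open>m\<close>. In radius 0 the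
  loop is constant.\<close>

lemma fills_loop_in_ball:
  assumes ve: vertex_edge and v: "v \<in> V"
  shows "closed_walk c m \<Longrightarrow> (\<And>k. k \<le> m \<Longrightarrow> gd v (c k) \<le> i) \<Longrightarrow> fills (loop c m)"
proof (induction i arbitrary: c m)
  case 0
  note D = closed_walkD[OF 0(1)]
  have c: "c k = v" if "k \<le> m" for k using 0(2)[OF that] gd_eq_0[OF v D(3)[OF that]] by auto
  have "loop c m z = vertex_point v" for z
  proof -
    obtain k where k: "k < m" "real k \<le> real m * (Arg2pi z / (2 * pi))" "real m * (Arg2pi z / (2 * pi)) \<le> real k + 1"
      using Arg2pi_segment[OF D(1)] by blast
    show ?thesis unfolding loop_def pl_segment[OF k] using c[of k] c[of "Suc k"] k(1) by (simp flip: distrib_right)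
  qed
  then show ?case unfolding fills_def
    using tame_const[OF vertex_point_realization[OF v]] by (intro exI[of _ "\<lambda>_. vertex_point v"]) simp
next
  case (Suc i)
  note D = closed_walkD[OF Suc.prems(1)]
  have e: "edge_cond v" "vertex_cond v" using ve v unfolding vertex_edge_def by auto
  define p where "p k = proj v i (c k) (c (Suc k))" for k
  \<comment> \<open>The value \<open>q k\<close> is the projection of the edge that ends at
    \<open>c k\<close>; at \<open>k = 0\<close> this is the last edge of the closed walk.\<close>
  define q where "q k = (if k = 0 then p (m - 1) else p (k - 1))" for k
  have gdc: "gd v (c k) \<le> Suc i" if "k \<le> m" for k using Suc.prems(2)[OF that] .
  have p: "p k \<in> V" "gd v (p k) \<le> i" "adjeq (p k) (c k)" "adjeq (p k) (c (Suc k))" if "k < m" for k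
    unfolding p_def using proj[OF v e(1) D(4)[OF that] D(3)[of k] gdc[of k] gdc[of "Suc k"]] that by auto
  have pp: "adjeq (proj v i a b) (proj v i b c')" if "adjeq a b" "adjeq b c'" "a \<in> V" "b \<in> V"
      "gd v a \<le> Suc i" "gd v b \<le> Suc i" "gd v c' \<le> Suc i" for a b c'
    using proj_adjeq[OF v e that] .
  have m1: "Suc (m - 1) = m" "m - 1 < m" using D(1) by auto
  have q0: "q (Suc k) = p k" for k unfolding q_def by simp
  have q: "q k \<in> V" "gd v (q k) \<le> i" "adjeq (q k) (c k)" if "k \<le> m" for k
  proof -
    have "q k \<in> V \<and> gd v (q k) \<le> i \<and> adjeq (q k) (c k)"
    proof (cases k)
      case 0
      then show ?thesis using p[OF m1(2)] D(2) unfolding q_def m1 by simp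
    next
      case (Suc j)
      then show ?thesis using p[of j] that unfolding q_def by simp
    qed
    then show "q k \<in> V" "gd v (q k) \<le> i" "adjeq (q k) (c k)" by auto
  qed
  have qq: "adjeq (q k) (q (Suc k))" if "k < m" for k
  proof (cases k)
    case 0
    have "adjeq (proj v i (c (m - 1)) (c 0)) (proj v i (c 0) (c 1))"
      using D(4)[OF m1(2)] D(4)[of 0] D(1,2) D(3)[of "m - 1"] D(3)[of 0] gdc[of "m - 1"] gdc[of 0] gdc[of 1] m1
      by (intro pp) auto
    then show ?thesis using 0 D(2) unfolding q_def p_def m1 by simp
  next
    case (Suc j)
    then have "adjeq (proj v i (c j) (c (Suc j))) (proj v i (c (Suc j)) (c (Suc (Suc j))))"
      using D(3,4) gdc that by (intro pp) auto
    then show ?thesis using Suc unfolding q_def p_def by simp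
  qed
  \<comment> \<open>\<open>c\<close> itself is not contiguous to its projection: \<open>c (k + 1)\<close> and \<open>q k\<close> need not be adjacent.
    Repeating every vertex makes the two walks move alternately.\<close>
  define C where "C = (\<lambda>j. c (j div 2))"
  define Q where "Q = (\<lambda>j. q (Suc j div 2))"
  have half: "Suc j div 2 \<le> m" if "j \<le> 2 * m" for j using that by linarith
  have step: "adjeq (C j) (Q j) \<and> adjeq (C j) (Q (Suc j)) \<and> adjeq (C (Suc j)) (Q j) \<and> adjeq (C (Suc j)) (Q (Suc j))
      \<and> adjeq (Q j) (Q (Suc j))" if j: "j < 2 * m" for j
  proof (cases "even j")
    case True
    then obtain k where k: "j = 2 * k" by (elim evenE)
    then have "k < m" using j by simp
    then have "adjeq (q k) (c k)" "adjeq (q (Suc k)) (c k)" "adjeq (q k) (q (Suc k))"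
      using q(3)[of k] p(3)[of k] qq[of k] q0 by auto
    then show ?thesis using k adj_sym unfolding C_def Q_def by auto
  next
    case False
    then obtain k where k: "j = Suc (2 * k)" using oddE by fastforce
    then have "k < m" using j by simp
    then have "adjeq (q (Suc k)) (c k)" "adjeq (q (Suc k)) (c (Suc k))"
      using p(3,4)[of k] q0 by auto
    then show ?thesis using k adj_sym unfolding C_def Q_def by auto
  qed
  have Qw: "closed_walk Q (2 * m)"
    unfolding closed_walk_def
  proof (intro conjI allI impI)
    show "Q 0 = Q (2 * m)" using m1 unfolding Q_def q_def by simp
    show "Q k \<in> V" if "k \<le> 2 * m" for k unfolding Q_def using q(1)[OF half[OF that]] .
    show "adjeq (Q k) (Q (Suc k))" if "k < 2 * m" for k using step[OF that] by blast
  qed (use D(1) in simp)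
  have "fills (loop Q (2 * m))"
    by (rule Suc.IH[OF Qw]) (use q(2) half in \<open>simp add: Q_def\<close>)
  moreover have Cw: "closed_walk C (2 * m)"
    unfolding C_def by (rule closed_walk_double[OF Suc.prems(1)])
  ultimately have "fills (loop C (2 * m))"
    using fills_loop_contiguous[OF Cw Qw] step by blast
  then show ?case using fills_loop_double[OF Suc.prems(1)] unfolding C_def by blast
qed

section \<open>Simplicial approximation of loops and discs\<close>

lemma dist_cis_2pi: "dist (cis (2 * pi * s)) (cis (2 * pi * t)) \<le> 2 * pi * \<bar>s - t\<bar>"
proof -
  have "\<bar>2 * pi * s - 2 * pi * t\<bar> = 2 * pi * \<bar>s - t\<bar>"
    by (simp add: abs_mult flip: right_diff_distrib)
  then show ?thesis using dist_cis_le[of "2 * pi * s" "2 * pi * t"] by simp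
qed

lemma cis_Arg2pi: "z \<in> sphere 0 1 \<Longrightarrow> cis (2 * pi * (Arg2pi z / (2 * pi))) = z"
  using complex_norm_eq_1_exp[of z] by (simp add: cis_conv_exp)

text \<open>The circle is cut into \<open>m\<close> arcs shorter than the Lebesgue number. Over each
  arc the labels of both ends belong to the support of every value of \<open>f\<close>, so
  \<open>f\<close> and the loop through the labels always share a simplex.\<close>

lemma vertex_edge_fills:
  assumes ve: vertex_edge and f: "tame (sphere 0 1) f"
  shows "fills f"
proof -
  obtain \<delta> lab where d: "\<delta> > 0"
    and lab: "\<And>z z'. z \<in> sphere 0 1 \<Longrightarrow> z' \<in> sphere 0 1 \<Longrightarrow> dist z z' < \<delta> \<Longrightarrow> lab z \<in> supp (f z')"
    using tame_Lebesgue[OF f compact_sphere] by blast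
  obtain m :: nat where m: "2 * pi / \<delta> < real m" using reals_Archimedean2 by blast
  have m0: "0 < m" using m d by (cases m) (auto simp: field_simps dest: order.strict_trans[of 0])
  have md: "2 * pi / real m < \<delta>" using m d m0 by (simp add: field_simps)
  define c where "c k = lab (cis (2 * pi * (real k / real m)))" for k
  have sp: "cis t \<in> sphere 0 1" for t by simp
  have cs: "{c k, c (Suc k)} \<subseteq> supp (f (cis (2 * pi * t)))"
    if k: "real k \<le> real m * t" "real m * t \<le> real k + 1" for k t
  proof -
    have "\<bar>real k / real m - t\<bar> \<le> 1 / real m" "\<bar>real (Suc k) / real m - t\<bar> \<le> 1 / real m"
    proof -
      have "real k / real m - t = (real k - real m * t) / real m"
        "real (Suc k) / real m - t = (real (Suc k) - real m * t) / real m"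
        using m0 by (simp_all add: field_simps)
      moreover have "\<bar>real k - real m * t\<bar> \<le> 1" "\<bar>real (Suc k) - real m * t\<bar> \<le> 1" using k by auto
      ultimately show "\<bar>real k / real m - t\<bar> \<le> 1 / real m" "\<bar>real (Suc k) / real m - t\<bar> \<le> 1 / real m"
        by (simp_all only: abs_divide abs_of_nat) (simp_all add: divide_right_mono)
    qed
    then have "2 * pi * \<bar>real k / real m - t\<bar> \<le> 2 * pi / real m" "2 * pi * \<bar>real (Suc k) / real m - t\<bar> \<le> 2 * pi / real m"
      using mult_left_mono[of _ "1 / real m" "2 * pi"] by fastforce+
    then have "dist (cis (2 * pi * (real k / real m))) (cis (2 * pi * t)) < \<delta>"
      "dist (cis (2 * pi * (real (Suc k) / real m))) (cis (2 * pi * t)) < \<delta>"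
      using md dist_cis_2pi[of "real k / real m" t] dist_cis_2pi[of "real (Suc k) / real m" t] by linarith+
    then show ?thesis unfolding c_def using lab[OF sp sp] by simp
  qed
  have fX: "supp (f z) \<in> X" if "z \<in> sphere 0 1" for z using realization_pointD(2)[OF tame_realization_point[OF f that]] .
  have pair: "{c k, c (Suc k)} \<in> X" for k
    using cs[of k "real k / real m"] m0 simplex_subset[OF fX[OF sp]] by simp
  have cw: "closed_walk c m" unfolding closed_walk_def
  proof (intro conjI allI impI)
    show "c 0 = c m" using m0 unfolding c_def by simp
    show "c k \<in> V" for k using simplex_subset_V[OF pair[of k]] by simp
    show "adjeq (c k) (c (Suc k))" for k using simplex_adjeq[OF pair[of k]] by simp
  qed (rule m0)
  \<comment> \<open>Any base point will do, since the finite walk lies in some ball around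
    it.\<close>
  obtain v where v: "v \<in> V" using closed_walkD(3)[OF cw, of 0] by blast
  define i where "i = Max ((\<lambda>k. gd v (c k)) ` {..m})"
  have "gd v (c k) \<le> i" if "k \<le> m" for k unfolding i_def using that by (intro Max_ge) auto
  then have "fills (loop c m)" using fills_loop_in_ball[OF ve v cw] by blast
  moreover have "supp (f z) \<union> supp (loop c m z) \<in> X" if z: "z \<in> sphere 0 1" for z
  proof -
    let ?t = "Arg2pi z / (2 * pi)"
    obtain k where k: "k < m" "real k \<le> real m * ?t" "real m * ?t \<le> real k + 1"
      using Arg2pi_segment[OF m0] by blast
    have "supp (loop c m z) \<subseteq> supp (f z)"
      using supp_pl_segment[OF k, of c] cs[OF k(2,3)] unfolding loop_def cis_Arg2pi[OF z] by blast
    then have "supp (f z) \<union> supp (loop c m z) = supp (f z)" by blast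
    then show ?thesis using fX[OF z] by simp
  qed
  ultimately show ?thesis using fills_contiguous[OF f loop_tame[OF cw]] by blast
qed

lemma vertex_edge_simply_connected: "vertex_edge \<Longrightarrow> simply_connected_space R"
  unfolding simply_connected_iff_fills using path_connected_realization vertex_edge_fills by blast

text \<open>The grid has \<open>N\<close> steps in radius and \<open>N\<close> in angle, and each
  grid point gets the label of a star. As \<open>N\<close> is a multiple of \<open>m\<close>, the
  vertices of the walk occur at grid points of the unit circle.\<close>

lemma fills_imp_null_homotopic:
  assumes c: "closed_walk c m" and f: "fills (loop c m)"
  shows "null_homotopic c m"
proof -
  note D = closed_walkD[OF c]
  obtain g where g: "tame (cball 0 1) g" "\<And>z. z \<in> sphere 0 1 \<Longrightarrow> g z = loop c m z"
    using f unfolding fills_def by blast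
  obtain \<delta> lab where d: "\<delta> > 0"
    and lab: "\<And>z z'. z \<in> cball 0 1 \<Longrightarrow> z' \<in> cball 0 1 \<Longrightarrow> dist z z' < \<delta> \<Longrightarrow> lab z \<in> supp (g z')"
    using tame_Lebesgue[OF g(1) compact_cball] by blast
  \<comment> \<open>Points in one cell differ by at most \<open>1 / N\<close> in radius and
    \<open>2 * pi / N\<close> along the circle, so \<open>(1 + 2 * pi) / N\<close> has to be below
    \<delta>.\<close>
  obtain s :: nat where s: "(1 + 2 * pi) / \<delta> < real s" using reals_Archimedean2 by blast
  have "0 < (1 + 2 * pi) / \<delta>" using d by (simp add: add_pos_pos)
  then have s0: "0 < s" using s by (cases s) auto
  define N where "N = m * s"
  have N0: "0 < N" using s0 D(1) by (simp add: N_def)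
  have "s \<le> N" using D(1) by (simp add: N_def)
  then have "(1 + 2 * pi) / \<delta> < real N" using s by linarith
  then have Nd: "(1 + 2 * pi) / real N < \<delta>" using d N0 by (simp add: field_simps)
  define w where "w j k = of_real (real j / real N) * cis (2 * pi * (real k / real N))" for j k
  define \<mu> where "\<mu> j k = lab (w j k)" for j k
  have wb: "w j k \<in> cball 0 1" if "j \<le> N" for j k
    
    unfolding w_def mem_cball_0 norm_mult norm_of_real norm_cis using that N0 by simp
  have close: "adjeq (\<mu> j k) (\<mu> j' k')"
    if j: "j \<le> N" "j' \<le> N" "\<bar>real j - real j'\<bar> \<le> 1" "\<bar>real k - real k'\<bar> \<le> 1" for j k j' k'
  proof -
    let ?z = "w j k" and ?z' = "w j' k'"
    let ?e = "cis (2 * pi * (real k / real N))" and ?e' = "cis (2 * pi * (real k' / real N))"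
    have "?z - ?z' = of_real (real j / real N) * (?e - ?e') + of_real (real j / real N - real j' / real N) * ?e'"
      unfolding w_def by (simp add: algebra_simps)
    then have "dist ?z ?z' \<le> norm (of_real (real j / real N) * (?e - ?e')) + norm (of_real (real j / real N - real j' / real N) * ?e')"
      unfolding dist_norm by (metis norm_triangle_ineq)
    also have "\<dots> = real j / real N * dist ?e ?e' + \<bar>real j / real N - real j' / real N\<bar>"
      unfolding norm_mult norm_of_real norm_cis dist_norm by simp
    also have "\<dots> \<le> 1 * (2 * pi / real N) + 1 / real N"
    proof (intro add_mono mult_mono)
      show "real j / real N \<le> 1" using j N0 by simp
      have "\<bar>real k / real N - real k' / real N\<bar> \<le> 1 / real N"
        using j(4) N0 by (simp add: abs_divide divide_right_mono flip: diff_divide_distrib)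
      then have "2 * pi * \<bar>real k / real N - real k' / real N\<bar> \<le> 2 * pi / real N"
        using mult_left_mono[of _ "1 / real N" "2 * pi"] by fastforce
      then show "dist ?e ?e' \<le> 2 * pi / real N"
        using dist_cis_2pi[of "real k / real N" "real k' / real N"] by linarith
      show "\<bar>real j / real N - real j' / real N\<bar> \<le> 1 / real N"
        using j(3) N0 by (simp add: abs_divide divide_right_mono flip: diff_divide_distrib)
    qed auto
    also have "\<dots> = (1 + 2 * pi) / real N" by (simp add: add_divide_distrib)
    finally have "dist ?z ?z' < \<delta>" using Nd by linarith
    then have "\<mu> j k \<in> supp (g ?z')" "\<mu> j' k' \<in> supp (g ?z')"
      unfolding \<mu>_def using lab wb j d by auto
    then show ?thesis using simplex_adjeq[OF realization_pointD(2)[OF tame_realization_point[OF g(1) wb[OF j(2)]]]] by blast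
  qed
  have top: "\<mu> N l \<in> {c k, c (Suc k)}" if k: "k < m" "k * s \<le> l" "l \<le> Suc k * s" for k l
  proof -
    have "Suc k * s \<le> m * s" using k(1) by (intro mult_le_mono1) simp
    then have l: "l \<le> N" using k unfolding N_def by simp
    have w: "w N l = cis (2 * pi * (real l / real N))" using N0 unfolding w_def by simp
    have u: "real m * (real l / real N) = real l / real s" using D(1) by (simp add: N_def)
    have "real (k * s) \<le> real l" "real l \<le> real (Suc k * s)" using k(2,3) of_nat_le_iff by blast+
    then have "real k \<le> real l / real s" "real l / real s \<le> real k + 1" using s0 by (simp_all add: field_simps)
    then have "supp (pl c m (real l / real s)) \<subseteq> {c k, c (Suc k)}" using k(1) by (intro supp_pl_segment)
    moreover have "g (w N l) = pl c m (real l / real s)"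
      using g(2)[of "w N l"] loop_cis[OF c, of "real l / real N"] l N0 unfolding w u by simp
    moreover have "\<mu> N l \<in> supp (g (w N l))" unfolding \<mu>_def using lab wb d by simp
    ultimately show ?thesis by (metis subsetD)
  qed
  \<comment> \<open>At the corner \<open>k * s\<close> the loop is at a vertex point, whose support
    is a singleton, so the label is forced.\<close>
  have top_vertex: "\<mu> N (k * s) = c k" if k: "k \<le> m" for k
  proof -
    have l: "k * s \<le> N" using k by (simp add: N_def)
    have w: "w N (k * s) = cis (2 * pi * (real (k * s) / real N))" using N0 unfolding w_def by simp
    have u: "real m * (real (k * s) / real N) = real k" using D(1) s0 by (simp add: N_def)
    have "real (k * s) / real N \<le> 1" using l N0 by (simp del: of_nat_mult)
    then have "g (w N (k * s)) = vertex_point (c k)"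
      using g(2)[of "w N (k * s)"] loop_cis[OF c, of "real (k * s) / real N"] pl_vertex[OF D(1) k, of c] unfolding w u by simp
    moreover have "\<mu> N (k * s) \<in> supp (g (w N (k * s)))" unfolding \<mu>_def using lab wb d by simp
    ultimately show ?thesis using supp_vertex_point[of "c k"] by simp
  qed
  have "null_homotopy c m N s \<mu>"
    unfolding null_homotopy_def
  proof (intro conjI allI impI)
    show "adjeq (\<mu> j k) (\<mu> j (Suc k))" if "j \<le> N" for j k using close[of j j k "Suc k"] that by simp
    show "adjeq (\<mu> j k) (\<mu> (Suc j) k)" if "j < N" for j k using close[of j "Suc j" k k] that by simp
    show "adjeq (\<mu> j k) (\<mu> (Suc j) (Suc k))" if "j < N" for j k using close[of j "Suc j" k "Suc k"] that by simp
    show "\<mu> 0 k = \<mu> 0 0" for k unfolding \<mu>_def w_def by simp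
    show "\<mu> j (m * s) = \<mu> j 0" for j using N0 unfolding \<mu>_def w_def N_def[symmetric] by simp
    show "\<mu> N (k * s) = c k" if "k \<le> m" for k using top_vertex[OF that] .
    show "\<mu> N l \<in> {c k, c (Suc k)}" if "k < m" "k * s \<le> l \<and> l \<le> Suc k * s" for k l using top that by blast
  qed
  then show ?thesis unfolding null_homotopic_def by blast
qed

lemma simply_connected_null_homotopic:
  assumes "simply_connected_space R" "c 0 = c m" "\<And>k. k \<le> m \<Longrightarrow> c k \<in> V"
    "\<And>k. k < m \<Longrightarrow> adjeq (c k) (c (Suc k))"
  shows "null_homotopic c m"
proof (cases "m = 0")
  \<comment> \<open>A walk without edges is no \<open>closed_walk\<close>, which divides the circle
    into \<open>m\<close> arcs; a single grid point serves instead, up to one idle column per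
    step.\<close>
  case True
  have "null_homotopy c 0 0 1 (\<lambda>_ _. c 0)" unfolding null_homotopy_def by simp
  then show ?thesis using True unfolding null_homotopic_def by blast
next
  case False
  then have c: "closed_walk c m" using assms unfolding closed_walk_def by simp
  then show ?thesis
    using fills_imp_null_homotopic[OF c] loop_tame[OF c] assms(1) unfolding simply_connected_iff_fills by blast
qed

end

lemma (in conn_flag) simply_connected_vertex_edge:
  assumes "simply_connected_space R" "W5hat_condition (one_skeleton X)" no_C4
  shows vertex_edge
  by (rule local_global_vertex_edge[OF assms(3,2) simply_connected_null_homotopic[OF assms(1)]])

theorem theoremA:
  fixes X :: "'a set set"
  assumes "flag_complex X"
    and "connected_graph (one_skeleton X)"
  shows "(weakly_systolic X \<longleftrightarrow>
            weakly_modular (one_skeleton X) \<and> no_induced_C4 (one_skeleton X)) \<and>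
         (weakly_systolic X \<longleftrightarrow>
            weakly_modular (one_skeleton X) \<and> has_convex_balls (one_skeleton X)) \<and>
         (weakly_systolic X \<longleftrightarrow>
            has_convex_balls (one_skeleton X) \<and> induced_C5_in_W5 (one_skeleton X)) \<and>
         (weakly_systolic X \<longleftrightarrow>
            simply_connected_space (realization X) \<and> W5hat_condition (one_skeleton X) \<and>
            no_induced_C4 (one_skeleton X))"
proof -
  interpret conn_flag X using assms by unfold_locales
  note facts = vertex_edge_weakly_modular vertex_edge_no_C4 vertex_edge_convex_balls
    vertex_edge_C5_in_W5 vertex_edge_simply_connected vertex_edge_W5hat
    weakly_modular_no_C4_vertex_edge weakly_modular_convex_vertex_edge convex_C5_vertex_edge
    simply_connected_vertex_edge
  show ?thesis
    unfolding weakly_systolic_iff_vertex_edge no_induced_C4_iff using facts by blast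
qed

end
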